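(* Let $n\geq 2$ and let $\theta:\mathbb{R}\times\mathbb{C}^n\rightarrow\mathbb{C}^n$ be a continuous action of the group $(\mathbb{R},+)$ on $\mathbb{C}^n$ such that for each $t\in\mathbb{R}$ the map $\theta_t=\theta(t,\cdot):\mathbb{C}^n\rightarrow\mathbb{C}^n$ is holomorphic. Let $\Omega$ be a Stein domain in $\mathbb{C}^n$ such that $\Omega$ is invariant under $\theta_t$ for all $t\geq 0$ (i.e. $\theta_t(\Omega)\subset\Omega$) and such that for every $z\in\mathbb{C}^n$ the orbit $\{\theta_t(z):t\in\mathbb{R}\}$ intersects $\Omega$. Then $\mathcal{E}_{\mathcal{R}}(\Omega,\mathbb{C}^n)\subset\overline{Aut(\mathbb{C}^n)}|_{\Omega}$ in $\mathcal{E}(\Omega,\mathbb{C}^n)$.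
   Context: For open sets $\Omega\subset\tilde\Omega$ in a complex manifold, $\Omega$ is Runge in $\tilde\Omega$ if every holomorphic function on $\Omega$ can be approximated, locally uniformly on $\Omega$, by restrictions of holomorphic functions on $\tilde\Omega$. $\mathcal{E}(\Omega,\mathbb{C}^n)$ is the space of all injective holomorphic maps $F:\Omega\to\mathbb{C}^n$ with the compact-open topology, and $\mathcal{E}_{\mathcal{R}}(\Omega,\mathbb{C}^n)=\{F\in\mathcal{E}(\Omega,\mathbb{C}^n):F(\Omega)\text{ is Runge in }\mathbb{C}^n\}$. $Aut(\mathbb{C}^n)$ is the set of bijective holomorphic maps $\mathbb{C}^n\to\mathbb{C}^n$, and $\overline{Aut(\mathbb{C}^n)}|_\Omega$ is the closure in $\mathcal{E}(\Omega,\mathbb{C}^n)$ of $\{\Phi|_\Omega:\Phi\in Aut(\mathbb{C}^n)\}$. *)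

theory Defs
  imports "HOL-Analysis.Analysis"
begin

(* Complex Euclidean n-space is complex ^ 'n, with CARD('n) = n.  Holomorphic means
   real differentiable with complex linear derivative; the definitions are meant for open S. *)

definition holo_fun :: "(complex ^ 'n) set \<Rightarrow> (complex ^ 'n \<Rightarrow> complex) \<Rightarrow> bool" where
  "holo_fun S f \<longleftrightarrow>
     (\<forall>z\<in>S. \<exists>f'. (f has_derivative f') (at z within S) \<and> (\<forall>c v. f' (c *s v) = c * f' v))"

definition holo_map :: "(complex ^ 'n) set \<Rightarrow> (complex ^ 'n \<Rightarrow> complex ^ 'm) \<Rightarrow> bool" where
  "holo_map S F \<longleftrightarrow> (\<forall>i. holo_fun S (\<lambda>z. F z $ i))"

definition holo_hull :: "(complex ^ 'n) set \<Rightarrow> (complex ^ 'n) set \<Rightarrow> (complex ^ 'n) set" where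
  "holo_hull \<Omega> K = {z\<in>\<Omega>. \<forall>f. holo_fun \<Omega> f \<longrightarrow> cmod (f z) \<le> (SUP w\<in>K. cmod (f w))}"

definition holo_convex :: "(complex ^ 'n) set \<Rightarrow> bool" where
  "holo_convex \<Omega> \<longleftrightarrow> (\<forall>K. compact K \<and> K \<subseteq> \<Omega> \<longrightarrow> compact (holo_hull \<Omega> K))"

(* The definition of a Stein manifold, read for a connected open subset of complex n-space.
   Its last two conditions, separation of points and global functions giving local
   coordinates at each point, hold there automatically by means of the coordinate functions. *)

definition stein_domain :: "(complex ^ 'n) set \<Rightarrow> bool" where
  "stein_domain \<Omega> \<longleftrightarrow>
     open \<Omega> \<and> connected \<Omega> \<and> \<Omega> \<noteq> {} \<and>
     holo_convex \<Omega> \<and>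
     (\<forall>z\<in>\<Omega>. \<forall>w\<in>\<Omega>. z \<noteq> w \<longrightarrow> (\<exists>f. holo_fun \<Omega> f \<and> f z \<noteq> f w)) \<and>
     (\<forall>z\<in>\<Omega>. \<exists>F :: complex ^ 'n \<Rightarrow> complex ^ 'n.
        holo_map \<Omega> F \<and> bij (frechet_derivative F (at z)))"

(* Locally uniform approximation: a sequence converging uniformly near each point of S. *)

definition runge_in :: "(complex ^ 'n) set \<Rightarrow> (complex ^ 'n) set \<Rightarrow> bool" where
  "runge_in S T \<longleftrightarrow> S \<subseteq> T \<and>
     (\<forall>f. holo_fun S f \<longrightarrow>
       (\<exists>g :: nat \<Rightarrow> complex ^ 'n \<Rightarrow> complex.
          (\<forall>k. holo_fun T (g k)) \<and>
          (\<forall>z\<in>S. \<exists>U. open U \<and> z \<in> U \<and> uniform_limit (U \<inter> S) g f sequentially)))"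

(* A map defined on \<Omega> is represented by the total function that is undefined outside \<Omega>,
   so that equality and the topology below only see its values on \<Omega>. *)

definition inj_holo_maps :: "(complex ^ 'n) set \<Rightarrow> (complex ^ 'n \<Rightarrow> complex ^ 'n) set" where
  "inj_holo_maps \<Omega> = {F \<in> extensional \<Omega>. holo_map \<Omega> F \<and> inj_on F \<Omega>}"

definition inj_holo_top :: "(complex ^ 'n) set \<Rightarrow> (complex ^ 'n \<Rightarrow> complex ^ 'n) topology" where
  "inj_holo_top \<Omega> =
     topology_generated_by
       {{F \<in> inj_holo_maps \<Omega>. F ` K \<subseteq> U} |K U. compact K \<and> K \<subseteq> \<Omega> \<and> open U}"

lemma topspace_inj_holo_top: "topspace (inj_holo_top \<Omega>) = inj_holo_maps \<Omega>"
proof -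
  have "inj_holo_maps \<Omega> \<in>
      {{F \<in> inj_holo_maps \<Omega>. F ` K \<subseteq> U} |K U. compact K \<and> K \<subseteq> \<Omega> \<and> open U}"
    by (rule CollectI, intro exI[of _ "{}"]) auto
  then show ?thesis
    unfolding inj_holo_top_def topology_generated_by_topspace by blast
qed

definition runge_inj_holo_maps :: "(complex ^ 'n) set \<Rightarrow> (complex ^ 'n \<Rightarrow> complex ^ 'n) set" where
  "runge_inj_holo_maps \<Omega> = {F \<in> inj_holo_maps \<Omega>. runge_in (F ` \<Omega>) UNIV}"

definition holo_aut :: "(complex ^ 'n \<Rightarrow> complex ^ 'n) set" where
  "holo_aut = {\<Phi>. holo_map UNIV \<Phi> \<and> bij \<Phi>}"

definition aut_closure :: "(complex ^ 'n) set \<Rightarrow> (complex ^ 'n \<Rightarrow> complex ^ 'n) set" where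
  "aut_closure \<Omega> = inj_holo_top \<Omega> closure_of ((\<lambda>\<Phi>. restrict \<Phi> \<Omega>) ` holo_aut)"

end

theory Submission
  imports Defs "HOL-Complex_Analysis.Complex_Analysis" "HOL-Real_Asymp.Real_Asymp"
begin

text \<open>Call a vector field on an open set \<open>U\<close> approximable if, on compact sets and for small \<open>h\<close>, some
  automorphism agrees with \<open>x + h X(x)\<close> up to \<open>o(h)\<close>.  Entire fields are approximable (Andersen--Lempert):
  exponentials \<open>exp (lin a z) v\<close> span a dense set of fields, and each is a limit of sums of shear and
  overshear fields, whose flows are automorphisms.  Hence holomorphic fields on Runge sets are
  approximable, and by Euler's method so are their flow maps, as long as the orbits stay in the set.

  Let \<open>F\<close> be injective with Runge image.  For a ball \<open>B\<close> and large \<open>T\<close>, \<open>\<theta> (T, \<cdot>)\<close> maps \<open>B\<close> into \<open>\<Omega>\<close>;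
  transporting the dilation flow of \<open>B\<close> to \<open>F ` \<Omega>\<close> shows that \<open>F \<circ> \<theta> (T, \<cdot>)\<close> is a limit of automorphisms
  on \<open>B\<close>.  Transporting the flow \<open>\<theta>\<close>, run backwards from \<open>T\<close> to \<open>0\<close>, then gives the same for \<open>F\<close>.  Both
  fields on \<open>F ` \<Omega>\<close> are holomorphic because the inverse of an injective holomorphic map is, which
  is deduced from Rado's theorem.  Since both fields are defined on all of \<open>F ` \<Omega>\<close>, no Runge property
  of \<open>\<theta> (t, \<cdot>) ` \<Omega>\<close> in \<open>\<Omega>\<close> is involved.\<close>

section \<open>Holomorphic functions of several variables\<close>

text \<open>Holomorphy is only given as real differentiability with complex linear derivative, so
  results of several variables are drawn from one-variable theory on coordinate lines, with
  continuity supplied separately. Approximability asks for nothing beyond first order, and the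
  automorphisms for different \<open>h\<close> need not be related. This is why sums of fields
  reduce to compositions, and why an autonomous flow is followed by iterating one automorphism. A
  ball enters because it carries a dilation flow joining
  \<open>F \<circ> \<theta> (T, \<cdot>)\<close> to an affine map; the compact set in
  \<open>\<Omega>\<close> has no such isotopy of its own. The automorphism that flows back is
  controlled only on a compact part of the image of \<open>F\<close>, so the first approximation
  must be close enough to land there. The action is merely continuous in time, hence its generator
  has to be constructed before the backward field can be named. For inverse maps the critical points
  cannot be discarded at the outset: the Jacobian determinant is carried over to the image, where it
  is continuous and holomorphic off its own zeros, which is the situation of Rado's theorem.\<close>

no_notation fps_nth (infixl "$" 75)

lemma uniformly_continuous_onE:
  assumes "compact K" "continuous_on K f" "e > 0"
  obtains d where "d > 0" "\<And>x y. x \<in> K \<Longrightarrow> y \<in> K \<Longrightarrow> dist y x < d \<Longrightarrow> dist (f y) (f x) < e"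
proof -
  have "\<exists>d>0. \<forall>x\<in>K. \<forall>y\<in>K. dist y x < d \<longrightarrow> dist (f y) (f x) < e"
    using compact_uniformly_continuous[OF assms(2,1)] assms(3) unfolding uniformly_continuous_on_def by blast
  then show thesis using that by blast
qed

lemma norm_smult: "norm (c *s v) = cmod c * norm (v :: complex ^ 'n)"
  unfolding norm_vec_def vector_scalar_mult_def
  by (simp add: norm_mult L2_set_right_distrib)

lemma norm_smult_axis [simp]: "norm (t *s axis j (1::complex) :: complex ^ 'n) = cmod t"
  by (simp add: norm_smult)

lemma bounded_linear_smult: "bounded_linear (\<lambda>t. t *s (v :: complex ^ 'n))"
  by (rule bounded_linear_intro[of _ "norm v"])
     (auto simp: vec_eq_iff algebra_simps norm_smult)

lemma continuous_on_smult [continuous_intros]: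
  fixes g :: "'a::topological_space \<Rightarrow> complex ^ 'n"
  assumes "continuous_on S f" "continuous_on S g"
  shows "continuous_on S (\<lambda>x. f x *s g x)"
  unfolding vector_scalar_mult_def
  by (intro continuous_intros assms)

lemma holo_funI:
  assumes "\<And>z. z \<in> S \<Longrightarrow> \<exists>f'. (f has_derivative f') (at z) \<and> (\<forall>c v. f' (c *s v) = c * f' v)"
  shows "holo_fun S f"
  unfolding holo_fun_def using assms has_derivative_at_withinI by blast

lemma holo_funE:
  assumes "holo_fun S f" "open S" "z \<in> S"
  obtains f' where "(f has_derivative f') (at z)" "\<And>c v. f' (c *s v) = c * f' v"
  using assms at_within_open[OF assms(3,2)] unfolding holo_fun_def by metis

lemma holo_fun_continuous: "holo_fun S f \<Longrightarrow> continuous_on S f"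
  unfolding holo_fun_def
  by (meson continuous_on_eq_continuous_within has_derivative_continuous)

lemma holo_map_continuous:
  fixes F :: "complex ^ 'n \<Rightarrow> complex ^ 'm"
  assumes "holo_map S F" shows "continuous_on S F"
proof -
  have "continuous_on S (\<lambda>z. \<chi> i. F z $ i)"
    using assms unfolding holo_map_def by (intro continuous_intros holo_fun_continuous) auto
  then show ?thesis by simp
qed

lemma holo_fun_subset: "holo_fun T f \<Longrightarrow> S \<subseteq> T \<Longrightarrow> holo_fun S f"
  unfolding holo_fun_def by (meson has_derivative_subset subsetD)

lemma holo_map_subset: "holo_map T f \<Longrightarrow> S \<subseteq> T \<Longrightarrow> holo_map S f"
  unfolding holo_map_def by (meson holo_fun_subset)

lemma holo_fun_cong:
  assumes "\<And>z. z \<in> S \<Longrightarrow> f z = g z" "holo_fun S f"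
  shows "holo_fun S g"
  unfolding holo_fun_def
proof
  fix z assume z: "z \<in> S"
  then obtain f' where "(f has_derivative f') (at z within S)" "\<forall>c v. f' (c *s v) = c * f' v"
    using assms(2) unfolding holo_fun_def by blast
  then show "\<exists>f'. (g has_derivative f') (at z within S) \<and> (\<forall>c v. f' (c *s v) = c * f' v)"
    using has_derivative_transform[OF z] assms(1) by metis
qed

lemma holo_map_cong:
  assumes "\<And>z. z \<in> S \<Longrightarrow> f z = g z" "holo_map S f"
  shows "holo_map S g"
  using assms holo_fun_cong[of S "\<lambda>z. f z $ _" "\<lambda>z. g z $ _"] unfolding holo_map_def by auto

lemma holo_fun_local:
  assumes "\<And>z. z \<in> S \<Longrightarrow> \<exists>U. open U \<and> z \<in> U \<and> holo_fun U f"
  shows "holo_fun S f"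
  by (rule holo_funI) (use assms holo_funE in metis)

lemma holo_fun_const [intro]: "holo_fun S (\<lambda>z. c)"
  by (rule holo_funI, rule exI[of _ "\<lambda>v. 0"]) auto

lemma holo_fun_nth [intro]: "holo_fun S (\<lambda>z. z $ i)"
  by (rule holo_funI, rule exI[of _ "\<lambda>v. v $ i"])
     (auto intro!: bounded_linear_imp_has_derivative bounded_linear_vec_nth)

lemma holo_map_id [intro]: "holo_map S (\<lambda>z. z)"
  unfolding holo_map_def by auto

lemma holo_fun_add [intro]:
  assumes "holo_fun S f" "holo_fun S g" shows "holo_fun S (\<lambda>z. f z + g z)"
  unfolding holo_fun_def
proof
  fix z assume "z \<in> S"
  then obtain f' g' where "(f has_derivative f') (at z within S)" "\<forall>c v. f' (c *s v) = c * f' v"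
    "(g has_derivative g') (at z within S)" "\<forall>c v. g' (c *s v) = c * g' v"
    using assms unfolding holo_fun_def by metis
  then show "\<exists>h'. ((\<lambda>z. f z + g z) has_derivative h') (at z within S) \<and> (\<forall>c v. h' (c *s v) = c * h' v)"
    by (intro exI[of _ "\<lambda>v. f' v + g' v"]) (auto intro!: derivative_eq_intros simp: algebra_simps)
qed

lemma holo_fun_mult [intro]:
  assumes "holo_fun S f" "holo_fun S g" shows "holo_fun S (\<lambda>z. f z * g z)"
  unfolding holo_fun_def
proof
  fix z assume "z \<in> S"
  then obtain f' g' where "(f has_derivative f') (at z within S)" "\<forall>c v. f' (c *s v) = c * f' v"
    "(g has_derivative g') (at z within S)" "\<forall>c v. g' (c *s v) = c * g' v"
    using assms unfolding holo_fun_def by metis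
  then show "\<exists>h'. ((\<lambda>z. f z * g z) has_derivative h') (at z within S) \<and> (\<forall>c v. h' (c *s v) = c * h' v)"
    by (intro exI[of _ "\<lambda>v. f z * g' v + f' v * g z"])
       (auto intro!: derivative_eq_intros simp: algebra_simps)
qed

lemma holo_fun_uminus [intro]: "holo_fun S f \<Longrightarrow> holo_fun S (\<lambda>z. - f z)"
  using holo_fun_mult[OF holo_fun_const[of S "-1"], of f] by simp

lemma holo_fun_diff [intro]:
  "holo_fun S f \<Longrightarrow> holo_fun S g \<Longrightarrow> holo_fun S (\<lambda>z. f z - g z)"
  using holo_fun_add[of S f "\<lambda>z. - g z"] by auto

lemma holo_fun_sum [intro]:
  "(\<And>i. i \<in> I \<Longrightarrow> holo_fun S (f i)) \<Longrightarrow> holo_fun S (\<lambda>z. \<Sum>i\<in>I. f i z)"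
  by (induction I rule: infinite_finite_induct) auto

lemma holo_fun_prod [intro]:
  "(\<And>i. i \<in> I \<Longrightarrow> holo_fun S (f i)) \<Longrightarrow> holo_fun S (\<lambda>z. \<Prod>i\<in>I. f i z)"
  by (induction I rule: infinite_finite_induct) auto

lemma holo_fun_compose_field:
  assumes "holo_fun S f" "\<And>z. z \<in> S \<Longrightarrow> g field_differentiable at (f z)"
  shows "holo_fun S (\<lambda>z. g (f z))"
  unfolding holo_fun_def
proof
  fix z assume z: "z \<in> S"
  then obtain f' where f': "(f has_derivative f') (at z within S)" "\<forall>c v. f' (c *s v) = c * f' v"
    using assms unfolding holo_fun_def by metis
  obtain d where d: "(g has_field_derivative d) (at (f z))"
    using assms(2)[OF z] unfolding field_differentiable_def by blast
  have "((\<lambda>z. g (f z)) has_derivative (\<lambda>v. d * f' v)) (at z within S)"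
    using has_derivative_compose[OF f'(1) d[unfolded has_field_derivative_def]] .
  then show "\<exists>h'. ((\<lambda>z. g (f z)) has_derivative h') (at z within S) \<and> (\<forall>c v. h' (c *s v) = c * h' v)"
    using f'(2) by (intro exI[of _ "\<lambda>v. d * f' v"]) auto
qed

lemma holo_fun_exp [intro]: "holo_fun S f \<Longrightarrow> holo_fun S (\<lambda>z. exp (f z))"
  by (rule holo_fun_compose_field) (auto intro: field_differentiable_within_exp)

lemma has_derivative_vecI:
  fixes F :: "'a::real_normed_vector \<Rightarrow> complex ^ 'm"
  assumes "\<And>i. ((\<lambda>z. F z $ i) has_derivative f' i) (at z)"
  shows "(F has_derivative (\<lambda>v. \<chi> i. f' i v)) (at z)"
proof (subst has_derivative_componentwise_within, clarify)
  fix b :: "complex ^ 'm" assume "b \<in> Basis"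
  then obtain i u where b: "b = axis i u" unfolding Basis_vec_def by auto
  show "((\<lambda>x. F x \<bullet> b) has_derivative (\<lambda>x. (\<chi> i. f' i x) \<bullet> b)) (at z)"
    unfolding b inner_axis by (auto intro!: derivative_eq_intros assms)
qed

lemma holo_mapE:
  fixes F :: "complex ^ 'n \<Rightarrow> complex ^ 'm"
  assumes "holo_map S F" "open S" "z \<in> S"
  obtains F' where "(F has_derivative F') (at z)" "\<And>c v. F' (c *s v) = c *s F' v"
proof -
  have "\<forall>i. \<exists>f'. ((\<lambda>z. F z $ i) has_derivative f') (at z) \<and> (\<forall>c v. f' (c *s v) = c * f' v)"
    using assms holo_funE unfolding holo_map_def by metis
  then obtain f' where f': "\<And>i. ((\<lambda>z. F z $ i) has_derivative f' i) (at z)"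
    "\<And>i c v. f' i (c *s v) = c * f' i v" by metis
  have "(F has_derivative (\<lambda>v. \<chi> i. f' i v)) (at z)" by (rule has_derivative_vecI[OF f'(1)])
  then show thesis by (rule that) (auto simp: vec_eq_iff f'(2))
qed

lemma holo_mapI:
  fixes F :: "complex ^ 'n \<Rightarrow> complex ^ 'm"
  assumes "\<And>z. z \<in> S \<Longrightarrow> \<exists>F'. (F has_derivative F') (at z) \<and> (\<forall>c v. F' (c *s v) = c *s F' v)"
  shows "holo_map S F"
  unfolding holo_map_def
proof (intro allI holo_funI)
  fix i z assume "z \<in> S"
  then obtain F' where F': "(F has_derivative F') (at z)" "\<forall>c v. F' (c *s v) = c *s F' v"
    using assms by blast
  show "\<exists>f'. ((\<lambda>z. F z $ i) has_derivative f') (at z) \<and> (\<forall>c v. f' (c *s v) = c * f' v)"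
    using bounded_linear.has_derivative[OF bounded_linear_vec_nth F'(1), of i] F'(2)
    by (intro exI[of _ "\<lambda>v. F' v $ i"]) auto
qed

lemma holo_fun_compose:
  fixes F :: "complex ^ 'n \<Rightarrow> complex ^ 'm"
  assumes "holo_fun T f" "holo_map S F" "open S" "open T" "F ` S \<subseteq> T"
  shows "holo_fun S (\<lambda>z. f (F z))"
proof (rule holo_funI)
  fix z assume z: "z \<in> S"
  obtain F' where F': "(F has_derivative F') (at z)" "\<And>c v. F' (c *s v) = c *s F' v"
    using holo_mapE assms(2,3) z by blast
  obtain f' where f': "(f has_derivative f') (at (F z))" "\<And>c v. f' (c *s v) = c * f' v"
    using holo_funE[OF assms(1,4), of "F z"] z assms(5) by blast
  show "\<exists>h'. ((\<lambda>z. f (F z)) has_derivative h') (at z) \<and> (\<forall>c v. h' (c *s v) = c * h' v)"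
    using has_derivative_compose[OF F'(1) f'(1)] F'(2) f'(2)
    by (intro exI[of _ "\<lambda>v. f' (F' v)"]) auto
qed

lemma holo_map_compose:
  fixes F :: "complex ^ 'n \<Rightarrow> complex ^ 'm" and G :: "complex ^ 'm \<Rightarrow> complex ^ 'k"
  assumes "holo_map T G" "holo_map S F" "open S" "open T" "F ` S \<subseteq> T"
  shows "holo_map S (\<lambda>z. G (F z))"
  unfolding holo_map_def
proof
  fix i show "holo_fun S (\<lambda>z. G (F z) $ i)"
    using holo_fun_compose[OF _ assms(2-5), of "\<lambda>w. G w $ i"] assms(1)
    unfolding holo_map_def by blast
qed

lemma holo_fun_line:
  assumes "holo_fun S f" "open S"
  shows "(\<lambda>t. f (z + t *s v)) holomorphic_on {t. z + t *s v \<in> S}"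
proof -
  have "(\<lambda>t. f (z + t *s v)) field_differentiable at t" if t: "z + t *s v \<in> S" for t
  proof -
    obtain f' where f': "(f has_derivative f') (at (z + t *s v))" "\<And>c v. f' (c *s v) = c * f' v"
      using holo_funE[OF assms t] by blast
    have "((\<lambda>t. z + t *s v) has_derivative (\<lambda>s. s *s v)) (at t)"
      by (auto intro!: derivative_eq_intros bounded_linear.has_derivative[OF bounded_linear_smult])
    from has_derivative_compose[OF this f'(1)]
    have "((\<lambda>t. f (z + t *s v)) has_field_derivative f' v) (at t)"
      unfolding has_field_derivative_def f'(2) by (simp add: mult.commute[of _ "f' v"])
    then show ?thesis unfolding field_differentiable_def by blast
  qed
  then show ?thesis
    unfolding holomorphic_on_def by (auto intro: field_differentiable_at_within)
qed

lemma open_line: "open S \<Longrightarrow> open {t. z + t *s (v :: complex ^ 'n) \<in> S}"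
  using open_vimage[of S "\<lambda>t. z + t *s v"] unfolding vimage_def
  by (simp add: continuous_intros linear_continuous_on[OF bounded_linear_smult])

section \<open>Separate holomorphy and partial derivatives\<close>

definition sep_holo :: "(complex ^ 'n) set \<Rightarrow> (complex ^ 'n \<Rightarrow> complex) \<Rightarrow> bool" where
  "sep_holo S f \<longleftrightarrow> (\<forall>z\<in>S. \<forall>j. (\<lambda>t. f (z + t *s axis j 1)) field_differentiable at 0)"

definition pd :: "'n \<Rightarrow> (complex ^ 'n \<Rightarrow> complex) \<Rightarrow> complex ^ 'n \<Rightarrow> complex" where
  "pd j f z = deriv (\<lambda>t. f (z + t *s axis j 1)) 0"

lemma sep_holo_deriv:
  assumes "sep_holo S f" "z + t *s axis j 1 \<in> S"
  shows "((\<lambda>t. f (z + t *s axis j 1)) has_field_derivative pd j f (z + t *s axis j 1)) (at t)"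
proof -
  have "((\<lambda>s. f ((z + t *s axis j 1) + s *s axis j 1)) has_field_derivative pd j f (z + t *s axis j 1)) (at 0)"
    using assms unfolding sep_holo_def pd_def by (auto simp: field_differentiable_derivI)
  then have "((\<lambda>s. f (z + (s + t) *s axis j 1)) has_field_derivative pd j f (z + t *s axis j 1)) (at 0)"
    by (simp add: vector_sadd_rdistrib add_ac)
  then show ?thesis
    using DERIV_shift[of "\<lambda>t. f (z + t *s axis j 1)" "pd j f (z + t *s axis j 1)" 0 t] by simp
qed

lemma sep_holo_line:
  assumes "sep_holo S f"
  shows "(\<lambda>t. f (z + t *s axis j 1)) holomorphic_on {t. z + t *s axis j 1 \<in> S}"
  unfolding holomorphic_on_def field_differentiable_def
  using has_field_derivative_at_within[OF sep_holo_deriv[OF assms]] by blast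

lemma holo_fun_sep:
  assumes "holo_fun S f" "open S"
  shows "sep_holo S f"
  unfolding sep_holo_def
proof (intro ballI allI)
  fix z j assume "z \<in> S"
  then show "(\<lambda>t. f (z + t *s axis j 1)) field_differentiable at 0"
    using holomorphic_on_imp_differentiable_at[OF holo_fun_line[OF assms] open_line[OF assms(2)], of 0 z "axis j 1"]
    by simp
qed

lemma sep_holoI:
  assumes "\<And>z j. z \<in> S \<Longrightarrow> \<exists>r>0. (\<lambda>t. f (z + t *s axis j 1)) holomorphic_on ball 0 r"
  shows "sep_holo S f"
  unfolding sep_holo_def
proof (intro ballI allI)
  fix z j assume "z \<in> S"
  then obtain r where "r > 0" "(\<lambda>t. f (z + t *s axis j 1)) holomorphic_on ball 0 r"
    using assms by blast
  then show "(\<lambda>t. f (z + t *s axis j 1)) field_differentiable at 0"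
    using holomorphic_on_imp_differentiable_at[of _ "ball 0 r" 0] by simp
qed

text \<open>The slices of \<open>f\<close> through two nearby points differ by a holomorphic
  function of one variable that is small on a circle, by uniform continuity on a compact ball.
  Cauchy's estimate carries the smallness over to the difference of the derivatives.\<close>

lemma continuous_on_pd:
  assumes S: "open S" and cont: "continuous_on S f" and sep: "sep_holo S f"
  shows "continuous_on S (pd j f)"
proof (rule continuous_at_imp_continuous_on, rule ballI)
  fix z assume z: "z \<in> S"
  obtain R where R: "R > 0" "cball z R \<subseteq> S" using S z open_contains_cball by blast
  define r where "r = R / 2"
  have r: "r > 0" using R by (simp add: r_def)
  have contR: "continuous_on (cball z R) f" using cont R(2) by (rule continuous_on_subset)
  show "isCont (pd j f) z"
    unfolding continuous_at_eps_delta
  proof (intro allI impI)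
    fix e :: real assume e: "e > 0"
    obtain d where d: "d > 0" "\<And>x y. x \<in> cball z R \<Longrightarrow> y \<in> cball z R \<Longrightarrow> dist y x < d \<Longrightarrow> dist (f y) (f x) < e * r / 2"
      using uniformly_continuous_onE[OF compact_cball contR, of "e * r / 2"] e r by auto
    have "dist (pd j f w) (pd j f z) < e" if w: "dist w z < min d r" for w
    proof -
      have inS: "w + t *s axis j 1 \<in> cball z R" "z + t *s axis j 1 \<in> cball z R" if "cmod t \<le> r" for t
      proof -
        have "dist z (w + t *s axis j 1) \<le> dist z w + cmod t"
          using dist_triangle[of z "w + t *s axis j 1" w] by (simp add: dist_norm)
        then show "w + t *s axis j 1 \<in> cball z R" using w that by (simp add: r_def dist_commute)
        show "z + t *s axis j 1 \<in> cball z R" using that R by (simp add: r_def dist_norm)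
      qed
      define h where "h t = f (w + t *s axis j 1) - f (z + t *s axis j 1)" for t
      have hol: "h holomorphic_on {t. w + t *s axis j 1 \<in> S} \<inter> {t. z + t *s axis j 1 \<in> S}"
        unfolding h_def by (intro holomorphic_on_diff holomorphic_on_subset[OF sep_holo_line[OF sep]]) auto
      have sub: "cball 0 r \<subseteq> {t. w + t *s axis j 1 \<in> S} \<inter> {t. z + t *s axis j 1 \<in> S}"
        using inS R(2) by auto
      have "cmod ((deriv ^^ 1) h 0) \<le> fact 1 * (e * r / 2) / r ^ 1"
      proof (rule Cauchy_inequality[OF _ _ r])
        show "h holomorphic_on ball 0 r" using hol sub by (meson ball_subset_cball holomorphic_on_subset order_trans)
        show "continuous_on (cball 0 r) h" using hol sub holomorphic_on_imp_continuous_on holomorphic_on_subset by blast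
        show "cmod (h t) \<le> e * r / 2" if "cmod (0 - t) = r" for t
        proof -
          have "dist (w + t *s axis j 1) (z + t *s axis j 1) = dist w z" by (simp add: dist_norm)
          then have "dist (f (w + t *s axis j 1)) (f (z + t *s axis j 1)) < e * r / 2"
            using d(2)[OF inS(2) inS(1), of t t] that w by simp
          then show ?thesis unfolding h_def dist_norm by simp
        qed
      qed
      moreover have "deriv h 0 = pd j f w - pd j f z"
      proof -
        have "w \<in> S" "z \<in> S" using inS[of 0] R r by auto
        then have "(\<lambda>t. f (w + t *s axis j 1)) field_differentiable at 0" "(\<lambda>t. f (z + t *s axis j 1)) field_differentiable at 0"
          using sep unfolding sep_holo_def by auto
        then show ?thesis unfolding h_def pd_def by (rule deriv_diff)
      qed
      ultimately show ?thesis using e r by (simp add: dist_norm)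
    qed
    then show "\<exists>d>0. \<forall>w. dist w z < d \<longrightarrow> dist (pd j f w) (pd j f z) < e"
      using d(1) r by (intro exI[of _ "min d r"]) auto
  qed
qed

text \<open>Coordinates are moved one at a time; each move is estimated by the one-variable mean
  value inequality, with the error governed by the continuity of the partial derivatives.\<close>

lemma has_derivative_pd:
  fixes f :: "complex ^ 'n \<Rightarrow> complex"
  assumes S: "open S" and cont: "\<And>j. continuous_on S (pd j f)" and sep: "sep_holo S f" and z: "z \<in> S"
  shows "(f has_derivative (\<lambda>v. \<Sum>j\<in>UNIV. pd j f z * v $ j)) (at z)"
proof -
  \<comment> \<open>The base point \<open>w\<close> is allowed to vary because the induction
    hypothesis is used at \<open>w'\<close>, after coordinate \<open>k\<close> has been
    moved.\<close>
  have key: "\<exists>d>0. \<forall>w h. dist w z < d \<longrightarrow> norm h < d \<longrightarrow>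
      cmod (f (w + (\<Sum>j\<in>I. h $ j *s axis j 1)) - f w - (\<Sum>j\<in>I. pd j f z * h $ j)) \<le> e * real (card I) * norm h"
    if e: "e > 0" and "finite I" for e and I :: "'n set"
    using \<open>finite I\<close>
  proof (induction I)
    case empty
    show ?case by (intro exI[of _ 1]) auto
  next
    case (insert k I)
    then obtain d where d: "d > 0" "\<And>w h. dist w z < d \<Longrightarrow> norm h < d \<Longrightarrow>
      cmod (f (w + (\<Sum>j\<in>I. h $ j *s axis j 1)) - f w - (\<Sum>j\<in>I. pd j f z * h $ j)) \<le> e * real (card I) * norm h"
      by blast
    have "isCont (pd k f) z" using cont S z continuous_on_eq_continuous_at by blast
    then obtain d1 where d1: "d1 > 0" "\<And>w. dist w z < d1 \<Longrightarrow> dist (pd k f w) (pd k f z) < e"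
      unfolding continuous_at_eps_delta using e by blast
    obtain d2 where d2: "d2 > 0" "ball z d2 \<subseteq> S" using S z open_contains_ball by blast
    define d' where "d' = min d (min d1 d2) / 2"
    have d': "d' > 0" "2 * d' \<le> d" "2 * d' \<le> d1" "2 * d' \<le> d2" using d(1) d1(1) d2(1) by (auto simp: d'_def)
    show ?case
    proof (intro exI[of _ d'] conjI allI impI)
      show "d' > 0" by fact
      fix w h :: "complex ^ 'n" assume w: "dist w z < d'" and h: "norm h < d'"
      define w' where "w' = w + h $ k *s axis k 1"
      have hk: "cmod (h $ k) \<le> norm h" by (rule Finite_Cartesian_Product.norm_nth_le)
      have near: "dist (w + t *s axis k 1) z < 2 * d'" if "cmod t \<le> norm h" for t
        using dist_triangle[of "w + t *s axis k 1" z w] that w h by (simp add: dist_norm)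
      have w': "dist w' z < d" using near[OF hk] d' by (simp add: w'_def)
      have "cmod (f (w' + (\<Sum>j\<in>I. h $ j *s axis j 1)) - f w' - (\<Sum>j\<in>I. pd j f z * h $ j)) \<le> e * real (card I) * norm h"
        using d(2)[OF w', of h] h d' by auto
      moreover have "cmod (f w' - f w - pd k f z * h $ k) \<le> e * norm h"
      proof -
        define g where "g t = f (w + t *s axis k 1) - pd k f z * t" for t
        have "cmod (g (h $ k) - g 0) \<le> e * cmod (h $ k - 0)"
        proof (rule field_differentiable_bound[of "cball 0 (norm h)" g "\<lambda>t. pd k f (w + t *s axis k 1) - pd k f z"])
          fix t :: complex assume "t \<in> cball 0 (norm h)"
          then have t: "cmod t \<le> norm h" by simp
          have "w + t *s axis k 1 \<in> S" using near[OF t] d' d2 by (auto simp: dist_commute subset_iff)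
          from sep_holo_deriv[OF sep this]
          show "(g has_field_derivative pd k f (w + t *s axis k 1) - pd k f z) (at t within cball 0 (norm h))"
            unfolding g_def by (auto intro!: derivative_eq_intros intro: has_field_derivative_at_within)
          show "cmod (pd k f (w + t *s axis k 1) - pd k f z) \<le> e"
            using d1(2)[of "w + t *s axis k 1"] near[OF t] d' by (auto simp: dist_norm)
        qed (use hk in auto)
        also have "\<dots> \<le> e * norm h" using hk e by simp
        finally show ?thesis by (simp add: g_def w'_def algebra_simps)
      qed
      moreover have "f (w + (\<Sum>j\<in>insert k I. h $ j *s axis j 1)) = f (w' + (\<Sum>j\<in>I. h $ j *s axis j 1))"
        using insert by (simp add: w'_def add_ac)
      ultimately show "cmod (f (w + (\<Sum>j\<in>insert k I. h $ j *s axis j 1)) - f w - (\<Sum>j\<in>insert k I. pd j f z * h $ j))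
          \<le> e * real (card (insert k I)) * norm h"
        using insert norm_triangle_ineq[of "f (w' + (\<Sum>j\<in>I. h $ j *s axis j 1)) - f w' - (\<Sum>j\<in>I. pd j f z * h $ j)"
            "f w' - f w - pd k f z * h $ k"]
        by (simp add: algebra_simps)
    qed
  qed
  have basis: "(\<Sum>j\<in>UNIV. h $ j *s axis j 1) = h" for h :: "complex ^ 'n"
    using basis_expansion[of h] by simp
  show ?thesis
    unfolding has_derivative_at_alt
  proof (intro conjI allI impI)
    show "bounded_linear (\<lambda>v. \<Sum>j\<in>UNIV. pd j f z * v $ j)"
      by (intro bounded_linear_sum bounded_linear_const_mult bounded_linear_vec_nth)
    fix e :: real assume e: "e > 0"
    define c where "c = real CARD('n)"
    have c: "c > 0" by (simp add: c_def)
    obtain d where d: "d > 0" "\<And>w h. dist w z < d \<Longrightarrow> norm h < d \<Longrightarrow>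
      cmod (f (w + h) - f w - (\<Sum>j\<in>UNIV. pd j f z * h $ j)) \<le> e / c * c * norm h"
      using key[of "e / c" "UNIV :: 'n set"] e c unfolding basis c_def by auto
    show "\<exists>d>0. \<forall>y. norm (y - z) < d \<longrightarrow> norm (f y - f z - (\<Sum>j\<in>UNIV. pd j f z * (y - z) $ j)) \<le> e * norm (y - z)"
      using d(1) d(2)[of z "_ - z"] c by (intro exI[of _ d]) auto
  qed
qed

text \<open>Osgood's lemma: Cauchy estimates make the partial derivatives continuous, and the
  resulting real derivative is complex linear by its formula.\<close>

lemma sep_holo_imp_holo:
  assumes "open S" "continuous_on S f" "sep_holo S f"
  shows "holo_fun S f"
proof (rule holo_funI)
  fix z assume z: "z \<in> S"
  show "\<exists>f'. (f has_derivative f') (at z) \<and> (\<forall>c v. f' (c *s v) = c * f' v)"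
  proof (intro exI conjI allI)
    show "(f has_derivative (\<lambda>v. \<Sum>j\<in>UNIV. pd j f z * v $ j)) (at z)"
      by (rule has_derivative_pd[OF assms(1) continuous_on_pd[OF assms] assms(3) z])
    show "(\<Sum>j\<in>UNIV. pd j f z * (c *s v) $ j) = c * (\<Sum>j\<in>UNIV. pd j f z * v $ j)" for c v
      unfolding sum_distrib_left by (intro sum.cong) auto
  qed
qed

lemma holo_fun_has_derivative:
  assumes "open S" "holo_fun S f" "z \<in> S"
  shows "(f has_derivative (\<lambda>v. \<Sum>j\<in>UNIV. pd j f z * v $ j)) (at z)"
proof -
  note * = holo_fun_continuous[OF assms(2)] holo_fun_sep[OF assms(2,1)]
  show ?thesis by (rule has_derivative_pd[OF assms(1) continuous_on_pd[OF assms(1) *] *(2) assms(3)])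
qed

text \<open>Weierstrass' theorem on each coordinate line, then Osgood's lemma; the continuity which
  the latter requires passes to uniform limits.\<close>

lemma holo_fun_limit:
  fixes g :: "nat \<Rightarrow> complex ^ 'n \<Rightarrow> complex"
  assumes S: "open S" and g: "\<And>k. holo_fun S (g k)"
    and lim: "\<And>z. z \<in> S \<Longrightarrow> \<exists>U. open U \<and> z \<in> U \<and> uniform_limit (U \<inter> S) g f sequentially"
  shows "holo_fun S f"
proof (rule holo_fun_local)
  fix z assume z: "z \<in> S"
  then obtain U where U: "open U" "z \<in> U" "uniform_limit (U \<inter> S) g f sequentially" using lim by blast
  define V where "V = U \<inter> S"
  have V: "open V" "z \<in> V" "uniform_limit V g f sequentially" "V \<subseteq> S" using U S z by (auto simp: V_def)
  have gV: "holo_fun V (g k)" for k using g V(4) holo_fun_subset by blast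
  have "continuous_on V f"
    by (rule uniform_limit_theorem[OF always_eventually V(3)])
       (use holo_fun_continuous[OF gV] in auto)
  moreover have "sep_holo V f"
  proof (rule sep_holoI)
    fix w j assume w: "w \<in> V"
    have "open {t. w + t *s axis j 1 \<in> V}" "0 \<in> {t. w + t *s axis j 1 \<in> V}" using open_line V(1) w by auto
    then obtain r where r: "r > 0" "cball 0 r \<subseteq> {t. w + t *s axis j 1 \<in> V}"
      using open_contains_cball by blast
    have "(\<lambda>t. f (w + t *s axis j 1)) holomorphic_on ball 0 r"
    proof (rule holomorphic_uniform_sequence)
      show "(\<lambda>t. g k (w + t *s axis j 1)) holomorphic_on ball 0 r" for k
        using holo_fun_line[OF gV V(1)] by (rule holomorphic_on_subset) (use r(2) ball_subset_cball[of 0 r] in blast)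
      fix t :: complex assume "t \<in> ball 0 r"
      then obtain d where d: "d > 0" "cball t d \<subseteq> ball 0 r" using open_ball open_contains_cball by blast
      have "uniform_limit (cball t d) (\<lambda>k t. g k (w + t *s axis j 1)) (\<lambda>t. f (w + t *s axis j 1)) sequentially"
        unfolding uniform_limit_iff
      proof (intro allI impI)
        fix e :: real assume "e > 0"
        then have "\<forall>\<^sub>F k in sequentially. \<forall>x\<in>V. dist (g k x) (f x) < e"
          using V(3) unfolding uniform_limit_iff by blast
        then show "\<forall>\<^sub>F k in sequentially. \<forall>s\<in>cball t d. dist (g k (w + s *s axis j 1)) (f (w + s *s axis j 1)) < e"
        proof eventually_elim
          case (elim k)
          show ?case
          proof
            fix s assume "s \<in> cball t d"
            then have "w + s *s axis j 1 \<in> V" using d(2) r(2) ball_subset_cball[of 0 r] by blast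
            then show "dist (g k (w + s *s axis j 1)) (f (w + s *s axis j 1)) < e" using elim by blast
          qed
        qed
      qed
      then show "\<exists>d>0. cball t d \<subseteq> ball 0 r \<and>
         uniform_limit (cball t d) (\<lambda>k t. g k (w + t *s axis j 1)) (\<lambda>t. f (w + t *s axis j 1)) sequentially"
        using d by blast
    qed auto
    then show "\<exists>r>0. (\<lambda>t. f (w + t *s axis j 1)) holomorphic_on ball 0 r" using r by blast
  qed
  ultimately show "\<exists>U. open U \<and> z \<in> U \<and> holo_fun U f"
    using sep_holo_imp_holo V(1,2) by blast
qed

text \<open>The partial derivative is a locally uniform limit of difference quotients, which are
  holomorphic as combinations of \<open>f\<close> and its translates. Uniformity comes from the
  uniform continuity of \<open>pd j f\<close> on a compact ball.\<close>

lemma holo_fun_pd: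
  fixes f :: "complex ^ 'n \<Rightarrow> complex"
  assumes S: "open S" and f: "holo_fun S f"
  shows "holo_fun S (pd j f)"
proof (rule holo_fun_local)
  fix z assume z: "z \<in> S"
  obtain R where R: "R > 0" "cball z R \<subseteq> S" using S z open_contains_cball by blast
  define r where "r = R / 2"
  have r: "r > 0" using R by (simp add: r_def)
  have sep: "sep_holo S f" using holo_fun_sep f S by blast
  have cpd: "continuous_on S (pd j f)"
    using continuous_on_pd[OF S _ sep] holo_fun_continuous f by blast
  then have contR: "continuous_on (cball z R) (pd j f)" using R(2) by (rule continuous_on_subset)
  define h where "h k = complex_of_real (r / real (Suc k))" for k
  have hr: "cmod (h k) \<le> r" "h k \<noteq> 0" "cmod (h k) = r / real (Suc k)" for k
    using r by (auto simp: h_def norm_divide norm_mult field_simps simp del: of_nat_Suc)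
  define g where "g k w = (f (w + h k *s axis j 1) - f w) * inverse (h k)" for k w
  have inS: "w + t *s axis j 1 \<in> cball z R" if "w \<in> ball z r" "cmod t \<le> r" for t w
  proof -
    have "dist z (w + t *s axis j 1) \<le> dist z w + cmod t"
      using dist_triangle[of z "w + t *s axis j 1" w] by (simp add: dist_norm)
    then show "w + t *s axis j 1 \<in> cball z R" using that by (simp add: r_def dist_commute)
  qed
  have "holo_fun (ball z r) (pd j f)"
  proof (rule holo_fun_limit)
    show "holo_fun (ball z r) (g k)" for k
    proof -
      have "holo_map (ball z r) (\<lambda>w. w + h k *s axis j 1)"
        unfolding holo_map_def by (auto intro!: holo_fun_add)
      then have "holo_fun (ball z r) (\<lambda>w. f (w + h k *s axis j 1))"
        using holo_fun_compose[OF f _ _ S] inS hr(1) R(2) by blast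
      moreover have "holo_fun (ball z r) f"
        by (rule holo_fun_subset[OF f]) (use R in \<open>auto simp: r_def subset_iff\<close>)
      ultimately show ?thesis unfolding g_def by auto
    qed
    have "uniform_limit (ball z r) g (pd j f) sequentially"
      unfolding uniform_limit_iff
    proof (intro allI impI)
      fix e :: real assume e: "e > 0"
      obtain d where d: "d > 0" "\<And>x y. x \<in> cball z R \<Longrightarrow> y \<in> cball z R \<Longrightarrow> dist y x < d \<Longrightarrow> dist (pd j f y) (pd j f x) < e / 2"
        using uniformly_continuous_onE[OF compact_cball contR, of "e / 2"] e by auto
      have "(\<lambda>k. r / real (Suc k)) \<longlonglongrightarrow> 0" by real_asymp
      then have "\<forall>\<^sub>F k in sequentially. r / real (Suc k) < d" using d(1) by (rule order_tendstoD)
      then show "\<forall>\<^sub>F k in sequentially. \<forall>w\<in>ball z r. dist (g k w) (pd j f w) < e"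
      proof eventually_elim
        case (elim k)
        show ?case
        proof
          fix w assume w: "w \<in> ball z r"
          \<comment> \<open>Without its linear term the slice has the oscillation of
            \<open>pd j f\<close> as derivative, which is small on the disc of radius
            \<open>cmod (h k)\<close>.\<close>
          define G where "G t = f (w + t *s axis j 1) - pd j f w * t" for t
          have "cmod (G (h k) - G 0) \<le> e / 2 * cmod (h k - 0)"
          proof (rule field_differentiable_bound[of "cball 0 (cmod (h k))" G "\<lambda>t. pd j f (w + t *s axis j 1) - pd j f w"])
            fix t :: complex assume "t \<in> cball 0 (cmod (h k))"
            then have t: "cmod t \<le> cmod (h k)" "cmod t \<le> r" using hr(1)[of k] by auto
            have "w + t *s axis j 1 \<in> S" using inS[OF w t(2)] R(2) by auto
            from sep_holo_deriv[OF sep this]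
            show "(G has_field_derivative pd j f (w + t *s axis j 1) - pd j f w) (at t within cball 0 (cmod (h k)))"
              unfolding G_def by (auto intro!: derivative_eq_intros intro: has_field_derivative_at_within)
            show "cmod (pd j f (w + t *s axis j 1) - pd j f w) \<le> e / 2"
              using d(2)[OF inS[OF w, of 0] inS[OF w t(2)]] t elim hr(3)[of k] r by (auto simp: dist_norm)
          qed auto
          then have "cmod (f (w + h k *s axis j 1) - f w - pd j f w * h k) \<le> e / 2 * cmod (h k)"
            by (simp add: G_def algebra_simps)
          moreover have "g k w - pd j f w = (f (w + h k *s axis j 1) - f w - pd j f w * h k) * inverse (h k)"
            using hr(2)[of k] by (simp add: g_def field_simps)
          ultimately have "cmod (g k w - pd j f w) \<le> e / 2 * cmod (h k) * cmod (inverse (h k))"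
            by (simp only: norm_mult mult_right_mono norm_ge_zero)
          then have "cmod (g k w - pd j f w) \<le> e / 2"
            using hr(2)[of k] by (simp add: norm_inverse mult.assoc)
          then show "dist (g k w) (pd j f w) < e" using e by (simp add: dist_norm)
        qed
      qed
    qed
    then show "\<exists>U. open U \<and> w \<in> U \<and> uniform_limit (U \<inter> ball z r) g (pd j f) sequentially" if "w \<in> ball z r" for w
      using that by (intro exI[of _ "ball z r"]) auto
  qed auto
  then show "\<exists>U. open U \<and> z \<in> U \<and> holo_fun U (pd j f)" using r by (intro exI[of _ "ball z r"]) auto
qed

section \<open>Rado's theorem\<close>

text \<open>On the frontier \<open>f * p ^ n\<close> is bounded by \<open>M * B ^ n\<close>, because
  it vanishes wherever the bound on \<open>p\<close> is missing. The maximum principle yields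
  \<open>cmod (f z) * (cmod (p z) / B) ^ n \<le> M\<close>, which fails for large \<open>n\<close>
  if the ratio exceeds 1.\<close>

lemma max_modulus_off_zeros:
  fixes f p :: "complex \<Rightarrow> complex"
  assumes N: "open N" "bounded N"
    and cont: "continuous_on (closure N) f" "continuous_on (closure N) p"
    and hol: "f holomorphic_on N" "p holomorphic_on N"
    and fr: "\<And>z. z \<in> frontier N \<Longrightarrow> f z = 0 \<or> cmod (p z) \<le> B" and B: "B > 0"
    and z: "z \<in> N" "f z \<noteq> 0"
  shows "cmod (p z) \<le> B"
proof (rule ccontr)
  assume "\<not> cmod (p z) \<le> B"
  then have x: "cmod (p z) / B > 1" using B by simp
  have "compact (closure N)" using N(2) by (simp add: compact_closure)
  then have "bounded (f ` closure N)" using cont(1) compact_continuous_image compact_imp_bounded by blast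
  then obtain M where M: "M > 0" "\<And>z. z \<in> closure N \<Longrightarrow> cmod (f z) \<le> M"
    unfolding bounded_pos by auto
  obtain n where n: "M / cmod (f z) < (cmod (p z) / B) ^ n" using real_arch_pow[OF x] by blast
  have "cmod (f z * p z ^ n) \<le> M * B ^ n"
  proof (rule maximum_modulus_frontier[of "\<lambda>z. f z * p z ^ n" N])
    show "(\<lambda>z. f z * p z ^ n) holomorphic_on interior N"
      using hol N(1) by (auto simp: interior_open intro!: holomorphic_intros)
    show "continuous_on (closure N) (\<lambda>z. f z * p z ^ n)" by (intro continuous_intros cont)
    show "cmod (f w * p w ^ n) \<le> M * B ^ n" if w: "w \<in> frontier N" for w
    proof (cases "f w = 0")
      case False
      then have "cmod (p w) \<le> B" using fr w by blast
      moreover have "cmod (f w) \<le> M" using w M by (auto simp: frontier_def)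
      ultimately show ?thesis using M(1) by (auto simp: norm_mult norm_power intro!: mult_mono power_mono)
    qed (use M B in auto)
  qed (use N z in auto)
  then have "cmod (f z) * (cmod (p z) / B) ^ n \<le> M"
    using B by (simp add: norm_mult norm_power power_divide field_simps)
  then show False using n z(2) by (simp add: field_simps)
qed

text \<open>On the circle the real part of \<open>z\<close> is \<open>(z + 1 / z) / 2\<close>, and
  similarly for the imaginary part, so a real polynomial becomes a Laurent polynomial in
  \<open>z\<close>; the factor \<open>z ^ n\<close> clears its negative powers.\<close>

lemma real_polynomial_circle:
  fixes g :: "complex \<Rightarrow> real"
  assumes "real_polynomial_function g"
  shows "\<exists>n P. \<forall>z. cmod z = 1 \<longrightarrow> z ^ n * complex_of_real (g z) = poly P z"
  using assms
proof (induction g rule: real_polynomial_function.induct)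
  case (linear f)
  interpret bounded_linear f by fact
  have f: "f z = Re z * f 1 + Im z * f \<i>" for z
  proof -
    have "z = Re z *\<^sub>R 1 + Im z *\<^sub>R \<i>" by (simp add: complex_eq_iff)
    then have "f z = f (Re z *\<^sub>R 1 + Im z *\<^sub>R \<i>)" by simp
    then show ?thesis by (simp only: add scaleR real_scaleR_def)
  qed
  define P where "P = [:(f 1 + \<i> * f \<i>) / 2, 0, (f 1 - \<i> * f \<i>) / 2:]"
  have "z ^ 1 * complex_of_real (f z) = poly P z" if "cmod z = 1" for z
  proof -
    have zz: "z * cnj z = 1" using that by (simp add: complex_norm_square[symmetric])
    have re: "complex_of_real (Re z) = (z + cnj z) / 2" by (simp add: complex_eq_iff)
    have im: "complex_of_real (Im z) = - \<i> * (z - cnj z) / 2" by (simp add: complex_eq_iff)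
    have "z * complex_of_real (f z) = (z * z + z * cnj z) / 2 * f 1 - \<i> * (z * z - z * cnj z) / 2 * f \<i>"
      unfolding f[of z] of_real_add of_real_mult re im by (simp add: field_simps)
    then show ?thesis unfolding zz by (simp add: field_simps P_def)
  qed
  then show ?case by blast
next
  case (const c)
  show ?case by (intro exI[of _ 0] exI[of _ "[:complex_of_real c:]"]) auto
next
  case (add f g)
  then obtain n P m Q where
    *: "\<And>z. cmod z = 1 \<Longrightarrow> z ^ n * complex_of_real (f z) = poly P z"
       "\<And>z. cmod z = 1 \<Longrightarrow> z ^ m * complex_of_real (g z) = poly Q z" by blast
  have "z ^ (n + m) * complex_of_real (f z + g z) = poly (monom 1 m * P + monom 1 n * Q) z" if "cmod z = 1" for z
    by (simp add: *[OF that, symmetric] poly_monom power_add algebra_simps)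
  then show ?case by blast
next
  case (mult f g)
  then obtain n P m Q where
    *: "\<And>z. cmod z = 1 \<Longrightarrow> z ^ n * complex_of_real (f z) = poly P z"
       "\<And>z. cmod z = 1 \<Longrightarrow> z ^ m * complex_of_real (g z) = poly Q z" by blast
  have "z ^ (n + m) * complex_of_real (f z * g z) = poly (P * Q) z" if "cmod z = 1" for z
    by (simp add: *[OF that, symmetric] power_add algebra_simps)
  then show ?case by blast
qed

text \<open>On the unit circle \<open>cnj z = 1 / z\<close>, so real trigonometric polynomials are real parts of polynomials.\<close>

lemma circle_Re_approx:
  fixes u :: "complex \<Rightarrow> real"
  assumes "continuous_on (sphere 0 1) u" "e > 0"
  shows "\<exists>H. H holomorphic_on UNIV \<and> (\<forall>z. cmod z = 1 \<longrightarrow> \<bar>u z - Re (H z)\<bar> < e)"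
proof -
  obtain g where g: "real_polynomial_function g" "\<And>z. z \<in> sphere 0 1 \<Longrightarrow> \<bar>u z - g z\<bar> < e"
    using Stone_Weierstrass_real_polynomial_function[OF compact_sphere assms] by metis
  obtain n P where P: "\<And>z. cmod z = 1 \<Longrightarrow> z ^ n * complex_of_real (g z) = poly P z"
    using real_polynomial_circle[OF g(1)] by blast
  \<comment> \<open>The terms of index \<open>k < n\<close> are negative powers of \<open>z\<close>;
    conjugating them keeps the real part on the circle and turns them into powers of
    \<open>z\<close>.\<close>
  define H where "H z = (\<Sum>k\<le>degree P. if n \<le> k then coeff P k * z ^ (k - n) else cnj (coeff P k) * z ^ (n - k))" for z
  have "g z = Re (H z)" if z: "cmod z = 1" for z
  proof -
    have zz: "cnj z * z = 1" using z by (simp add: complex_norm_square[symmetric] mult.commute)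
    have pz: "cnj z ^ k * z ^ k = 1" for k using zz by (simp add: power_mult_distrib[symmetric])
    have "complex_of_real (g z) = cnj z ^ n * z ^ n * complex_of_real (g z)" by (simp add: pz)
    also have "\<dots> = cnj z ^ n * poly P z" using P[OF z] by (simp add: mult.assoc)
    also have "\<dots> = (\<Sum>k\<le>degree P. coeff P k * (cnj z ^ n * z ^ k))"
      by (simp add: poly_altdef sum_distrib_left mult_ac)
    finally have "g z = (\<Sum>k\<le>degree P. Re (coeff P k * (cnj z ^ n * z ^ k)))"
      by (metis Re_complex_of_real Re_sum)
    also have "\<dots> = (\<Sum>k\<le>degree P. Re (if n \<le> k then coeff P k * z ^ (k - n) else cnj (coeff P k) * z ^ (n - k)))"
    proof (rule sum.cong)
      fix k
      show "Re (coeff P k * (cnj z ^ n * z ^ k)) = Re (if n \<le> k then coeff P k * z ^ (k - n) else cnj (coeff P k) * z ^ (n - k))"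
      proof (cases "n \<le> k")
        case True
        then have "cnj z ^ n * z ^ k = z ^ (k - n)"
          using pz[of n] power_add[of z n "k - n"] by (simp add: mult.assoc[symmetric])
        then show ?thesis using True by simp
      next
        case False
        then have "cnj z ^ n = cnj z ^ (n - k) * cnj z ^ k" by (simp flip: power_add)
        then have "cnj z ^ n * z ^ k = cnj z ^ (n - k)" using pz[of k] by (simp add: mult.assoc)
        then have "Re (coeff P k * (cnj z ^ n * z ^ k)) = Re (cnj (coeff P k * cnj z ^ (n - k)))"
          by (simp only: cnj.sel(1))
        then show ?thesis using False
          by (simp only: complex_cnj_mult complex_cnj_power complex_cnj_cnj if_False)
      qed
    qed simp
    finally show ?thesis by (simp add: H_def)
  qed
  moreover have "H holomorphic_on UNIV"
    unfolding H_def
  proof (intro holomorphic_on_sum)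
    fix k
    show "(\<lambda>z. if n \<le> k then coeff P k * z ^ (k - n) else cnj (coeff P k) * z ^ (n - k)) holomorphic_on UNIV"
      by (cases "n \<le> k") (auto intro!: holomorphic_intros)
  qed
  ultimately show ?thesis using g(2) by (intro exI[of _ H]) auto
qed

text \<open>The modulus of \<open>exp (h z)\<close> lies between \<open>exp (- B)\<close> and
  \<open>exp B\<close>. Cauchy's estimate for this function, divided by its modulus, bounds
  \<open>deriv h\<close>, and hence \<open>h\<close>, starting from the real value at 0. This
  provides the local bounds for Montel's theorem from bounds on real parts.\<close>

lemma bounded_Re_imp_bounded:
  assumes hol: "h holomorphic_on ball 0 1" and B: "\<And>z. cmod z < 1 \<Longrightarrow> \<bar>Re (h z)\<bar> \<le> B"
    and 0: "Im (h 0) = 0" and z: "cmod z \<le> s" and s: "s < 1"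
  shows "cmod (h z) \<le> B + 2 * exp (2 * B) / (1 - s)"
proof -
  \<comment> \<open>Closed discs of this radius about points of \<open>cball 0 s\<close> stay in the
    open unit disc.\<close>
  define r where "r = (1 - s) / 2"
  have r: "r > 0" using s by (simp add: r_def)
  have s0: "0 \<le> s" using z norm_ge_zero order_trans by blast
  have bd: "cmod (deriv h w) \<le> exp (2 * B) / r" if w: "w \<in> cball 0 s" for w
  proof -
    have sub: "cball w r \<subseteq> ball 0 1"
    proof
      fix x assume "x \<in> cball w r"
      then have "cmod x \<le> s + r" using w norm_triangle_ineq2[of x w] by (simp add: dist_norm norm_minus_commute)
      then show "x \<in> ball 0 1" using s by (simp add: r_def field_simps)
    qed
    have hol': "(\<lambda>z. exp (h z)) holomorphic_on ball 0 1" by (intro holomorphic_intros hol)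
    have "cmod ((deriv ^^ 1) (\<lambda>z. exp (h z)) w) \<le> fact 1 * exp B / r ^ 1"
    proof (rule Cauchy_inequality[OF _ _ r])
      show "(\<lambda>z. exp (h z)) holomorphic_on ball w r" using hol' sub ball_subset_cball holomorphic_on_subset by blast
      show "continuous_on (cball w r) (\<lambda>z. exp (h z))"
        using hol' sub holomorphic_on_imp_continuous_on continuous_on_subset by blast
      show "cmod (exp (h x)) \<le> exp B" if "cmod (w - x) = r" for x
        using B[of x] sub that by (auto simp: subset_iff dist_norm)
    qed
    moreover have "w \<in> ball 0 1" using subsetD[OF sub, of w] r by simp
    then have "deriv (\<lambda>z. exp (h z)) w = exp (h w) * deriv h w"
      using hol by (intro DERIV_imp_deriv) (auto intro!: derivative_eq_intros holomorphic_derivI)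
    ultimately have "exp (Re (h w)) * cmod (deriv h w) \<le> exp B / r" by (simp add: norm_mult)
    moreover have "exp (- B) \<le> exp (Re (h w))" using B[of w] \<open>w \<in> ball 0 1\<close> by (simp add: abs_le_iff)
    ultimately have "exp (- B) * cmod (deriv h w) \<le> exp B / r"
      by (meson mult_right_mono norm_ge_zero order_trans)
    then have "exp B * (exp (- B) * cmod (deriv h w)) \<le> exp B * (exp B / r)"
      by (rule mult_left_mono) simp
    then show ?thesis by (simp add: mult.assoc[symmetric] exp_add[symmetric])
  qed
  have "cmod (h z - h 0) \<le> exp (2 * B) / r * cmod (z - 0)"
  proof (rule field_differentiable_bound[of "cball 0 s" h "deriv h"])
    fix w :: complex assume w: "w \<in> cball 0 s"
    then have "w \<in> ball 0 1" using s by auto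
    then show "(h has_field_derivative deriv h w) (at w within cball 0 s)"
      using hol holomorphic_derivI[OF hol open_ball] has_field_derivative_at_within by blast
    show "cmod (deriv h w) \<le> exp (2 * B) / r" using bd[OF w] .
  qed (use z s0 in auto)
  also have "\<dots> \<le> exp (2 * B) / r * 1" using z s r by (intro mult_left_mono) auto
  finally have "cmod (h z - h 0) \<le> 2 * exp (2 * B) / (1 - s)" by (simp add: r_def mult.commute)
  moreover have "cmod (h 0) \<le> B" using B[of 0] 0 by (simp add: cmod_eq_Re)
  ultimately show ?thesis using norm_triangle_ineq[of "h z - h 0" "h 0"] by simp
qed

text \<open>The real derivative of \<open>Re (h w)\<close> in direction \<open>v\<close> is
  \<open>Re (d * v)\<close>; the direction \<open>cnj d\<close> recovers the square of
  \<open>cmod d\<close>.\<close>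

lemma Re_eq_0_imp_deriv_0:
  assumes "(h has_field_derivative d) (at z)" "open U" "z \<in> U" "\<And>w. w \<in> U \<Longrightarrow> Re (h w) = 0"
  shows "d = 0"
proof -
  have "((\<lambda>w. Re (h w)) has_derivative (\<lambda>v. Re (d * v))) (at z)"
    using assms(1) unfolding has_field_derivative_def
    by (rule bounded_linear.has_derivative[OF bounded_linear_Re])
  moreover have "((\<lambda>w. Re (h w)) has_derivative (\<lambda>v. 0)) (at z)"
    by (rule has_derivative_transform_within_open[of "\<lambda>_. 0"]) (use assms in auto)
  ultimately have "(\<lambda>v. Re (d * v)) = (\<lambda>v. 0)" by (rule has_derivative_unique)
  then have "Re (d * cnj d) = 0" by (rule fun_cong)
  then show ?thesis by (simp add: complex_mult_cnj sum_power2_eq_zero_iff complex_eq_iff)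
qed

text \<open>Rado's theorem on the disc.  By the maximum principle for \<open>f * p ^ n\<close>, the zero set of \<open>f\<close>
  is negligible for the maximum principle, so that real parts of polynomials approximating
  \<open>Re f\<close> and \<open>Im f\<close> on the circle converge to them on the disc.\<close>

lemma rado_disc:
  assumes cont: "continuous_on (cball 0 1) f" and hol: "f holomorphic_on {z \<in> ball 0 1. f z \<noteq> 0}"
  shows "f holomorphic_on ball 0 1"
proof -
  define D where "D = ball (0::complex) 1"
  define N where "N = {z \<in> D. f z \<noteq> 0}"
  \<comment> \<open>\<open>V\<close> is the interior of the zero set of \<open>f\<close> in the
    disc. The function is holomorphic on \<open>N\<close> and on \<open>V\<close>, and
    \<open>N \<union> V\<close> is dense in the disc.\<close>
  define V where "V = D - closure N"
  have contD: "continuous_on D f" using cont by (rule continuous_on_subset) (auto simp: D_def)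
  have "open (D \<inter> f -` (- {0}))" by (rule continuous_open_preimage[OF contD]) (auto simp: D_def)
  moreover have "D \<inter> f -` (- {0}) = N" by (auto simp: N_def)
  ultimately have oN: "open N" by simp
  have oV: "open V" by (auto simp: V_def D_def)
  have clD: "closure D = cball 0 1" by (simp add: D_def closure_ball)
  have clN: "closure N \<subseteq> cball 0 1" using closure_mono[of N D] clD by (auto simp: N_def)
  have clV: "closure V \<subseteq> cball 0 1" using closure_mono[of V D] clD by (auto simp: V_def)
  have fV: "f z = 0" if "z \<in> V" for z using that closure_subset[of N] by (auto simp: V_def N_def)
  have holN: "f holomorphic_on N" using hol by (simp add: N_def D_def)
  have holV: "f holomorphic_on V" by (rule holomorphic_transform[of "\<lambda>_. 0"]) (auto simp: fV)
  \<comment> \<open>The bound on the circle passes to \<open>N\<close>, since \<open>f\<close>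
    vanishes at the frontier points inside the disc, then to \<open>closure N\<close> by continuity,
    and finally to \<open>V\<close>, whose frontier is contained in the circle and
    \<open>closure N\<close>.\<close>
  have max: "cmod (p z) \<le> B"
    if p: "continuous_on (cball 0 1) p" "p holomorphic_on N" "p holomorphic_on V"
      and B: "B > 0" "\<And>z. cmod z = 1 \<Longrightarrow> cmod (p z) \<le> B" and z: "z \<in> D" for p B z
  proof -
    have bN: "cmod (p z) \<le> B" if "z \<in> N" for z
    proof (rule max_modulus_off_zeros[OF oN _ _ _ holN p(2) _ B(1) that])
      show "bounded N" by (rule bounded_subset[of D]) (auto simp: N_def D_def)
      show "continuous_on (closure N) f" "continuous_on (closure N) p"
        using cont p(1) clN continuous_on_subset by blast+
      show "f w = 0 \<or> cmod (p w) \<le> B" if w: "w \<in> frontier N" for w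
      proof -
        have "cmod w \<le> 1" "w \<notin> N" using w clN oN by (auto simp: frontier_def interior_open)
        then show ?thesis using B(2)[of w] by (cases "cmod w = 1") (auto simp: N_def D_def)
      qed
      show "f z \<noteq> 0" using that by (simp add: N_def)
    qed
    have bcl: "cmod (p z) \<le> B" if "z \<in> closure N" for z
    proof (rule continuous_le_on_closure[OF _ that bN])
      show "continuous_on (closure N) (\<lambda>z. cmod (p z))"
        using p(1) clN by (intro continuous_intros) (auto intro: continuous_on_subset)
    qed
    show ?thesis
    proof (cases "z \<in> closure N")
      case False
      show ?thesis
      proof (rule maximum_modulus_frontier[of p V])
        show "p holomorphic_on interior V" using p(3) oV by (simp add: interior_open)
        show "continuous_on (closure V) p" using p(1) clV continuous_on_subset by blast
        show "bounded V" by (rule bounded_subset[of D]) (auto simp: V_def D_def)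
        show "z \<in> V" using z False by (simp add: V_def)
        show "cmod (p w) \<le> B" if w: "w \<in> frontier V" for w
        proof -
          have "cmod w \<le> 1" "w \<notin> V" using w clV oV by (auto simp: frontier_def interior_open)
          then show ?thesis using B(2)[of w] bcl[of w] by (cases "cmod w = 1") (auto simp: V_def D_def)
        qed
      qed
    qed (rule bcl)
  qed
  have harm: "\<exists>H. H holomorphic_on D \<and> (\<forall>z\<in>D. Re (H z) = Re (c * f z))" for c
  proof -
    have "\<exists>H. H holomorphic_on UNIV \<and> (\<forall>z\<in>D. \<bar>Re (c * f z) - Re (H z)\<bar> \<le> e)" if e: "e > 0" for e
    proof -
      have "continuous_on (sphere 0 1) (\<lambda>z. Re (c * f z))"
        by (intro continuous_intros continuous_on_subset[OF cont]) auto
      from circle_Re_approx[OF this e] obtain H where H: "H holomorphic_on UNIV"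
        "\<And>z. cmod z = 1 \<Longrightarrow> \<bar>Re (c * f z) - Re (H z)\<bar> < e" by blast
      have cH: "continuous_on (cball 0 1) H"
        using H(1) holomorphic_on_imp_continuous_on continuous_on_subset by blast
      have "Re (c * f z) - Re (H z) \<le> e" "Re (H z) - Re (c * f z) \<le> e" if z: "z \<in> D" for z
      proof -
        \<comment> \<open>Exponentials turn bounds on real parts into bounds on moduli, to which
          \<open>max\<close> applies; the two signs give the two inequalities.\<close>
        have "cmod (exp (c * f z - H z)) \<le> exp e"
        proof (rule max[OF _ _ _ _ _ z])
          show "cmod (exp (c * f w - H w)) \<le> exp e" if "cmod w = 1" for w
            using H(2)[OF that] by simp
        qed (auto intro!: holomorphic_intros continuous_intros cont cH holN holV holomorphic_on_subset[OF H(1)])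
        then show "Re (c * f z) - Re (H z) \<le> e" by simp
        have "cmod (exp (H z - c * f z)) \<le> exp e"
        proof (rule max[OF _ _ _ _ _ z])
          show "cmod (exp (H w - c * f w)) \<le> exp e" if "cmod w = 1" for w
            using H(2)[OF that] by simp
        qed (auto intro!: holomorphic_intros continuous_intros cont cH holN holV holomorphic_on_subset[OF H(1)])
        then show "Re (H z) - Re (c * f z) \<le> e" by simp
      qed
      then show ?thesis using H(1) by (intro exI[of _ H]) (auto simp: abs_le_iff)
    qed
    then have "\<forall>n::nat. \<exists>H. H holomorphic_on UNIV \<and> (\<forall>z\<in>D. \<bar>Re (c * f z) - Re (H z)\<bar> \<le> 1 / Suc n)"
      by (simp del: of_nat_Suc)
    from choice[OF this] obtain H
      where HH: "\<forall>n::nat. H n holomorphic_on UNIV \<and> (\<forall>z\<in>D. \<bar>Re (c * f z) - Re (H n z)\<bar> \<le> 1 / Suc n)" ..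
    have H: "H n holomorphic_on UNIV" "z \<in> D \<Longrightarrow> \<bar>Re (c * f z) - Re (H n z)\<bar> \<le> 1 / Suc n" for n z
      using HH by blast+
    \<comment> \<open>A real part determines its function only up to an imaginary constant; making
      the value at 0 real leaves a locally bounded sequence.\<close>
    define K where "K n z = H n z - \<i> * Im (H n 0)" for n :: nat and z
    have "bounded (f ` cball 0 1)"
      by (rule compact_imp_bounded[OF compact_continuous_image[OF cont compact_cball]])
    then obtain M where "\<forall>y\<in>f ` cball 0 1. cmod y \<le> M"
      unfolding bounded_iff by blast
    then have M: "\<And>z. z \<in> cball 0 1 \<Longrightarrow> cmod (f z) \<le> M" by blast
    define B where "B = cmod c * M + 1"
    have KB: "\<bar>Re (K n z)\<bar> \<le> B" if "cmod z < 1" for n z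
    proof -
      have "\<bar>Re (c * f z)\<bar> \<le> cmod c * M"
        using abs_Re_le_cmod[of "c * f z"] M[of z] that mult_left_mono[of "cmod (f z)" M "cmod c"]
        by (simp add: norm_mult)
      moreover have "1 / real (Suc n) \<le> 1" by simp
      moreover have "\<bar>Re (c * f z) - Re (H n z)\<bar> \<le> 1 / real (Suc n)"
        using H(2)[of z n] that by (simp add: D_def)
      moreover have "Re (K n z) = Re (H n z)" by (simp add: K_def)
      ultimately show ?thesis unfolding B_def by linarith
    qed
    have Kh: "K n holomorphic_on D" for n
      unfolding K_def by (intro holomorphic_intros holomorphic_on_subset[OF H(1)]) auto
    obtain G r where G: "G holomorphic_on D" "strict_mono (r :: nat \<Rightarrow> nat)"
      "\<And>x. x \<in> D \<Longrightarrow> (\<lambda>n. K (r n) x) \<longlonglongrightarrow> G x"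
    proof (rule Montel[of D "range K" K])
      show "\<exists>B. \<forall>h\<in>range K. \<forall>z\<in>L. cmod (h z) \<le> B" if L: "compact L" "L \<subseteq> D" for L
      proof -
        obtain s where s: "s < 1" "\<And>z. z \<in> L \<Longrightarrow> cmod z \<le> s"
        proof (cases "L = {}")
          case False
          then obtain x where "x \<in> L" "\<And>y. y \<in> L \<Longrightarrow> cmod y \<le> cmod x"
            using continuous_attains_sup[OF L(1), of cmod] by (auto intro!: continuous_intros)
          then show ?thesis using L(2) by (intro that[of "cmod x"]) (auto simp: D_def)
        qed (use that[of 0] in auto)
        show ?thesis
          using bounded_Re_imp_bounded[OF Kh[unfolded D_def] KB _ s(2) s(1)]
          by (intro exI[of _ "B + 2 * exp (2 * B) / (1 - s)"]) (auto simp: K_def)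
      qed
      show "range K \<subseteq> range K" by simp
    qed (use Kh in \<open>auto simp: D_def\<close>)
    have "Re (G z) = Re (c * f z)" if z: "z \<in> D" for z
    proof (rule LIMSEQ_unique)
      show "(\<lambda>n. Re (K (r n) z)) \<longlonglongrightarrow> Re (G z)" by (intro tendsto_Re G(3) z)
      have "(\<lambda>n. Re (K n z)) \<longlonglongrightarrow> Re (c * f z)"
      proof (rule LIMSEQ_I)
        fix e :: real assume "e > 0"
        then obtain n0 where n0: "1 / real (Suc n0) < e" using nat_approx_posE by blast
        have "norm (Re (K n z) - Re (c * f z)) < e" if "n \<ge> n0" for n
        proof -
          have "1 / real (Suc n) \<le> 1 / real (Suc n0)" using that by (simp add: frac_le)
          then show ?thesis using H(2)[OF z, of n] n0 by (simp add: K_def)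
        qed
        then show "\<exists>n0. \<forall>n\<ge>n0. norm (Re (K n z) - Re (c * f z)) < e" by blast
      qed
      then show "(\<lambda>n. Re (K (r n) z)) \<longlonglongrightarrow> Re (c * f z)"
        using LIMSEQ_subseq_LIMSEQ[OF _ G(2)] by (auto simp: o_def)
    qed
    then show ?thesis using G(1) by blast
  qed
  obtain H where H: "H holomorphic_on D" "\<And>z. z \<in> D \<Longrightarrow> Re (H z) = Re (f z)" using harm[of 1] by auto
  obtain G where G: "G holomorphic_on D" "\<And>z. z \<in> D \<Longrightarrow> Re (G z) = Im (f z)" using harm[of "- \<i>"] by auto
  have oD: "open D" by (simp add: D_def)
  \<comment> \<open>The derivative of \<open>H - \<i> * G\<close>. Where \<open>f\<close> is
    holomorphic, the derivatives of \<open>H\<close> and \<open>G\<close> are those of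
    \<open>f\<close> and \<open>- \<i> * f\<close>, so \<open>d\<close> vanishes on a dense set.
    Thus \<open>H - \<i> * G\<close> is constant, and \<open>f\<close> is \<open>\<i> * G\<close>
    plus a constant.\<close>
  define d where "d z = deriv H z - \<i> * deriv G z" for z
  have HG: "((\<lambda>z. H z - \<i> * G z) has_field_derivative d z) (at z)" if "z \<in> D" for z
    unfolding d_def by (intro DERIV_diff DERIV_cmult holomorphic_derivI[OF H(1) oD that] holomorphic_derivI[OF G(1) oD that])
  have d0: "d z = 0" if W: "W = N \<or> W = V" and z: "z \<in> W" for W z
  proof -
    have W': "open W" "W \<subseteq> D" "f holomorphic_on W" using W oN oV holN holV by (auto simp: N_def V_def)
    note zD = subsetD[OF W'(2) z]
    have "((\<lambda>z. f z - H z) has_field_derivative deriv f z - deriv H z) (at z)"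
      by (intro derivative_intros holomorphic_derivI[OF H(1) oD zD] holomorphic_derivI[OF W'(3,1) z])
    then have 1: "deriv f z - deriv H z = 0"
      by (rule Re_eq_0_imp_deriv_0[OF _ W'(1) z]) (use W'(2) H(2) in auto)
    have "((\<lambda>z. - \<i> * f z - G z) has_field_derivative - \<i> * deriv f z - deriv G z) (at z)"
      by (intro derivative_intros DERIV_cmult holomorphic_derivI[OF G(1) oD zD] holomorphic_derivI[OF W'(3,1) z])
    then have 2: "- \<i> * deriv f z - deriv G z = 0"
      by (rule Re_eq_0_imp_deriv_0[OF _ W'(1) z]) (use W'(2) G(2) in auto)
    have "deriv H z = deriv f z" "deriv G z = - \<i> * deriv f z" using 1 2 by auto
    then show ?thesis by (simp add: d_def)
  qed
  have "d z = 0" if z: "z \<in> D" for z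
  proof (rule ccontr)
    assume nz: "d z \<noteq> 0"
    have "continuous_on D d" unfolding d_def
      by (intro continuous_intros holomorphic_on_imp_continuous_on holomorphic_deriv H(1) G(1) oD)
    then have "open (D \<inter> d -` (- {0}))" by (rule continuous_open_preimage) (auto simp: oD)
    moreover have "D \<inter> d -` (- {0}) \<inter> N = {}" using d0[of N] by auto
    ultimately have "D \<inter> d -` (- {0}) \<inter> closure N = {}" using open_Int_closure_eq_empty by blast
    then have "z \<in> V" using z nz by (auto simp: V_def)
    then show False using d0[of V] nz by blast
  qed
  then have "((\<lambda>z. H z - \<i> * G z) has_field_derivative 0) (at z within D)" if "z \<in> D" for z
    using HG[OF that] that has_field_derivative_at_within by fastforce
  then obtain c where c: "\<And>z. z \<in> D \<Longrightarrow> H z - \<i> * G z = c"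
    using has_field_derivative_zero_constant[of D "\<lambda>z. H z - \<i> * G z"] by (auto simp: D_def)
  have fz: "f z = \<i> * G z + Re c" if z: "z \<in> D" for z
    using H(2)[OF z] G(2)[OF z] c[OF z] by (auto simp: complex_eq_iff)
  have "(\<lambda>z. \<i> * G z + Re c) holomorphic_on D" by (intro holomorphic_intros G(1))
  then have "f holomorphic_on D" by (rule holomorphic_transform) (simp add: fz)
  then show ?thesis by (simp add: D_def)
qed

lemma rado:
  assumes S: "open S" and cont: "continuous_on S f" and hol: "f holomorphic_on {z \<in> S. f z \<noteq> 0}"
  shows "f holomorphic_on S"
proof -
  have "\<exists>U. open U \<and> z \<in> U \<and> f holomorphic_on U" if z: "z \<in> S" for z
  proof -
    obtain r where r: "r > 0" "cball z r \<subseteq> S" using S z open_contains_cball by blast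
    define m where "m w = z + complex_of_real r * w" for w
    have mS: "m w \<in> S" if "cmod w \<le> 1" for w
    proof -
      have "m w \<in> cball z r" using that r by (simp add: m_def dist_norm norm_mult)
      then show ?thesis using r by auto
    qed
    have "(\<lambda>w. f (m w)) holomorphic_on ball 0 1"
    proof (rule rado_disc)
      show "continuous_on (cball 0 1) (\<lambda>w. f (m w))"
        by (rule continuous_on_compose2[OF cont]) (auto simp: mS m_def[abs_def] intro!: continuous_intros mS[unfolded m_def])
      have "(f \<circ> m) holomorphic_on {w \<in> ball 0 1. f (m w) \<noteq> 0}"
        by (rule holomorphic_on_compose_gen[OF _ hol]) (auto simp: mS m_def[abs_def] intro!: holomorphic_intros mS[unfolded m_def])
      then show "(\<lambda>w. f (m w)) holomorphic_on {w \<in> ball 0 1. f (m w) \<noteq> 0}" by (simp add: o_def)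
    qed
    then have "((\<lambda>w. f (m w)) \<circ> (\<lambda>w. (w - z) / r)) holomorphic_on ball z r"
      by (rule holomorphic_on_compose_gen[rotated])
         (use r in \<open>auto intro!: holomorphic_intros simp: dist_norm norm_divide norm_minus_commute\<close>)
    then have "f holomorphic_on ball z r"
      by (rule holomorphic_transform) (use r in \<open>auto simp: m_def\<close>)
    then show ?thesis using r by (intro exI[of _ "ball z r"]) auto
  qed
  then show ?thesis
    by (metis S analytic_imp_holomorphic analytic_on_def analytic_on_open holomorphic_on_subset open_contains_ball subsetD)
qed

lemma holomorphic_on_local:
  assumes "\<And>z. z \<in> S \<Longrightarrow> \<exists>U. open U \<and> z \<in> U \<and> f holomorphic_on U"
  shows "f holomorphic_on S"
  unfolding holomorphic_on_def
proof
  fix z assume "z \<in> S"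
  then obtain U where "open U" "z \<in> U" "f holomorphic_on U" using assms by blast
  then show "f field_differentiable at z within S"
    using holomorphic_on_imp_differentiable_at field_differentiable_at_within by blast
qed

text \<open>Rado's theorem on each complex line shows that \<open>g\<close> is holomorphic, so \<open>w\<close> is holomorphic
  on every line on which \<open>g\<close> is not identically zero; the other lines are limits of such lines.\<close>

lemma rado_removable:
  fixes g w :: "complex ^ 'n \<Rightarrow> complex"
  assumes U: "open U" and g: "continuous_on U g" "holo_fun {z\<in>U. g z \<noteq> 0} g"
    and w: "continuous_on U w" "holo_fun {z\<in>U. g z \<noteq> 0} w"
    and thin: "\<And>B. open B \<Longrightarrow> B \<subseteq> U \<Longrightarrow> \<forall>z\<in>B. g z = 0 \<Longrightarrow> B = {}"
  shows "holo_fun U w"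
proof -
  define U' where "U' = {z\<in>U. g z \<noteq> 0}"
  have "open (U \<inter> g -` (- {0}))" by (rule continuous_open_preimage[OF g(1) U]) auto
  moreover have "U \<inter> g -` (- {0}) = U'" by (auto simp: U'_def)
  ultimately have U': "open U'" by simp
  have lineU: "continuous_on {t. z + t *s v \<in> U} (\<lambda>t. f (z + t *s v))"
    if "continuous_on U f" for f :: "complex ^ 'n \<Rightarrow> complex" and z v
    by (rule continuous_on_compose2[OF that])
       (auto intro!: continuous_intros linear_continuous_on[OF bounded_linear_smult])
  have line': "(\<lambda>t. f (z + t *s v)) holomorphic_on {t. z + t *s v \<in> U'}"
    if "holo_fun {z\<in>U. g z \<noteq> 0} f" for f z v
    using holo_fun_line[OF that[folded U'_def] U'] .
  have gline: "(\<lambda>t. g (z + t *s v)) holomorphic_on {t. z + t *s v \<in> U}" for z v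
  proof (rule rado[OF open_line[OF U] lineU[OF g(1)]])
    have "{t \<in> {t. z + t *s v \<in> U}. g (z + t *s v) \<noteq> 0} = {t. z + t *s v \<in> U'}" by (auto simp: U'_def)
    then show "(\<lambda>t. g (z + t *s v)) holomorphic_on {t \<in> {t. z + t *s v \<in> U}. g (z + t *s v) \<noteq> 0}"
      using line'[OF g(2), of z v] by simp
  qed
  have "sep_holo U w"
  proof (rule sep_holoI)
    fix z0 j assume z0: "z0 \<in> U"
    let ?e = "axis j 1 :: complex ^ 'n"
    obtain R where R: "R > 0" "cball z0 R \<subseteq> U" using U z0 open_contains_cball by blast
    define r where "r = R / 2"
    have r: "r > 0" using R by (simp add: r_def)
    have inR: "z + t *s ?e \<in> cball z0 R" if "dist z z0 \<le> r" "cmod t \<le> r" for z t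
      using dist_triangle[of z0 "z + t *s ?e" z] that by (simp add: dist_norm r_def norm_minus_commute)
    have wline: "(\<lambda>t. w (z + t *s ?e)) holomorphic_on ball 0 r" if z: "dist z z0 \<le> r" "g z \<noteq> 0" for z
    proof (rule holomorphic_on_local)
      have sub: "ball 0 r \<subseteq> {t. z + t *s ?e \<in> U}" using inR[OF z(1)] R by auto
      fix t0 :: complex assume t0: "t0 \<in> ball 0 r"
      show "\<exists>V. open V \<and> t0 \<in> V \<and> (\<lambda>t. w (z + t *s ?e)) holomorphic_on V"
      proof (cases "g (z + t0 *s ?e) = 0")
        case False
        then have "t0 \<in> {t. z + t *s ?e \<in> U'}" using sub t0 by (auto simp: U'_def)
        then show ?thesis using line'[OF w(2)] open_line[OF U'] by blast
      next
        case True
        \<comment> \<open>Since \<open>g\<close> is nonzero at the centre of the line, its zeros on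
          the disc are isolated; the continuity of \<open>w\<close> makes them removable.\<close>
        obtain d where d: "d > 0" "ball t0 d \<subseteq> ball 0 r" "\<And>t. t \<in> ball t0 d - {t0} \<Longrightarrow> g (z + t *s ?e) \<noteq> 0"
        proof (rule isolated_zeros[of "\<lambda>t. g (z + t *s ?e)" "ball 0 r" t0 0])
          show "(\<lambda>t. g (z + t *s ?e)) holomorphic_on ball 0 r"
            using gline sub by (rule holomorphic_on_subset)
        qed (use True t0 r z(2) in auto)
        have "(\<lambda>t. w (z + t *s ?e)) holomorphic_on ball t0 d"
        proof (rule no_isolated_singularity[where K = "{t0}"])
          show "continuous_on (ball t0 d) (\<lambda>t. w (z + t *s ?e))"
            using lineU[OF w(1)] by (rule continuous_on_subset) (use d(2) sub in blast)
          show "(\<lambda>t. w (z + t *s ?e)) holomorphic_on ball t0 d - {t0}"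
            using line'[OF w(2)] by (rule holomorphic_on_subset) (use d sub in \<open>auto simp: U'_def\<close>)
        qed auto
        then show ?thesis using d(1) by (intro exI[of _ "ball t0 d"]) auto
      qed
    qed
    have "\<exists>z. dist z z0 < min r (1 / real (Suc k)) \<and> g z \<noteq> 0" for k
    proof (rule ccontr)
      assume *: "\<not> ?thesis"
      have "ball z0 (min r (1 / real (Suc k))) = {}"
        by (rule thin) (use * R in \<open>auto simp: dist_commute r_def subset_iff\<close>)
      moreover have "0 < min r (1 / real (Suc k))" using r by simp
      ultimately show False using centre_in_ball by blast
    qed
    then have "\<forall>k. \<exists>z. dist z z0 < min r (1 / real (Suc k)) \<and> g z \<noteq> 0" by blast
    from choice[OF this] obtain z where z: "\<forall>k. dist (z k) z0 < min r (1 / real (Suc k)) \<and> g (z k) \<noteq> 0" ..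
    have contR: "continuous_on (cball z0 R) w" using w(1) R(2) by (rule continuous_on_subset)
    have ul: "uniform_limit (cball 0 r) (\<lambda>k t. w (z k + t *s ?e)) (\<lambda>t. w (z0 + t *s ?e)) sequentially"
      unfolding uniform_limit_iff
    proof (intro allI impI)
      fix e :: real assume e: "e > 0"
      obtain d where d: "d > 0" "\<And>x y. x \<in> cball z0 R \<Longrightarrow> y \<in> cball z0 R \<Longrightarrow> dist y x < d \<Longrightarrow> dist (w y) (w x) < e"
        using uniformly_continuous_onE[OF compact_cball contR e] by blast
      have "(\<lambda>k. 1 / real (Suc k)) \<longlonglongrightarrow> 0" by real_asymp
      then have "\<forall>\<^sub>F k in sequentially. 1 / real (Suc k) < d" using d(1) by (rule order_tendstoD)
      then show "\<forall>\<^sub>F k in sequentially. \<forall>t\<in>cball 0 r. dist (w (z k + t *s ?e)) (w (z0 + t *s ?e)) < e"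
      proof eventually_elim
        case (elim k)
        have zk: "dist (z k) z0 < r" "dist (z k) z0 < d" using z[rule_format, of k] elim by (auto simp del: of_nat_Suc)
        show ?case
        proof
          fix t :: complex assume "t \<in> cball 0 r"
          then have "cmod t \<le> r" by simp
          then have "z k + t *s ?e \<in> cball z0 R" "z0 + t *s ?e \<in> cball z0 R"
            using inR[of "z k" t] inR[of z0 t] zk(1) r by auto
          moreover have "dist (z k + t *s ?e) (z0 + t *s ?e) < d" using zk(2) by (simp add: dist_norm)
          ultimately show "dist (w (z k + t *s ?e)) (w (z0 + t *s ?e)) < e" using d(2) by blast
        qed
      qed
    qed
    have "(\<lambda>t. w (z0 + t *s ?e)) holomorphic_on ball 0 r"
    proof (rule holomorphic_uniform_sequence)
      show "(\<lambda>t. w (z k + t *s ?e)) holomorphic_on ball 0 r" for k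
        by (rule wline) (use z[rule_format, of k] in auto)
      fix t :: complex assume "t \<in> ball 0 r"
      then obtain d where d: "d > 0" "cball t d \<subseteq> ball 0 r" using open_ball open_contains_cball by blast
      have "uniform_limit (cball t d) (\<lambda>k t. w (z k + t *s ?e)) (\<lambda>t. w (z0 + t *s ?e)) sequentially"
        by (rule uniform_limit_on_subset[OF ul]) (use d(2) ball_subset_cball[of 0 r] in blast)
      then show "\<exists>d>0. cball t d \<subseteq> ball 0 r \<and>
         uniform_limit (cball t d) (\<lambda>k t. w (z k + t *s ?e)) (\<lambda>t. w (z0 + t *s ?e)) sequentially"
        using d by blast
    qed auto
    then show "\<exists>r>0. (\<lambda>t. w (z0 + t *s ?e)) holomorphic_on ball 0 r" using r by blast
  qed
  then show ?thesis using sep_holo_imp_holo U w(1) by blast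
qed

section \<open>Inverses of injective holomorphic maps\<close>

definition jac_mat :: "(complex ^ 'n \<Rightarrow> complex ^ 'm) \<Rightarrow> complex ^ 'n \<Rightarrow> complex ^ 'n ^ 'm" where
  "jac_mat F z = (\<chi> i j. pd j (\<lambda>w. F w $ i) z)"

lemma has_derivative_jac_mat:
  fixes F :: "complex ^ 'n \<Rightarrow> complex ^ 'm"
  assumes "open S" "holo_map S F" "z \<in> S"
  shows "(F has_derivative (\<lambda>v. jac_mat F z *v v)) (at z)"
proof -
  have "((\<lambda>z. F z $ i) has_derivative (\<lambda>v. \<Sum>j\<in>UNIV. pd j (\<lambda>w. F w $ i) z * v $ j)) (at z)" for i
    using assms unfolding holo_map_def by (intro holo_fun_has_derivative[OF assms(1) _ assms(3)]) blast
  from has_derivative_vecI[OF this] show ?thesis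
    by (simp add: jac_mat_def matrix_vector_mult_def)
qed

lemma holo_fun_det_jac_mat:
  fixes F :: "complex ^ 'n \<Rightarrow> complex ^ 'n"
  assumes "open S" "holo_map S F"
  shows "holo_fun S (\<lambda>z. det (jac_mat F z))"
proof -
  have "holo_fun S (\<lambda>z. jac_mat F z $ i $ j)" for i j
    using assms unfolding jac_mat_def holo_map_def by (auto intro!: holo_fun_pd)
  then show ?thesis
    unfolding det_def by (intro holo_fun_sum holo_fun_mult holo_fun_const holo_fun_prod)
qed

text \<open>By Sard's theorem a map with everywhere singular derivative has negligible image,
  whereas invariance of domain makes the image of a nonempty open set open.\<close>

lemma injective_holo_jac_mat_not_identically_0:
  fixes F :: "complex ^ 'n \<Rightarrow> complex ^ 'n"
  assumes B: "open B" and F: "holo_map B F" "inj_on F B" and det: "\<And>z. z \<in> B \<Longrightarrow> det (jac_mat F z) = 0"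
  shows "B = {}"
proof (rule ccontr)
  assume ne: "B \<noteq> {}"
  have oFB: "open (F ` B)" by (rule invariance_of_domain[OF holo_map_continuous[OF F(1)] B F(2)])
  \<comment> \<open>Sard's theorem is applied in a real coordinate space; \<open>'n bit0\<close> has
    twice as many elements as \<open>'n\<close>, which is the real dimension of
    \<open>complex ^ 'n\<close>.\<close>
  have "DIM(complex ^ 'n) = DIM(real ^ 'n bit0)" by simp
  then obtain f :: "complex ^ 'n \<Rightarrow> real ^ 'n bit0" and g where fg: "linear f" "linear g"
    "\<And>x. g (f x) = x" "\<And>y. f (g y) = y"
    using isomorphisms_UNIV_UNIV by metis
  have bl: "bounded_linear f" "bounded_linear g" using fg by (auto simp: linear_conv_bounded_linear)
  have "negligible ((\<lambda>y. f (F (g y))) ` f ` B)"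
  proof (rule baby_Sard)
    fix y assume "y \<in> f ` B"
    then have gy: "g y \<in> B" using fg by auto
    have "((\<lambda>y. F (g y)) has_derivative (\<lambda>v. jac_mat F (g y) *v g v)) (at y)"
      by (rule has_derivative_compose[OF bounded_linear_imp_has_derivative[OF bl(2)] has_derivative_jac_mat[OF B F(1) gy]])
    from bounded_linear.has_derivative[OF bl(1) this]
    have der: "((\<lambda>y. f (F (g y))) has_derivative (\<lambda>v. f (jac_mat F (g y) *v g v))) (at y)" .
    then show "((\<lambda>y. f (F (g y))) has_derivative (\<lambda>v. f (jac_mat F (g y) *v g v))) (at y within f ` B)"
      by (rule has_derivative_at_withinI)
    have lin: "linear (\<lambda>v. f (jac_mat F (g y) *v g v))"
      using der has_derivative_bounded_linear linear_conv_bounded_linear by blast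
    have "\<not> inj ((*v) (jac_mat F (g y)))"
      using det[OF gy] det_nz_iff_inj_gen[OF matrix_vector_mul_linear_gen, of "jac_mat F (g y)"] by simp
    then obtain u v where uv: "u \<noteq> v" "jac_mat F (g y) *v u = jac_mat F (g y) *v v" unfolding inj_def by blast
    then have "f u \<noteq> f v" using fg(3) by metis
    moreover have "f (jac_mat F (g y) *v g (f u)) = f (jac_mat F (g y) *v g (f v))" using uv fg(3) by simp
    ultimately have "\<not> inj (\<lambda>v. f (jac_mat F (g y) *v g v))" unfolding inj_def by blast
    then show "rank (matrix (\<lambda>v. f (jac_mat F (g y) *v g v))) < CARD('n bit0)"
      unfolding less_rank_noninjective using matrix_vector_mul(2)[OF lin] by simp
  qed simp
  moreover have "(\<lambda>y. f (F (g y))) ` f ` B = g -` (F ` B)"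
  proof (intro equalityI subsetI)
    fix y assume "y \<in> g -` (F ` B)"
    then obtain z where "z \<in> B" "g y = F z" by auto
    then have "y = f (F (g (f z)))" using fg(3,4) by metis
    then show "y \<in> (\<lambda>y. f (F (g y))) ` f ` B" using \<open>z \<in> B\<close> by blast
  qed (auto simp: fg(3))
  moreover have "open (g -` (F ` B))"
    by (rule open_vimage[OF oFB]) (rule linear_continuous_on[OF bl(2)])
  moreover have "g -` (F ` B) \<noteq> {}" using ne fg(3) by (auto simp: vimage_def) 
  ultimately show False using open_not_negligible by metis
qed

text \<open>\<open>G\<close> is continuous by invariance of domain, and holomorphic where the
  Jacobian determinant \<open>g\<close>, viewed on the image, is nonzero. As \<open>g\<close> is
  continuous, holomorphic off its zeros and identically zero on no nonempty open set, the holomorphy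
  of the components of \<open>G\<close> extends across those zeros.\<close>

theorem holo_map_inv_into:
  fixes F :: "complex ^ 'n \<Rightarrow> complex ^ 'n"
  assumes \<Omega>: "open \<Omega>" and F: "holo_map \<Omega> F" "inj_on F \<Omega>"
  shows "open (F ` \<Omega>)" "holo_map (F ` \<Omega>) (inv_into \<Omega> F)"
proof -
  define G where "G = inv_into \<Omega> F"
  define U where "U = F ` \<Omega>"
  have cF: "continuous_on \<Omega> F" by (rule holo_map_continuous[OF F(1)])
  have U: "open U" unfolding U_def by (rule invariance_of_domain[OF cF \<Omega> F(2)])
  then show "open (F ` \<Omega>)" by (simp add: U_def)
  have GF: "G (F z) = z" if "z \<in> \<Omega>" for z using F(2) that by (simp add: G_def)
  have FG: "F (G y) = y" "G y \<in> \<Omega>" if "y \<in> U" for y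
    using that by (auto simp: G_def U_def f_inv_into_f inv_into_into)
  have cG: "continuous_on U G" unfolding U_def
    by (rule continuous_on_inverse_open[OF \<Omega> cF]) (auto simp: GF)
  define g where "g y = det (jac_mat F (G y))" for y
  have hdet: "holo_fun \<Omega> (\<lambda>z. det (jac_mat F z))" by (rule holo_fun_det_jac_mat[OF \<Omega> F(1)])
  have cg: "continuous_on U g" unfolding g_def
    by (rule continuous_on_compose2[OF holo_fun_continuous[OF hdet] cG]) (auto simp: FG)
  define U' where "U' = {y\<in>U. g y \<noteq> 0}"
  have "open (U \<inter> g -` (- {0}))" by (rule continuous_open_preimage[OF cg U]) auto
  moreover have "U \<inter> g -` (- {0}) = U'" by (auto simp: U'_def)
  ultimately have U': "open U'" by simp
  have hG: "holo_map U' G"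
  proof (rule holo_mapI)
    fix y assume "y \<in> U'"
    then have y: "y \<in> U" "det (jac_mat F (G y)) \<noteq> 0" by (auto simp: U'_def g_def)
    then obtain B where B: "B ** jac_mat F (G y) = mat 1"
      using invertible_det_nz invertible_def by blast
    have "(G has_derivative (\<lambda>v. B *v v)) (at y)"
    proof (rule has_derivative_inverse_basic[where f = F and g = G and y = y, OF has_derivative_jac_mat[OF \<Omega> F(1) FG(2)[OF y(1)]]])
      show "bounded_linear ((*v) B)" by simp
      show "(*v) B \<circ> (*v) (jac_mat F (G y)) = id" by (auto simp: fun_eq_iff matrix_vector_mul_assoc B)
      show "isCont G y" using cG U y(1) continuous_on_eq_continuous_at by blast
    qed (use U y FG in auto)
    then show "\<exists>G'. (G has_derivative G') (at y) \<and> (\<forall>c v. G' (c *s v) = c *s G' v)"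
      by (intro exI[of _ "\<lambda>v. B *v v"]) (auto simp: vector_scalar_commute)
  qed
  have hg: "holo_fun U' g"
    unfolding g_def by (rule holo_fun_compose[OF hdet hG U' \<Omega>]) (auto simp: U'_def FG)
  have thin: "B = {}" if B: "open B" "B \<subseteq> U" "\<forall>y\<in>B. g y = 0" for B
  proof -
    have oB: "open (\<Omega> \<inter> F -` B)" by (rule continuous_open_preimage[OF cF \<Omega> B(1)])
    have empty: "\<Omega> \<inter> F -` B = {}"
    proof (rule injective_holo_jac_mat_not_identically_0[OF oB])
      show "holo_map (\<Omega> \<inter> F -` B) F" using F(1) by (rule holo_map_subset) auto
      show "inj_on F (\<Omega> \<inter> F -` B)" using F(2) by (rule inj_on_subset) auto
      show "det (jac_mat F z) = 0" if "z \<in> \<Omega> \<inter> F -` B" for z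
        using B(3) that GF[of z] by (auto simp: g_def)
    qed
    then show ?thesis using B(2) unfolding U_def by blast
  qed
  have "holo_map U G"
    unfolding holo_map_def
  proof
    fix i
    show "holo_fun U (\<lambda>y. G y $ i)"
    proof (rule rado_removable[OF U cg _ _ _ thin])
      show "holo_fun {z \<in> U. g z \<noteq> 0} g" using hg by (simp add: U'_def)
      show "holo_fun {z \<in> U. g z \<noteq> 0} (\<lambda>y. G y $ i)" using hG by (simp add: U'_def holo_map_def)
      show "continuous_on U (\<lambda>y. G y $ i)" by (intro continuous_intros cG)
    qed
  qed
  then show "holo_map (F ` \<Omega>) (inv_into \<Omega> F)" by (simp add: U_def G_def)
qed

text \<open>Bilinear, without conjugation, so that \<open>exp (lin a z)\<close> is holomorphic in
  \<open>z\<close>.\<close>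

definition lin :: "complex ^ 'n \<Rightarrow> complex ^ 'n \<Rightarrow> complex" where
  "lin a z = (\<Sum>i\<in>UNIV. a $ i * z $ i)"

lemma lin_add: "lin (a + b) z = lin a z + lin b z"
  and lin_add_right: "lin a (z + w) = lin a z + lin a w"
  and lin_diff: "lin (a - b) z = lin a z - lin b z"
  and lin_diff_right: "lin a (z - w) = lin a z - lin a w"
  and lin_smult: "lin (c *s a) z = c * lin a z"
  and lin_smult_right: "lin a (c *s z) = c * lin a z"
  by (simp_all add: lin_def algebra_simps sum.distrib sum_subtractf sum_distrib_left)

lemma lin_zero [simp]: "lin 0 z = 0"
  by (simp add: lin_def)

lemma lin_axis: "lin (axis i c) z = c * z $ i"
proof -
  have "(\<Sum>j\<in>UNIV. axis i c $ j * z $ j) = (\<Sum>j\<in>UNIV. if j = i then c * z $ i else 0)"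
    by (intro sum.cong) (auto simp: axis_def)
  then show ?thesis by (simp add: lin_def)
qed

lemma holo_fun_lin [intro]: "holo_fun S (lin a)"
  unfolding lin_def[abs_def] by (intro holo_fun_sum holo_fun_mult holo_fun_const holo_fun_nth)

lemma continuous_on_lin [continuous_intros]:
  "continuous_on S f \<Longrightarrow> continuous_on S (\<lambda>x. lin a (f x))"
  unfolding lin_def by (intro continuous_intros)

lemma exp_first_order:
  fixes e :: real
  assumes "e > 0"
  obtains d where "d > 0" "\<And>w :: complex. cmod w < d \<Longrightarrow> cmod (exp w - 1 - w) \<le> e * cmod w"
proof -
  have "(*) (1::complex) = (\<lambda>v. v)" by (simp add: fun_eq_iff)
  then have "(exp has_derivative (\<lambda>v. v)) (at (0::complex))"
    using DERIV_exp[of "0::complex"] by (simp add: has_field_derivative_def)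
  then have "\<exists>d>0. \<forall>w. cmod (w - 0) < d \<longrightarrow> cmod (exp w - exp 0 - (w - 0)) \<le> e * cmod (w - 0)"
    using assms unfolding has_derivative_at_alt by blast
  then show thesis using that by auto
qed

lemma compact_norm_bound:
  fixes f :: "'a::topological_space \<Rightarrow> 'b::real_normed_vector"
  assumes "compact K" "continuous_on K f"
  obtains M where "M > 0" "\<And>x. x \<in> K \<Longrightarrow> norm (f x) \<le> M"
proof -
  have "bounded (f ` K)" by (rule compact_imp_bounded[OF compact_continuous_image[OF assms(2,1)]])
  then obtain M where "M > 0" "\<forall>y\<in>f ` K. norm y \<le> M" unfolding bounded_pos by blast
  then show thesis using that by blast
qed

section \<open>Approximation of entire functions by exponential sums\<close>

inductive exp_span :: "(complex ^ 'n \<Rightarrow> complex) \<Rightarrow> bool" where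
  exp_span_exp: "exp_span (\<lambda>z. c * exp (lin a z))"
| exp_span_add: "exp_span f \<Longrightarrow> exp_span g \<Longrightarrow> exp_span (\<lambda>z. f z + g z)"

lemma exp_span_continuous: "exp_span f \<Longrightarrow> continuous_on S f"
  by (induction rule: exp_span.induct) (auto intro!: continuous_intros)

text \<open>Exponents add, so the span is an algebra; it then suffices to reach coordinates in order
  to reach polynomials.\<close>

lemma exp_span_mult:
  assumes "exp_span f" "exp_span g"
  shows "exp_span (\<lambda>z. f z * g z)"
  using assms(1)
proof (induction rule: exp_span.induct)
  case (exp_span_exp c a)
  show ?case using assms(2)
  proof (induction rule: exp_span.induct)
    case (exp_span_exp d b)
    have "(\<lambda>z. c * exp (lin a z) * (d * exp (lin b z))) = (\<lambda>z. (c * d) * exp (lin (a + b) z))"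
      by (simp add: fun_eq_iff lin_add exp_add)
    then show ?case using exp_span.exp_span_exp by metis
  next
    case (exp_span_add f g)
    then show ?case using exp_span.exp_span_add by (fastforce simp: distrib_left)
  qed
next
  case (exp_span_add f g)
  then show ?case using exp_span.exp_span_add by (fastforce simp: distrib_right)
qed

text \<open>Continuity is part of the notion because products are estimated through bounds of their
  factors on compact sets.\<close>

definition exp_approx :: "(complex ^ 'n \<Rightarrow> complex) \<Rightarrow> bool" where
  "exp_approx f \<longleftrightarrow> continuous_on UNIV f \<and>
     (\<forall>K e. compact K \<longrightarrow> e > 0 \<longrightarrow> (\<exists>g. exp_span g \<and> (\<forall>z\<in>K. cmod (f z - g z) \<le> e)))"

lemma exp_approxD:
  assumes "exp_approx f" "compact K" "e > 0"
  obtains g where "exp_span g" "\<And>z. z \<in> K \<Longrightarrow> cmod (f z - g z) \<le> e"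
proof -
  obtain g where "exp_span g \<and> (\<forall>z\<in>K. cmod (f z - g z) \<le> e)"
    using assms(1)[unfolded exp_approx_def, THEN conjunct2, rule_format, OF assms(2,3)] ..
  then show thesis by (intro that[of g]) auto
qed

lemma exp_approx_continuous: "exp_approx f \<Longrightarrow> continuous_on S f"
  unfolding exp_approx_def using continuous_on_subset[OF _ subset_UNIV] by auto

lemma exp_approx_limit:
  assumes "continuous_on UNIV f"
    and "\<And>K e. compact K \<Longrightarrow> e > 0 \<Longrightarrow> \<exists>g. exp_approx g \<and> (\<forall>z\<in>K. cmod (f z - g z) \<le> e)"
  shows "exp_approx f"
  unfolding exp_approx_def
proof (intro conjI allI impI)
  fix K :: "(complex ^ 'a) set" and e :: real assume K: "compact K" "e > 0"
  then obtain g where g: "exp_approx g" "\<And>z. z \<in> K \<Longrightarrow> cmod (f z - g z) \<le> e / 2"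
    using assms(2)[of K "e / 2"] by auto
  obtain h where h: "exp_span h" "\<And>z. z \<in> K \<Longrightarrow> cmod (g z - h z) \<le> e / 2"
    using exp_approxD[OF g(1) K(1), of "e / 2"] K(2) by auto
  have "cmod (f z - h z) \<le> e" if "z \<in> K" for z
    using norm_triangle_ineq[of "f z - g z" "g z - h z"] g(2)[OF that] h(2)[OF that] by simp
  then show "\<exists>g. exp_span g \<and> (\<forall>z\<in>K. cmod (f z - g z) \<le> e)" using h(1) by blast
qed fact

lemma exp_span_approx: "exp_span f \<Longrightarrow> exp_approx f"
  unfolding exp_approx_def using exp_span_continuous[of f UNIV] by (auto intro!: exI[of _ f])

lemma exp_span_const: "exp_span (\<lambda>z. c)"
  using exp_span_exp[of c 0] by simp

lemma exp_approx_const: "exp_approx (\<lambda>z. c)"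
  by (rule exp_span_approx[OF exp_span_const])

lemma exp_approx_add:
  assumes "exp_approx f" "exp_approx g"
  shows "exp_approx (\<lambda>z. f z + g z)"
  unfolding exp_approx_def
proof (intro conjI allI impI)
  show "continuous_on UNIV (\<lambda>z. f z + g z)" by (intro continuous_intros exp_approx_continuous assms)
  fix K :: "(complex ^ 'a) set" and e :: real assume K: "compact K" "e > 0"
  obtain f1 where f1: "exp_span f1" "\<And>z. z \<in> K \<Longrightarrow> cmod (f z - f1 z) \<le> e / 2"
    using exp_approxD[OF assms(1) K(1), of "e / 2"] K(2) by auto
  obtain g1 where g1: "exp_span g1" "\<And>z. z \<in> K \<Longrightarrow> cmod (g z - g1 z) \<le> e / 2"
    using exp_approxD[OF assms(2) K(1), of "e / 2"] K(2) by auto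
  have "cmod (f z + g z - (f1 z + g1 z)) \<le> e" if "z \<in> K" for z
    using norm_triangle_ineq[of "f z - f1 z" "g z - g1 z"] f1(2)[OF that] g1(2)[OF that] by (simp add: algebra_simps)
  then show "\<exists>h. exp_span h \<and> (\<forall>z\<in>K. cmod (f z + g z - h z) \<le> e)"
    using exp_span_add[OF f1(1) g1(1)] by blast
qed

lemma exp_approx_mult:
  assumes "exp_approx f" "exp_approx g"
  shows "exp_approx (\<lambda>z. f z * g z)"
  unfolding exp_approx_def
proof (intro conjI allI impI)
  show "continuous_on UNIV (\<lambda>z. f z * g z)" by (intro continuous_intros exp_approx_continuous assms)
  fix K :: "(complex ^ 'a) set" and e :: real assume K: "compact K" "e > 0"
  obtain M where M: "M > 0" "\<And>z. z \<in> K \<Longrightarrow> norm (f z) \<le> M"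
    using compact_norm_bound[OF K(1) exp_approx_continuous[OF assms(1)]] by blast
  obtain N where N: "N > 0" "\<And>z. z \<in> K \<Longrightarrow> norm (g z) \<le> N"
    using compact_norm_bound[OF K(1) exp_approx_continuous[OF assms(2)]] by blast
  \<comment> \<open>The product error is at most \<open>M * d + d * (N + 1)\<close>, where
    \<open>d \<le> 1\<close> provides the bound \<open>N + 1\<close> for the approximant of
    \<open>g\<close>.\<close>
  define d where "d = min 1 (e / (M + N + 1))"
  have MN: "M + N + 1 > 0" using M(1) N(1) by simp
  have d: "d > 0" "d \<le> 1" "d \<le> e / (M + N + 1)" using K(2) MN by (auto simp: d_def)
  then have d': "d * (M + N + 1) \<le> e" using MN by (simp add: pos_le_divide_eq)
  obtain f1 where f1: "exp_span f1" "\<And>z. z \<in> K \<Longrightarrow> cmod (f z - f1 z) \<le> d"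
    using exp_approxD[OF assms(1) K(1) d(1)] by blast
  obtain g1 where g1: "exp_span g1" "\<And>z. z \<in> K \<Longrightarrow> cmod (g z - g1 z) \<le> d"
    using exp_approxD[OF assms(2) K(1) d(1)] by blast
  have "cmod (f z * g z - f1 z * g1 z) \<le> e" if z: "z \<in> K" for z
  proof -
    have g1N: "cmod (g1 z) \<le> N + 1"
      using norm_triangle_ineq4[of "g z" "g z - g1 z"] N(2)[OF z] g1(2)[OF z] d(2) by simp
    have "f z * g z - f1 z * g1 z = f z * (g z - g1 z) + (f z - f1 z) * g1 z" by (simp add: algebra_simps)
    then have "cmod (f z * g z - f1 z * g1 z) \<le> cmod (f z) * cmod (g z - g1 z) + cmod (f z - f1 z) * cmod (g1 z)"
      using norm_triangle_ineq[of "f z * (g z - g1 z)" "(f z - f1 z) * g1 z"] by (simp add: norm_mult)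
    also have "\<dots> \<le> M * d + d * (N + 1)"
      by (intro add_mono mult_mono M N g1 f1 z g1N) (use M d in auto)
    also have "\<dots> \<le> e" using d' by (simp add: algebra_simps)
    finally show ?thesis .
  qed
  then show "\<exists>h. exp_span h \<and> (\<forall>z\<in>K. cmod (f z * g z - h z) \<le> e)"
    using exp_span_mult[OF f1(1) g1(1)] by blast
qed

lemma exp_approx_power: "exp_approx f \<Longrightarrow> exp_approx (\<lambda>z. f z ^ k)"
  by (induction k) (auto intro: exp_approx_const exp_approx_mult)

lemma exp_approx_sum:
  "(\<And>i. i \<in> I \<Longrightarrow> exp_approx (f i)) \<Longrightarrow> exp_approx (\<lambda>z. \<Sum>i\<in>I. f i z)"
  by (induction I rule: infinite_finite_induct) (auto intro: exp_approx_const exp_approx_add)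

lemma continuous_on_nth: "continuous_on K (\<lambda>z :: complex ^ 'n. z $ i)"
  by (intro continuous_intros)

text \<open>A coordinate is the limit of \<open>(exp (s * z $ i) - 1) / s\<close> as
  \<open>s\<close> tends to 0, and the constant 1 is itself an exponential, that of
  \<open>lin 0\<close>.\<close>

lemma exp_approx_nth: "exp_approx (\<lambda>z. z $ i)"
  unfolding exp_approx_def
proof (intro conjI allI impI)
  show "continuous_on UNIV (\<lambda>z :: complex ^ 'a. z $ i)" by (intro continuous_intros)
  fix K :: "(complex ^ 'a) set" and e :: real assume K: "compact K" "e > 0"
  obtain M where M: "M > 0" "\<And>z. z \<in> K \<Longrightarrow> norm (z $ i) \<le> M"
    using compact_norm_bound[OF K(1) continuous_on_nth] by blast
  obtain d where d: "d > 0" "\<And>w :: complex. cmod w < d \<Longrightarrow> cmod (exp w - 1 - w) \<le> e / M * cmod w"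
    using exp_first_order[of "e / M"] K(2) M(1) by auto
  define s where "s = d / (2 * M)"
  have s: "s > 0" "s * M < d" using d(1) M(1) by (auto simp: s_def field_simps)
  define g :: "complex ^ 'a \<Rightarrow> complex"
    where "g z = (1 / of_real s) * exp (lin (axis i (of_real s)) z) + (- 1 / of_real s) * exp (lin 0 z)" for z
  have "exp_span g" unfolding g_def by (intro exp_span_add exp_span_exp)
  moreover have "cmod (z $ i - g z) \<le> e" if z: "z \<in> K" for z
  proof -
    define w where "w = of_real s * z $ i"
    have w: "cmod w = s * cmod (z $ i)" using s by (simp add: w_def norm_mult)
    also have "\<dots> \<le> s * M" using M(2)[OF z] s by simp
    finally have "cmod w < d" using s by simp
    from d(2)[OF this] have 1: "cmod (exp w - 1 - w) \<le> e / M * (s * cmod (z $ i))" unfolding w .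
    also have "\<dots> \<le> e / M * (s * M)" using M s K(2) z by (intro mult_left_mono) auto
    also have "\<dots> = e * s" using M by simp
    finally have 2: "cmod (exp w - 1 - w) \<le> e * s" .
    have "z $ i - g z = - (exp w - 1 - w) / of_real s"
      using s by (simp add: g_def w_def lin_axis field_simps)
    then have "cmod (z $ i - g z) = cmod (exp w - 1 - w) / s" using s by (simp add: norm_divide norm_minus_commute)
    then show ?thesis using 2 s by (simp add: pos_divide_le_eq)
  qed
  ultimately show "\<exists>g. exp_span g \<and> (\<forall>z\<in>K. cmod (z $ i - g z) \<le> e)" by blast
qed

lemma holo_fun_pd_iterate:
  "open S \<Longrightarrow> holo_fun S f \<Longrightarrow> holo_fun S ((pd j ^^ k) f)"
  by (induction k) (auto intro: holo_fun_pd)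

lemma deriv_iterate_line:
  assumes f: "holo_fun UNIV f"
  shows "(deriv ^^ k) (\<lambda>t. f (z + t *s axis j 1)) = (\<lambda>t. (pd j ^^ k) f (z + t *s axis j 1))"
proof (induction k)
  case (Suc k)
  have "((\<lambda>t. (pd j ^^ k) f (z + t *s axis j 1)) has_field_derivative pd j ((pd j ^^ k) f) (z + t *s axis j 1)) (at t)" for t
    by (rule sep_holo_deriv[OF holo_fun_sep[OF holo_fun_pd_iterate[OF open_UNIV f] open_UNIV]]) simp
  then have "deriv (\<lambda>t. (pd j ^^ k) f (z + t *s axis j 1)) = (\<lambda>t. pd j ((pd j ^^ k) f) (z + t *s axis j 1))"
    by (intro ext DERIV_imp_deriv)
  then show ?case by (simp add: Suc)
qed simp

text \<open>Induction on a finite set of coordinates that determines \<open>f\<close>. The Taylor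
  coefficients with respect to \<open>z $ j\<close> depend only on the remaining coordinates, so
  they fall under the induction hypothesis, and the partial sums are sums of products.\<close>

lemma entire_exp_approx_aux:
  fixes f :: "complex ^ 'n \<Rightarrow> complex"
  assumes "finite I" "holo_fun UNIV f" "\<And>z w. (\<forall>i\<in>I. z $ i = w $ i) \<Longrightarrow> f z = f w"
  shows "exp_approx f"
  using assms
proof (induction I arbitrary: f rule: finite_induct)
  case empty
  define c where "c = f 0"
  have "f = (\<lambda>z. c)" unfolding c_def by (rule ext, rule empty.prems(2)) simp
  then show ?case using exp_approx_const[of c] by (simp only:)
next
  case (insert j I)
  define proj :: "complex ^ 'n \<Rightarrow> complex ^ 'n" where "proj z = (\<chi> i. if i = j then 0 else z $ i)" for z
  have holo_proj: "holo_map UNIV proj"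
    unfolding holo_map_def
  proof
    fix i show "holo_fun UNIV (\<lambda>z. proj z $ i)" by (cases "i = j") (auto simp: proj_def)
  qed
  have cont_proj: "continuous_on S proj" for S
    using holo_map_continuous[OF holo_map_subset[OF holo_proj subset_UNIV]] .
  have split: "z = proj z + (z $ j) *s axis j 1" for z
    by (auto simp: vec_eq_iff proj_def axis_def)
  have dep: "(pd j ^^ k) f z = (pd j ^^ k) f w" if "\<forall>i\<in>insert j I. z $ i = w $ i" for k z w
    using that
  proof (induction k arbitrary: z w)
    case 0 then show ?case using insert.prems(2)[of z w] by simp
  next
    case (Suc k)
    have "(\<lambda>t. (pd j ^^ k) f (z + t *s axis j 1)) = (\<lambda>t. (pd j ^^ k) f (w + t *s axis j 1))"
      using Suc.prems by (intro ext Suc.IH) auto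
    then show ?case by (simp add: pd_def[of j "(pd j ^^ k) f"])
  qed
  define c where "c k z = (pd j ^^ k) f (proj z)" for k z
  have c: "exp_approx (c k)" for k
  proof (rule insert.IH)
    show "holo_fun UNIV (c k)" unfolding c_def
      by (rule holo_fun_compose[OF holo_fun_pd_iterate[OF open_UNIV insert.prems(1)] holo_proj]) auto
    show "c k z = c k w" if "\<forall>i\<in>I. z $ i = w $ i" for z w
      unfolding c_def by (rule dep) (use that in \<open>auto simp: proj_def\<close>)
  qed
  have cont_f: "continuous_on S f" for S
    using holo_fun_continuous[OF holo_fun_subset[OF insert.prems(1) subset_UNIV]] .
  show ?case
  proof (rule exp_approx_limit[OF cont_f])
    fix K :: "(complex ^ 'n) set" and e :: real assume K: "compact K" "e > 0"
    obtain r where r: "r > 0" "\<And>z. z \<in> K \<Longrightarrow> norm (z $ j) \<le> r"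
      using compact_norm_bound[OF K(1) continuous_on_nth] by blast
    \<comment> \<open>Cauchy's estimate on a circle of twice the needed radius makes the Taylor
      terms decay like \<open>(1 / 2) ^ k\<close>, uniformly on \<open>K\<close>.\<close>
    define R where "R = 2 * r"
    have R: "R > 0" using r by (simp add: R_def)
    have "compact (K \<times> cball (0::complex) R)" using K by (intro compact_Times) auto
    moreover have "continuous_on (K \<times> cball (0::complex) R) (\<lambda>p. f (proj (fst p) + snd p *s axis j 1))"
      by (intro continuous_on_compose2[OF cont_f[of UNIV]] continuous_intros continuous_on_compose2[OF cont_proj[of UNIV]]) auto
    ultimately obtain M where M: "M > 0"
      "\<And>p. p \<in> K \<times> cball (0::complex) R \<Longrightarrow> norm (f (proj (fst p) + snd p *s axis j 1)) \<le> M"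
      using compact_norm_bound by blast
    define a where "a k z = c k z / fact k * (z $ j) ^ k" for k z
    have hol: "(\<lambda>t. f (proj z + t *s axis j 1)) holomorphic_on UNIV" for z
      using holo_fun_line[OF insert.prems(1) open_UNIV] by simp
    have ck: "c k z = (deriv ^^ k) (\<lambda>t. f (proj z + t *s axis j 1)) 0" for k z
      by (simp add: c_def deriv_iterate_line[OF insert.prems(1)])
    have bound: "norm (a k z) \<le> M * (1 / 2) ^ k" if z: "z \<in> K" for k z
    proof -
      have "cmod (c k z) \<le> fact k * M / R ^ k"
        unfolding ck
      proof (rule Cauchy_inequality[OF _ _ R])
        show "cmod (f (proj z + t *s axis j 1)) \<le> M" if "cmod (0 - t) = R" for t
          using M(2)[of "(z, t)"] z that by simp
        show "(\<lambda>t. f (proj z + t *s axis j 1)) holomorphic_on ball 0 R"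
          using hol by (rule holomorphic_on_subset) simp
        show "continuous_on (cball 0 R) (\<lambda>t. f (proj z + t *s axis j 1))"
          using holomorphic_on_imp_continuous_on[OF hol] by (rule continuous_on_subset) simp
      qed
      then have 1: "cmod (c k z) / fact k \<le> (fact k * M / R ^ k) / fact k" by (rule divide_right_mono) simp
      have 2: "cmod (z $ j) ^ k \<le> r ^ k" using r(2)[OF z] by (intro power_mono) auto
      have 3: "norm (a k z) = cmod (c k z) / fact k * cmod (z $ j) ^ k"
        by (simp add: a_def norm_mult norm_divide norm_power)
      have "norm (a k z) \<le> (fact k * M / R ^ k) / fact k * r ^ k"
        unfolding 3 by (intro mult_mono 1 2) (use M(1) R in auto)
      also have "\<dots> = M * (1 / 2) ^ k" using r(1) by (simp add: R_def power_mult_distrib power_divide)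
      finally show ?thesis .
    qed
    have sums: "(\<lambda>k. a k z) sums f z" for z
    proof -
      have "(\<lambda>k. (deriv ^^ k) (\<lambda>t. f (proj z + t *s axis j 1)) 0 / fact k * (z $ j - 0) ^ k) sums
          (\<lambda>t. f (proj z + t *s axis j 1)) (z $ j)"
        by (rule holomorphic_power_series[where r = "cmod (z $ j) + 1"])
           (auto intro: holomorphic_on_subset[OF hol])
      then show ?thesis using split[of z] by (simp add: a_def ck)
    qed
    have "uniform_limit K (\<lambda>n z. \<Sum>k<n. a k z) (\<lambda>z. suminf (\<lambda>k. a k z)) sequentially"
      by (rule Weierstrass_m_test[OF bound]) (auto intro!: summable_mult summable_geometric)
    moreover have "suminf (\<lambda>k. a k z) = f z" for z using sums sums_unique by metis
    ultimately have "\<forall>\<^sub>F n in sequentially. \<forall>z\<in>K. dist (\<Sum>k<n. a k z) (f z) < e"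
      using K(2) by (simp add: uniform_limit_iff)
    then obtain n where n: "\<forall>z\<in>K. dist (\<Sum>k<n. a k z) (f z) < e"
      using eventually_happens'[OF sequentially_bot] by blast
    have "exp_approx (\<lambda>z. \<Sum>k<n. a k z)"
    proof (rule exp_approx_sum)
      fix k
      have "exp_approx (\<lambda>z. c k z * (1 / fact k) * (z $ j) ^ k)"
        by (intro exp_approx_mult c exp_approx_const exp_approx_power exp_approx_nth)
      then show "exp_approx (a k)" by (simp add: a_def[abs_def])
    qed
    then show "\<exists>g. exp_approx g \<and> (\<forall>z\<in>K. cmod (f z - g z) \<le> e)"
      using n by (intro exI[of _ "\<lambda>z. \<Sum>k<n. a k z"]) (auto simp: dist_norm norm_minus_commute less_imp_le)
  qed
qed

lemma entire_exp_approx: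
  fixes f :: "complex ^ 'n \<Rightarrow> complex"
  assumes "holo_fun UNIV f"
  shows "exp_approx f"
  by (rule entire_exp_approx_aux[of UNIV, OF _ assms]) (auto simp: vec_eq_iff[symmetric])

section \<open>Vector fields approximable by automorphisms\<close>

text \<open>\<open>A\<close> may depend on \<open>h\<close> in any manner, and only the first order
  in \<open>h\<close> is prescribed. Hence sums of fields can be realised by compositions, and an
  error \<open>e\<close> in the field costs just \<open>e * h\<close>.\<close>

definition approx_field :: "(complex ^ 'n) set \<Rightarrow> (complex ^ 'n \<Rightarrow> complex ^ 'n) \<Rightarrow> bool" where
  "approx_field S X \<longleftrightarrow> (\<forall>K e. compact K \<longrightarrow> K \<subseteq> S \<longrightarrow> e > 0 \<longrightarrow>
     (\<exists>h0>0. \<forall>h. 0 < h \<longrightarrow> h < h0 \<longrightarrow> (\<exists>A\<in>holo_aut. \<forall>x\<in>K. norm (A x - x - h *\<^sub>R X x) \<le> e * h)))"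

lemma approx_fieldI:
  assumes "\<And>K e. compact K \<Longrightarrow> K \<subseteq> S \<Longrightarrow> e > 0 \<Longrightarrow>
     \<exists>h0>0. \<forall>h. 0 < h \<longrightarrow> h < h0 \<longrightarrow> (\<exists>A\<in>holo_aut. \<forall>x\<in>K. norm (A x - x - h *\<^sub>R X x) \<le> e * h)"
  shows "approx_field S X"
  unfolding approx_field_def using assms by blast

lemma approx_fieldD:
  assumes "approx_field S X" "compact K" "K \<subseteq> S" "e > 0"
  shows "\<exists>h0>0. \<forall>h. 0 < h \<longrightarrow> h < h0 \<longrightarrow> (\<exists>A\<in>holo_aut. \<forall>x\<in>K. norm (A x - x - h *\<^sub>R X x) \<le> e * h)"
  using assms(1)[unfolded approx_field_def, rule_format, OF assms(2-4)] .

lemma holo_aut_compose: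
  assumes "A \<in> holo_aut" "B \<in> holo_aut" shows "(\<lambda>x. A (B x)) \<in> holo_aut"
  using assms holo_map_compose[of UNIV A UNIV B] bij_comp[of B A] by (auto simp: holo_aut_def o_def)

lemma approx_field_limit:
  assumes "\<And>K e. compact K \<Longrightarrow> K \<subseteq> S \<Longrightarrow> e > 0 \<Longrightarrow> \<exists>Y. approx_field UNIV Y \<and> (\<forall>x\<in>K. norm (X x - Y x) \<le> e)"
  shows "approx_field S X"
proof (rule approx_fieldI)
  fix K :: "(complex ^ 'a) set" and e :: real assume K: "compact K" "K \<subseteq> S" "e > 0"
  then obtain Y where Y: "approx_field UNIV Y" "\<forall>x\<in>K. norm (X x - Y x) \<le> e / 2"
    using assms[of K "e / 2"] by auto
  obtain h0 where h0: "h0 > 0"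
    "\<forall>h. 0 < h \<longrightarrow> h < h0 \<longrightarrow> (\<exists>A\<in>holo_aut. \<forall>x\<in>K. norm (A x - x - h *\<^sub>R Y x) \<le> e / 2 * h)"
    using approx_fieldD[OF Y(1) K(1), of "e / 2"] K(3) by auto
  show "\<exists>h0>0. \<forall>h. 0 < h \<longrightarrow> h < h0 \<longrightarrow> (\<exists>A\<in>holo_aut. \<forall>x\<in>K. norm (A x - x - h *\<^sub>R X x) \<le> e * h)"
  proof (intro exI[of _ h0] conjI allI impI h0(1))
    fix h assume h: "0 < h" "h < h0"
    then obtain A where A: "A \<in> holo_aut" "\<forall>x\<in>K. norm (A x - x - h *\<^sub>R Y x) \<le> e / 2 * h"
      using h0(2) by blast
    have "norm (A x - x - h *\<^sub>R X x) \<le> e * h" if x: "x \<in> K" for x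
    proof -
      have "norm (A x - x - h *\<^sub>R X x) = norm ((A x - x - h *\<^sub>R Y x) - h *\<^sub>R (X x - Y x))"
        by (simp add: algebra_simps)
      also have "\<dots> \<le> norm (A x - x - h *\<^sub>R Y x) + norm (h *\<^sub>R (X x - Y x))"
        by (rule norm_triangle_ineq4)
      also have "\<dots> \<le> e / 2 * h + h * (e / 2)"
        using A(2) Y(2) x h by (intro add_mono) auto
      finally show ?thesis by (simp add: algebra_simps)
    qed
    then show "\<exists>A\<in>holo_aut. \<forall>x\<in>K. norm (A x - x - h *\<^sub>R X x) \<le> e * h" using A(1) by blast
  qed
qed

text \<open>A step for \<open>Y\<close> is followed by a step for \<open>X\<close>. The second one
  starts at \<open>B x\<close>, close to \<open>x\<close>, where uniform continuity allows
  \<open>X (B x)\<close> to be replaced by \<open>X x\<close>.\<close>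

lemma approx_field_add:
  assumes X: "approx_field UNIV X" "continuous_on UNIV X" and Y: "approx_field UNIV Y" "continuous_on UNIV Y"
  shows "approx_field UNIV (\<lambda>z. X z + Y z)"
proof (rule approx_fieldI)
  fix K :: "(complex ^ 'a) set" and e :: real assume K: "compact K" "K \<subseteq> UNIV" "e > 0"
  obtain R where R: "\<And>x. x \<in> K \<Longrightarrow> norm x \<le> R"
    using compact_imp_bounded[OF K(1)] unfolding bounded_iff by blast
  \<comment> \<open>\<open>B x\<close> may leave \<open>K\<close>, but it moves by less than 1, so
    the step for \<open>X\<close> is prepared on this larger ball.\<close>
  define K2 where "K2 = cball (0 :: complex ^ 'a) (R + 1)"
  have K2: "compact K2" by (simp add: K2_def)
  obtain M where M: "M > 0" "\<And>x. x \<in> K \<Longrightarrow> norm (Y x) \<le> M"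
    using compact_norm_bound[OF K(1) continuous_on_subset[OF Y(2) subset_UNIV]] by blast
  obtain d where d: "d > 0" "\<And>x y. x \<in> K2 \<Longrightarrow> y \<in> K2 \<Longrightarrow> dist y x < d \<Longrightarrow> dist (X y) (X x) < e / 3"
    using uniformly_continuous_onE[OF K2 continuous_on_subset[OF X(2) subset_UNIV], of "e / 3"] K(3) by auto
  \<comment> \<open>The cap 1 on the tolerance gives
    \<open>norm (B x - x) \<le> h * (M + 1)\<close>, whatever \<open>e\<close> is.\<close>
  obtain hY where hY: "hY > 0"
    "\<forall>h. 0 < h \<longrightarrow> h < hY \<longrightarrow> (\<exists>A\<in>holo_aut. \<forall>x\<in>K. norm (A x - x - h *\<^sub>R Y x) \<le> min (e / 3) 1 * h)"
    using approx_fieldD[OF Y(1) K(1), of "min (e / 3) 1"] K(3) by auto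
  obtain hX where hX: "hX > 0"
    "\<forall>h. 0 < h \<longrightarrow> h < hX \<longrightarrow> (\<exists>A\<in>holo_aut. \<forall>x\<in>K2. norm (A x - x - h *\<^sub>R X x) \<le> e / 3 * h)"
    using approx_fieldD[OF X(1) K2, of "e / 3"] K(3) by auto
  define h0 where "h0 = min (min hX hY) (min d 1 / (M + 1))"
  have h0: "h0 > 0" using hX hY d M by (simp add: h0_def)
  show "\<exists>h0>0. \<forall>h. 0 < h \<longrightarrow> h < h0 \<longrightarrow> (\<exists>A\<in>holo_aut. \<forall>x\<in>K. norm (A x - x - h *\<^sub>R (X x + Y x)) \<le> e * h)"
  proof (intro exI[of _ h0] conjI allI impI h0)
    fix h assume h: "0 < h" "h < h0"
    have hM: "h * (M + 1) < min d 1" using h M(1) by (simp add: h0_def pos_less_divide_eq)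
    obtain A where A: "A \<in> holo_aut" "\<forall>x\<in>K2. norm (A x - x - h *\<^sub>R X x) \<le> e / 3 * h"
      using hX(2) h unfolding h0_def by auto
    obtain B where B: "B \<in> holo_aut" "\<forall>x\<in>K. norm (B x - x - h *\<^sub>R Y x) \<le> min (e / 3) 1 * h"
      using hY(2) h unfolding h0_def by auto
    have "norm (A (B x) - x - h *\<^sub>R (X x + Y x)) \<le> e * h" if x: "x \<in> K" for x
    proof -
      have Bx: "norm (B x - x - h *\<^sub>R Y x) \<le> min (e / 3) 1 * h" using B(2) x by blast
      have "min (e / 3) 1 * h \<le> 1 * h" using h by (intro mult_right_mono) auto
      then have Bx1: "norm (B x - x - h *\<^sub>R Y x) \<le> h" using Bx by simp
      have "min (e / 3) 1 * h \<le> e / 3 * h" using h by (intro mult_right_mono) auto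
      then have Bx2: "norm (B x - x - h *\<^sub>R Y x) \<le> e / 3 * h" using Bx by simp
      have "norm (B x - x) \<le> norm (B x - x - h *\<^sub>R Y x) + norm (h *\<^sub>R Y x)"
        using norm_triangle_ineq[of "B x - x - h *\<^sub>R Y x" "h *\<^sub>R Y x"] by simp
      also have "\<dots> \<le> h + h * M" using Bx1 M(2)[OF x] h by (intro add_mono) (simp_all add: mult_left_mono)
      finally have near: "norm (B x - x) < min d 1" using hM by (simp add: algebra_simps)
      have xK2: "x \<in> K2" using R[OF x] by (simp add: K2_def)
      have BK2: "B x \<in> K2" using norm_triangle_ineq[of x "B x - x"] R[OF x] near by (simp add: K2_def)
      have "dist (X (B x)) (X x) < e / 3" using d(2)[OF xK2 BK2] near by (simp add: dist_norm)
      then have XB: "norm (h *\<^sub>R (X (B x) - X x)) \<le> e / 3 * h" using h by (simp add: dist_norm mult.commute)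
      have AB: "norm (A (B x) - B x - h *\<^sub>R X (B x)) \<le> e / 3 * h" using A(2) BK2 by blast
      have "A (B x) - x - h *\<^sub>R (X x + Y x) =
        (A (B x) - B x - h *\<^sub>R X (B x)) + (B x - x - h *\<^sub>R Y x) + h *\<^sub>R (X (B x) - X x)"
        by (simp add: algebra_simps)
      also have "norm \<dots> \<le> e / 3 * h + e / 3 * h + e / 3 * h"
        by (intro order_trans[OF norm_triangle_ineq] add_mono AB Bx2 XB)
      finally show ?thesis by simp
    qed
    then show "\<exists>A\<in>holo_aut. \<forall>x\<in>K. norm (A x - x - h *\<^sub>R (X x + Y x)) \<le> e * h"
      using holo_aut_compose[OF A(1) B(1)] by (intro bexI[of _ "\<lambda>x. A (B x)"]) auto
  qed
qed

section \<open>Shears and overshears\<close>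

lemma holo_map_shear:
  assumes "holo_fun S f" shows "holo_map S (\<lambda>z. z + f z *s v)"
  unfolding holo_map_def using assms by (auto intro!: holo_fun_add holo_fun_mult)

lemma bij_by_inverse:
  assumes "\<And>z. g (f z) = z" "\<And>z. f (g z) = z" shows "bij f"
  by (rule o_bij[of g]) (simp_all add: fun_eq_iff assms)

text \<open>\<open>lin a\<close> is constant along \<open>v\<close>, so the same formula with
  \<open>- c\<close> is the inverse.\<close>

lemma shear_aut:
  assumes "lin a v = 0"
  shows "(\<lambda>z. z + (c * exp (lin a z)) *s v) \<in> holo_aut"
proof -
  let ?f = "\<lambda>c z. z + (c * exp (lin a z)) *s v"
  have a: "lin a (?f c z) = lin a z" for c z by (simp add: lin_add_right lin_smult_right assms)
  have inv: "?f d (?f c z) = z" if "d = - c" for c d z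
    unfolding a by (simp add: that vec_eq_iff)
  have "bij (?f c)" by (rule bij_by_inverse[of "?f (- c)"]; rule inv; simp)
  moreover have "holo_map UNIV (?f c)" by (intro holo_map_shear holo_fun_mult holo_fun_exp holo_fun_const holo_fun_lin)
  ultimately show ?thesis by (simp add: holo_aut_def)
qed

text \<open>The time-one map of the field
  \<open>(c * exp (lin a z) * lin b z / lin b u) *s u\<close>: it preserves \<open>lin a\<close> and
  multiplies \<open>lin b\<close> by \<open>exp (c * exp (lin a z))\<close>, so the inverse has
  \<open>- c\<close> in place of \<open>c\<close>.\<close>

lemma overshear_aut:
  assumes "lin a u = 0" "lin b u \<noteq> 0"
  shows "(\<lambda>z. z + ((exp (c * exp (lin a z)) - 1) * lin b z / lin b u) *s u) \<in> holo_aut"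
proof -
  let ?f = "\<lambda>c z. z + ((exp (c * exp (lin a z)) - 1) * lin b z / lin b u) *s u"
  have a: "lin a (?f c z) = lin a z" for c z by (simp add: lin_add_right lin_smult_right assms)
  have b: "lin b (?f c z) = exp (c * exp (lin a z)) * lin b z" for c z
  proof -
    have "lin b (?f c z) = lin b z + (exp (c * exp (lin a z)) - 1) * lin b z"
      unfolding lin_add_right lin_smult_right using assms(2) by simp
    then show ?thesis by (simp add: algebra_simps)
  qed
  have cancel: "(E - 1) * m / l + (D - 1) * (E * m) / l = 0" if "D * E = 1" for D E m l :: complex
  proof -
    have "(E - 1) * m + (D - 1) * (E * m) = (D * E - 1) * m" by (simp add: algebra_simps)
    then have "(E - 1) * m + (D - 1) * (E * m) = 0" using that by simp
    then show ?thesis by (simp flip: add_divide_distrib)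
  qed
  have inv: "?f d (?f c z) = z" if "d = - c" for c d z
  proof -
    have "exp (d * exp (lin a z)) * exp (c * exp (lin a z)) = 1" unfolding that by (simp flip: exp_add)
    from cancel[OF this] show ?thesis unfolding a b by (simp add: add.assoc flip: vector_sadd_rdistrib)
  qed
  have "bij (?f c)" by (rule bij_by_inverse[of "?f (- c)"]; rule inv; simp)
  moreover have "holo_map UNIV (?f c)"
    unfolding divide_inverse
    by (intro holo_map_shear holo_fun_mult holo_fun_diff holo_fun_exp holo_fun_const holo_fun_lin)
  ultimately show ?thesis by (simp add: holo_aut_def)
qed

lemma scaleR_eq_smult: "h *\<^sub>R (v :: complex ^ 'n) = of_real h *s v"
  by (simp add: vec_eq_iff scaleR_conv_of_real[where 'a = complex])

text \<open>The shear with coefficient \<open>h * c\<close> is exactly the Euler step of the field,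
  so the error is zero for every \<open>h\<close>.\<close>

lemma approx_field_shear:
  assumes "lin a v = 0"
  shows "approx_field UNIV (\<lambda>z. (c * exp (lin a z)) *s v)"
proof (rule approx_fieldI)
  fix K :: "(complex ^ 'a) set" and e :: real assume K: "e > 0"
  show "\<exists>h0>0. \<forall>h. 0 < h \<longrightarrow> h < h0 \<longrightarrow> (\<exists>A\<in>holo_aut. \<forall>x\<in>K. norm (A x - x - h *\<^sub>R ((c * exp (lin a x)) *s v)) \<le> e * h)"
  proof (intro exI[of _ 1] conjI allI impI)
    fix h :: real assume h: "0 < h"
    let ?A = "\<lambda>z. z + (of_real h * c * exp (lin a z)) *s v"
    have "?A x - x - h *\<^sub>R ((c * exp (lin a x)) *s v) = 0" for x
      by (simp add: scaleR_eq_smult vector_smult_assoc mult.assoc)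
    then show "\<exists>A\<in>holo_aut. \<forall>x\<in>K. norm (A x - x - h *\<^sub>R ((c * exp (lin a x)) *s v)) \<le> e * h"
      using shear_aut[OF assms, of "of_real h * c"] h K by (intro bexI[of _ ?A] ballI) simp_all
  qed auto
qed

lemma approx_field_overshear:
  assumes "lin a u = 0" "lin b u \<noteq> 0"
  shows "approx_field UNIV (\<lambda>z. (c * exp (lin a z) * lin b z) *s u)"
proof (rule approx_fieldI)
  fix K :: "(complex ^ 'a) set" and e :: real assume K: "compact K" "e > 0"
  \<comment> \<open>The growth rate of \<open>lin b\<close> along the field: the overshear for time
    \<open>h\<close> has exponent \<open>h * q z\<close>, and only the linearisation of its
    exponential is lost.\<close>
  define q where "q z = c * lin b u * exp (lin a z)" for z
  have "continuous_on K q" unfolding q_def by (intro continuous_intros)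
  then obtain Q where Q: "Q > 0" "\<And>z. z \<in> K \<Longrightarrow> norm (q z) \<le> Q"
    using compact_norm_bound[OF K(1)] by blast
  have "continuous_on K (\<lambda>z. (lin b z / lin b u) *s u)" by (intro continuous_intros assms(2) ballI)
  then obtain M where M: "M > 0" "\<And>z. z \<in> K \<Longrightarrow> norm ((lin b z / lin b u) *s u) \<le> M"
    using compact_norm_bound[OF K(1)] by blast
  obtain d where d: "d > 0" "\<And>w :: complex. cmod w < d \<Longrightarrow> cmod (exp w - 1 - w) \<le> e / (Q * M) * cmod w"
    using exp_first_order[of "e / (Q * M)"] K(2) Q(1) M(1) by auto
  show "\<exists>h0>0. \<forall>h. 0 < h \<longrightarrow> h < h0 \<longrightarrow>
     (\<exists>A\<in>holo_aut. \<forall>x\<in>K. norm (A x - x - h *\<^sub>R ((c * exp (lin a x) * lin b x) *s u)) \<le> e * h)"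
  proof (intro exI[of _ "d / Q"] conjI allI impI)
    show "d / Q > 0" using d Q by simp
    fix h :: real assume h: "0 < h" "h < d / Q"
    let ?A = "\<lambda>z. z + ((exp ((of_real h * c * lin b u) * exp (lin a z)) - 1) * lin b z / lin b u) *s u"
    have "norm (?A x - x - h *\<^sub>R ((c * exp (lin a x) * lin b x) *s u)) \<le> e * h" if x: "x \<in> K" for x
    proof -
      define w where "w = of_real h * q x"
      have w: "cmod w \<le> h * Q" using h Q(2)[OF x] by (simp add: w_def norm_mult)
      have "h * Q < d" using h Q by (simp add: pos_less_divide_eq)
      then have "cmod w < d" using w by simp
      from d(2)[OF this] have "cmod (exp w - 1 - w) \<le> e / (Q * M) * cmod w" .
      also have "\<dots> \<le> e / (Q * M) * (h * Q)" using w K Q M by (intro mult_left_mono) auto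
      also have "\<dots> = e * h / M" using Q by simp
      finally have 1: "cmod (exp w - 1 - w) \<le> e * h / M" .
      have "?A x - x - h *\<^sub>R ((c * exp (lin a x) * lin b x) *s u) = (exp w - 1 - w) *s ((lin b x / lin b u) *s u)"
        using assms(2) by (simp add: scaleR_eq_smult vec_eq_iff w_def q_def field_simps)
      then have "norm (?A x - x - h *\<^sub>R ((c * exp (lin a x) * lin b x) *s u))
          = cmod (exp w - 1 - w) * norm ((lin b x / lin b u) *s u)" by (simp only: norm_smult)
      also have "\<dots> \<le> e * h / M * M"
        using 1 M(2)[OF x] M(1) h K by (intro mult_mono) auto
      finally show ?thesis using M by simp
    qed
    then show "\<exists>A\<in>holo_aut. \<forall>x\<in>K. norm (A x - x - h *\<^sub>R ((c * exp (lin a x) * lin b x) *s u)) \<le> e * h"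
      using overshear_aut[OF assms, of "of_real h * c * lin b u"] by (intro bexI[of _ ?A]) auto
  qed
qed

text \<open>If \<open>lin a v \<noteq> 0\<close>, choose \<open>u\<close> in the kernel of \<open>a\<close> and \<open>b\<close> with \<open>lin b v = 0\<close>, \<open>lin b u = lin a v\<close>.
  The overshear field \<open>exp (lin a z) * lin b z *s u\<close> has the divergence of \<open>exp (lin a z) *s v\<close>, and the
  difference is the derivative at \<open>s = 0\<close> of the shear fields \<open>exp (lin (a + s *s b) z) *s (s *s v - u)\<close>.\<close>

lemma approx_field_exp:
  fixes a v :: "complex ^ 'n"
  assumes n: "CARD('n) \<ge> 2"
  shows "approx_field UNIV (\<lambda>z. (c * exp (lin a z)) *s v)"
proof (cases "lin a v = 0")
  case True
  then show ?thesis by (rule approx_field_shear)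
next
  case False
  then have "a \<noteq> 0" by auto
  then obtain i where i: "a $ i \<noteq> 0" by (auto simp: vec_eq_iff)
  obtain j where j: "j \<noteq> i"
  proof -
    have "UNIV \<noteq> {i}"
    proof
      assume "UNIV = {i}"
      then have "CARD('n) = 1" by (metis card_1_singleton_iff One_nat_def)
      then show False using n by simp
    qed
    then show thesis using that by blast
  qed
  \<comment> \<open>A nonzero vector killed by \<open>lin a\<close>; the second coordinate
    \<open>j\<close> makes room for it.\<close>
  define u where "u = a $ j *s axis i 1 - a $ i *s axis j (1 :: complex)"
  \<comment> \<open>\<open>\<nu>\<close> takes the value 1 on \<open>u\<close>. The combination
    \<open>b\<close> is formed so that its contributions cancel on \<open>v\<close> while it equals
    \<open>lin a v\<close> on \<open>u\<close>.\<close>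
  define \<nu> where "\<nu> = axis j (- 1 / a $ i)"
  define b where "b = lin a v *s \<nu> - lin \<nu> v *s a"
  have lin_axis_r: "lin w (axis k 1) = w $ k" for w :: "complex ^ 'n" and k
  proof -
    have "(\<Sum>l\<in>UNIV. w $ l * axis k 1 $ l) = (\<Sum>l\<in>UNIV. if l = k then w $ k else 0)"
      by (intro sum.cong) (auto simp: axis_def)
    then show ?thesis by (simp add: lin_def)
  qed
  have au: "lin a u = 0" by (simp add: u_def lin_diff_right lin_smult_right lin_axis_r)
  have "u $ j = - a $ i" using j by (simp add: u_def axis_def)
  then have nu: "lin \<nu> u = 1" using i by (simp add: \<nu>_def lin_axis)
  have bu: "lin b u = lin a v" by (simp add: b_def lin_diff lin_smult au nu)
  have bv: "lin b v = 0" by (simp add: b_def lin_diff lin_smult)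
  have bu0: "lin b u \<noteq> 0" using bu False by simp
  show ?thesis
  proof (rule approx_field_limit)
    fix K :: "(complex ^ 'n) set" and e :: real assume K: "compact K" "e > 0"
    obtain M where M: "M > 0" "\<And>z. z \<in> K \<Longrightarrow> norm (lin b z) \<le> M"
      using compact_norm_bound[OF K(1), of "lin b"] holo_fun_continuous[OF holo_fun_lin] by blast
    have "continuous_on K (\<lambda>z. c * exp (lin a z))" by (intro continuous_intros)
    then obtain C where C: "C > 0" "\<And>z. z \<in> K \<Longrightarrow> norm (c * exp (lin a z)) \<le> C"
      using compact_norm_bound[OF K(1)] by blast
    \<comment> \<open>\<open>\<epsilon>\<close> controls the remainder along \<open>u\<close>, which
      gets divided by the step \<open>s\<close>; the part along \<open>v\<close> is of order
      \<open>s\<close> and is made small by choosing \<open>s\<close> against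
      \<open>N\<close>.\<close>
    define \<epsilon> where "\<epsilon> = min 1 (e / (2 * (C * M * (norm u + 1))))"
    have C1: "C * M * (norm u + 1) > 0" using C(1) M(1) by (simp add: add_nonneg_pos)
    have \<epsilon>: "\<epsilon> > 0" "\<epsilon> \<le> 1" "\<epsilon> \<le> e / (2 * (C * M * (norm u + 1)))" using K(2) C1 by (auto simp: \<epsilon>_def)
    then have \<epsilon>3: "\<epsilon> * (C * M * (norm u + 1)) \<le> e / 2" using C1 by (simp add: pos_le_divide_eq)
    obtain d where d: "d > 0" "\<And>w :: complex. cmod w < d \<Longrightarrow> cmod (exp w - 1 - w) \<le> \<epsilon> * cmod w"
      using exp_first_order[OF \<epsilon>(1)] by blast
    define N where "N = C * (2 * M) * (norm v + 1)"
    have N: "N > 0" using C(1) M(1) by (simp add: N_def add_nonneg_pos)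
    define s where "s = min (d / (2 * M)) (e / (2 * N))"
    have s: "s > 0" "s \<le> d / (2 * M)" "s \<le> e / (2 * N)" using d(1) M(1) N K(2) by (auto simp: s_def)
    have sM: "s * M < d" using s(2) M(1) d(1) by (simp add: pos_le_divide_eq)
    have sN: "s * N \<le> e / 2" using s(3) N by (simp add: pos_le_divide_eq)
    define S where "S = complex_of_real s"
    have S: "S \<noteq> 0" "cmod S = s" using s(1) by (auto simp: S_def)
    \<comment> \<open>\<open>X\<close> is the overshear field, while \<open>Y\<close> and
      \<open>Z\<close> are shear fields at parameters \<open>S\<close> and 0, scaled so that
      \<open>Y z + Z z\<close> is their difference quotient.\<close>
    define X where "X z = (c * exp (lin a z) * lin b z) *s u" for z
    define Y where "Y z = (c / S * exp (lin (a + S *s b) z)) *s (S *s v - u)" for z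
    define Z where "Z z = (c / S * exp (lin a z)) *s u" for z
    have "lin (a + S *s b) (S *s v - u) = 0"
      by (simp add: lin_add lin_smult lin_diff_right lin_smult_right au bu bv)
    then have XYZ: "approx_field UNIV X" "approx_field UNIV Y" "approx_field UNIV Z"
      unfolding X_def Y_def Z_def by (intro approx_field_overshear approx_field_shear au bu0; assumption?)+
    have cont: "continuous_on UNIV X" "continuous_on UNIV Y" "continuous_on UNIV Z"
      unfolding X_def Y_def Z_def by (intro continuous_intros)+
    have "approx_field UNIV (\<lambda>z. X z + (Y z + Z z))"
      by (intro approx_field_add XYZ cont continuous_intros)
    moreover have "norm ((c * exp (lin a z)) *s v - (X z + (Y z + Z z))) \<le> e" if z: "z \<in> K" for z
    proof -
      define w where "w = S * lin b z"
      have w: "cmod w \<le> s * M" using M(2)[OF z] s(1) by (simp add: w_def S(2) norm_mult)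
      then have wd: "cmod w < d" using sM by simp
      have e1: "cmod (exp w - 1 - w) \<le> \<epsilon> * (s * M)"
        using d(2)[OF wd] w \<epsilon>(1) by (meson mult_left_mono less_imp_le order_trans)
      have "\<epsilon> * (s * M) \<le> 1 * (s * M)" using \<epsilon> s M by (intro mult_right_mono) auto
      then have e2: "cmod (1 - exp w) \<le> 2 * (s * M)"
        using norm_triangle_ineq[of "exp w - 1 - w" w] e1 w by (simp add: norm_minus_commute)
      have ex: "exp (lin (a + S *s b) z) = exp (lin a z) * exp w"
        by (simp add: lin_add lin_smult w_def exp_add)
      \<comment> \<open>All multiples of \<open>u\<close> combine to the remainder
        \<open>exp w - 1 - w\<close> over \<open>S\<close>: the linear term is cancelled by the
        overshear.\<close>
      have "(c * exp (lin a z)) *s v - (X z + (Y z + Z z))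
          = (c * exp (lin a z)) *s ((1 - exp w) *s v + ((exp w - 1 - w) / S) *s u)"
        using S(1) unfolding X_def Y_def Z_def ex by (simp add: vec_eq_iff w_def field_simps)
      then have "norm ((c * exp (lin a z)) *s v - (X z + (Y z + Z z)))
          = cmod (c * exp (lin a z)) * norm ((1 - exp w) *s v + ((exp w - 1 - w) / S) *s u)"
        by (simp only: norm_smult)
      also have "\<dots> \<le> C * (2 * (s * M) * norm v + \<epsilon> * (s * M) / s * norm u)"
      proof (intro mult_mono C(2)[OF z])
        have "norm ((1 - exp w) *s v + ((exp w - 1 - w) / S) *s u) \<le> cmod (1 - exp w) * norm v + cmod (exp w - 1 - w) / s * norm u"
          using norm_triangle_ineq[of "(1 - exp w) *s v" "((exp w - 1 - w) / S) *s u"]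
          by (simp only: norm_smult norm_divide S(2))
        also have "\<dots> \<le> 2 * (s * M) * norm v + \<epsilon> * (s * M) / s * norm u"
          using e1 e2 s(1) by (intro add_mono mult_right_mono divide_right_mono) auto
        finally show "norm ((1 - exp w) *s v + ((exp w - 1 - w) / S) *s u) \<le> 2 * (s * M) * norm v + \<epsilon> * (s * M) / s * norm u" .
      qed (use C in auto)
      also have "\<dots> = s * (C * (2 * M) * norm v) + \<epsilon> * (C * M * norm u)" using s(1) by (simp add: algebra_simps)
      also have "\<dots> \<le> s * N + \<epsilon> * (C * M * (norm u + 1))"
        unfolding N_def using s(1) \<epsilon>(1) C(1) M(1) by (intro add_mono mult_left_mono) auto
      also have "\<dots> \<le> e" using sN \<epsilon>3 by simp
      finally show ?thesis .
    qed
    ultimately show "\<exists>Y. approx_field UNIV Y \<and> (\<forall>z\<in>K. norm ((c * exp (lin a z)) *s v - Y z) \<le> e)" by blast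
  qed
qed

lemma approx_field_exp_span:
  fixes v :: "complex ^ 'n"
  assumes n: "CARD('n) \<ge> 2" and "exp_span f"
  shows "approx_field UNIV (\<lambda>z. f z *s v)"
  using assms(2)
proof (induction rule: exp_span.induct)
  case (exp_span_exp c a)
  show ?case by (rule approx_field_exp[OF n])
next
  case (exp_span_add f g)
  have "approx_field UNIV (\<lambda>z. f z *s v + g z *s v)"
    by (intro approx_field_add exp_span_add continuous_intros exp_span_continuous)
  then show ?case by (simp add: vector_sadd_rdistrib)
qed

lemma approx_field_exp_approx:
  fixes v :: "complex ^ 'n"
  assumes n: "CARD('n) \<ge> 2" and f: "exp_approx f"
  shows "approx_field UNIV (\<lambda>z. f z *s v)"
proof (rule approx_field_limit)
  fix K :: "(complex ^ 'n) set" and e :: real assume K: "compact K" "e > 0"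
  have v: "norm v + 1 > 0" by (simp add: add_nonneg_pos)
  obtain g where g: "exp_span g" "\<And>z. z \<in> K \<Longrightarrow> cmod (f z - g z) \<le> e / (norm v + 1)"
    using exp_approxD[OF f K(1), of "e / (norm v + 1)"] K(2) v by auto
  have "norm (f z *s v - g z *s v) \<le> e" if z: "z \<in> K" for z
  proof -
    have "norm (f z *s v - g z *s v) = cmod (f z - g z) * norm v"
      by (simp flip: vector_ssub_ldistrib vector_sub_rdistrib norm_smult)
    also have "\<dots> \<le> cmod (f z - g z) * (norm v + 1)" by (intro mult_left_mono) auto
    also have "\<dots> \<le> e" using g(2)[OF z] v by (simp add: pos_le_divide_eq)
    finally show ?thesis .
  qed
  then show "\<exists>Y. approx_field UNIV Y \<and> (\<forall>z\<in>K. norm (f z *s v - Y z) \<le> e)"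
    using approx_field_exp_span[OF n g(1), of v] by blast
qed

lemma approx_field_entire:
  fixes X :: "complex ^ 'n \<Rightarrow> complex ^ 'n"
  assumes n: "CARD('n) \<ge> 2" and X: "holo_map UNIV X"
  shows "approx_field UNIV X"
proof -
  have ap: "exp_approx (\<lambda>z. X z $ i)" for i
    using X unfolding holo_map_def by (intro entire_exp_approx) blast
  have "approx_field UNIV (\<lambda>z. \<Sum>i\<in>I. X z $ i *s axis i 1)" if "finite I" for I
    using that
  proof (induction I)
    case empty
    show ?case using approx_field_shear[of 0 0 0] by simp
  next
    case (insert i I)
    have "approx_field UNIV (\<lambda>z. X z $ i *s axis i 1 + (\<Sum>i\<in>I. X z $ i *s axis i 1))"
      by (intro approx_field_add insert.IH approx_field_exp_approx[OF n] ap continuous_intros exp_approx_continuous)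
    then show ?case using insert.hyps by simp
  qed
  from this[of UNIV] show ?thesis by (simp add: basis_expansion)
qed

section \<open>Holomorphic fields on Runge sets\<close>

lemma runge_in_compact:
  fixes f :: "complex ^ 'n \<Rightarrow> complex"
  assumes "runge_in U T" "holo_fun U f" "compact K" "K \<subseteq> U" "e > 0"
  obtains g where "holo_fun T g" "\<And>z. z \<in> K \<Longrightarrow> cmod (f z - g z) < e"
proof -
  obtain g where g: "\<forall>k. holo_fun T (g k)"
    "\<forall>z\<in>U. \<exists>V. open V \<and> z \<in> V \<and> uniform_limit (V \<inter> U) g f sequentially"
    using assms(1,2) unfolding runge_in_def by blast
  then have "\<forall>z\<in>K. \<exists>V. open V \<and> z \<in> V \<and> uniform_limit (V \<inter> U) g f sequentially"
    using assms(4) by blast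
  from bchoice[OF this] obtain V
    where V: "\<forall>z\<in>K. open (V z) \<and> z \<in> V z \<and> uniform_limit (V z \<inter> U) g f sequentially" ..
  obtain D where D: "D \<subseteq> K" "finite D" "K \<subseteq> (\<Union>z\<in>D. V z)"
    using compactE_image[OF assms(3), of K V] V by blast
  have "\<forall>\<^sub>F k in sequentially. \<forall>z\<in>D. \<forall>x\<in>V z \<inter> U. dist (g k x) (f x) < e"
    using D V assms(5) by (intro eventually_ball_finite) (auto simp: uniform_limit_iff)
  then obtain k where k: "\<forall>z\<in>D. \<forall>x\<in>V z \<inter> U. dist (g k x) (f x) < e"
    using eventually_happens'[OF sequentially_bot] by blast
  show thesis
  proof (rule that[of "g k"])
    show "holo_fun T (g k)" using g(1) by blast
    show "cmod (f z - g k z) < e" if z: "z \<in> K" for z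
    proof -
      obtain y where "y \<in> D" "z \<in> V y" using D(3) z by blast
      then have "dist (g k z) (f z) < e" using k assms(4) z by blast
      then show ?thesis by (simp add: dist_norm norm_minus_commute)
    qed
  qed
qed

lemma norm_vec_le_sum: "norm (x :: complex ^ 'n) \<le> (\<Sum>i\<in>UNIV. cmod (x $ i))"
  unfolding norm_vec_def by (rule L2_set_le_sum) simp

lemma approx_field_runge:
  fixes X :: "complex ^ 'n \<Rightarrow> complex ^ 'n"
  assumes n: "CARD('n) \<ge> 2" and U: "runge_in U UNIV" and X: "holo_map U X"
  shows "approx_field U X"
proof (rule approx_field_limit)
  fix K :: "(complex ^ 'n) set" and e :: real assume K: "compact K" "K \<subseteq> U" "e > 0"
  have "\<exists>g. holo_fun UNIV g \<and> (\<forall>z\<in>K. cmod (X z $ i - g z) < e / CARD('n))" for i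
  proof -
    have "holo_fun U (\<lambda>z. X z $ i)" using X by (simp add: holo_map_def)
    moreover have "e / CARD('n) > 0" using K(3) by simp
    ultimately obtain g where "holo_fun UNIV g" "\<And>z. z \<in> K \<Longrightarrow> cmod (X z $ i - g z) < e / CARD('n)"
      using runge_in_compact[OF U _ K(1,2)] by blast
    then show ?thesis by blast
  qed
  then have "\<forall>i. \<exists>g. holo_fun UNIV g \<and> (\<forall>z\<in>K. cmod (X z $ i - g z) < e / CARD('n))" by blast
  from choice[OF this] obtain g where g: "\<forall>i. holo_fun UNIV (g i) \<and> (\<forall>z\<in>K. cmod (X z $ i - g i z) < e / CARD('n))" ..
  define Y where "Y z = (\<chi> i. g i z)" for z
  have "holo_map UNIV Y" using g by (simp add: holo_map_def Y_def)
  then have "approx_field UNIV Y" by (rule approx_field_entire[OF n])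
  moreover have "norm (X z - Y z) \<le> e" if z: "z \<in> K" for z
  proof -
    have "norm (X z - Y z) \<le> (\<Sum>i\<in>UNIV. cmod ((X z - Y z) $ i))" by (rule norm_vec_le_sum)
    also have "\<dots> \<le> (\<Sum>i\<in>(UNIV :: 'n set). e / CARD('n))"
      using g z by (intro sum_mono) (auto simp: Y_def less_imp_le)
    finally show ?thesis by simp
  qed
  ultimately show "\<exists>Y. approx_field UNIV Y \<and> (\<forall>z\<in>K. norm (X z - Y z) \<le> e)" by blast
qed

section \<open>Flows\<close>

lemma compact_cball_nbhd:
  fixes A :: "'a::euclidean_space set"
  assumes "compact A" "open B" "A \<subseteq> B"
  obtains d where "d > 0" "compact (\<Union>x\<in>A. cball x d)" "(\<Union>x\<in>A. cball x d) \<subseteq> B"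
proof -
  obtain e where e: "e > 0" "(\<Union>x\<in>A. ball x e) \<subseteq> B"
    using compact_subset_open_imp_ball_epsilon_subset[OF assms] by blast
  have "(\<Union>x\<in>A. cball x (e / 2)) = {x + y | x y. x \<in> A \<and> y \<in> cball 0 (e / 2)}"
  proof (intro equalityI subsetI)
    fix y assume "y \<in> (\<Union>x\<in>A. cball x (e / 2))"
    then obtain x where "x \<in> A" "dist x y \<le> e / 2" by auto
    then show "y \<in> {x + y | x y. x \<in> A \<and> y \<in> cball 0 (e / 2)}"
      by (intro CollectI exI[of _ x] exI[of _ "y - x"]) (auto simp: dist_norm norm_minus_commute)
  next
    fix y assume "y \<in> {x + y | x y. x \<in> A \<and> y \<in> cball 0 (e / 2)}"
    then obtain x w where "x \<in> A" "y = x + w" "w \<in> cball 0 (e / 2)" by blast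
    then show "y \<in> (\<Union>x\<in>A. cball x (e / 2))" by (intro UN_I[of x]) (auto simp: dist_norm)
  qed
  moreover have "compact {x + y | x y. x \<in> A \<and> y \<in> cball 0 (e / 2)}"
    by (rule compact_sums[OF assms(1)]) simp
  moreover have "(\<Union>x\<in>A. cball x (e / 2)) \<subseteq> (\<Union>x\<in>A. ball x e)" using e(1) by fastforce
  ultimately show thesis using that[of "e / 2"] e by auto
qed

lemma norm_matrix_vector_le:
  fixes M :: "complex ^ 'n ^ 'm"
  shows "norm (M *v v) \<le> (\<Sum>i\<in>UNIV. \<Sum>j\<in>UNIV. cmod (M $ i $ j)) * norm v"
proof -
  have "norm (M *v v) \<le> (\<Sum>i\<in>UNIV. cmod ((M *v v) $ i))" by (rule norm_vec_le_sum)
  also have "\<dots> \<le> (\<Sum>i\<in>UNIV. \<Sum>j\<in>UNIV. cmod (M $ i $ j) * norm v)"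
  proof (rule sum_mono)
    fix i
    have "cmod ((M *v v) $ i) \<le> (\<Sum>j\<in>UNIV. cmod (M $ i $ j * v $ j))"
      unfolding matrix_vector_mult_def by (simp add: norm_sum)
    also have "\<dots> \<le> (\<Sum>j\<in>UNIV. cmod (M $ i $ j) * norm v)"
      by (intro sum_mono) (simp add: norm_mult mult_left_mono Finite_Cartesian_Product.norm_nth_le)
    finally show "cmod ((M *v v) $ i) \<le> (\<Sum>j\<in>UNIV. cmod (M $ i $ j) * norm v)" .
  qed
  finally show ?thesis by (simp add: sum_distrib_right)
qed

lemma holo_fun_jac_mat:
  assumes "open S" "holo_map S F"
  shows "holo_fun S (\<lambda>z. jac_mat F z $ i $ j)"
  using assms unfolding jac_mat_def holo_map_def by (auto intro!: holo_fun_pd)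

text \<open>One constant for all convex subsets, because the compact tube to which this is applied
  is not convex; the mean value inequality is used inside single balls.\<close>

lemma holo_map_lipschitz:
  fixes W :: "complex ^ 'n \<Rightarrow> complex ^ 'm"
  assumes U: "open U" "holo_map U W" and K: "compact K" "K \<subseteq> U"
  obtains L where "L > 0" "\<And>S x y. convex S \<Longrightarrow> S \<subseteq> K \<Longrightarrow> x \<in> S \<Longrightarrow> y \<in> S \<Longrightarrow> norm (W x - W y) \<le> L * norm (x - y)"
proof -
  define N where "N y = (\<Sum>i\<in>UNIV. \<Sum>j\<in>UNIV. cmod (jac_mat W y $ i $ j))" for y
  have "continuous_on K N" unfolding N_def
    by (intro continuous_on_sum continuous_on_norm continuous_on_subset[OF holo_fun_continuous[OF holo_fun_jac_mat[OF U]] K(2)])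
  then obtain L where L: "L > 0" "\<And>y. y \<in> K \<Longrightarrow> norm (N y) \<le> L" using compact_norm_bound[OF K(1)] by blast
  show thesis
  proof (rule that[OF L(1)])
    fix S x y assume S: "convex S" "S \<subseteq> K" "x \<in> S" "y \<in> S"
    show "norm (W x - W y) \<le> L * norm (x - y)"
    proof (rule differentiable_bound[OF S(1) _ _ S(3,4)])
      fix z assume z: "z \<in> S"
      then show "(W has_derivative (\<lambda>v. jac_mat W z *v v)) (at z within S)"
        using has_derivative_jac_mat[OF U] S(2) K(2) has_derivative_at_withinI by blast
      have "N z \<le> L" using L(2)[of z] z S(2) by auto
      then show "onorm (\<lambda>v. jac_mat W z *v v) \<le> L"
        using norm_matrix_vector_le[of "jac_mat W z"] L(1) unfolding N_def
        by (intro onorm_le) (meson mult_right_mono norm_ge_zero order_trans)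
    qed
  qed
qed

lemma holo_aut_id: "(\<lambda>x. x) \<in> holo_aut"
  by (auto simp: holo_aut_def bij_def inj_def)

lemma holo_aut_iterate: "A \<in> holo_aut \<Longrightarrow> A ^^ k \<in> holo_aut"
proof (induction k)
  case 0 show ?case using holo_aut_id by (simp add: id_def)
next
  case (Suc k) then show ?case using holo_aut_compose[of A "A ^^ k"] by (simp add: o_def)
qed

text \<open>The step estimate is available only while \<open>E k \<le> \<delta>\<close>, that is,
  inside a tube around the exact solution. By \<open>small\<close> the final bound itself respects
  the tube, so the induction never leaves it.\<close>

lemma discrete_gronwall:
  fixes E :: "nat \<Rightarrow> real"
  assumes h: "h \<ge> 0" and L: "L \<ge> 0" and \<eta>: "\<eta> \<ge> 0"
    and E0: "E 0 = 0" and step: "\<And>k. k < N \<Longrightarrow> E k \<le> \<delta> \<Longrightarrow> E (Suc k) \<le> (1 + h * L) * E k + \<eta> * h"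
    and small: "\<eta> * (h * real N) * exp (L * (h * real N)) \<le> \<delta>" and k: "k \<le> N"
  shows "E k \<le> \<eta> * (h * real N) * exp (L * (h * real N))"
proof -
  have *: "\<eta> * (h * real k) * (1 + h * L) ^ k \<le> \<eta> * (h * real N) * exp (L * (h * real N))" if "k \<le> N" for k
  proof -
    have "(1 + h * L) ^ k \<le> exp (h * L) ^ k" using h L by (intro power_mono exp_ge_add_one_self) simp
    also have "\<dots> = exp (L * (h * real k))" by (simp add: exp_of_nat_mult[symmetric] mult_ac)
    also have "\<dots> \<le> exp (L * (h * real N))" using that h L by (simp add: mult_left_mono)
    finally show ?thesis using that h L \<eta> by (intro mult_mono) auto
  qed
  have "E k \<le> \<eta> * (h * real k) * (1 + h * L) ^ k" if "k \<le> N" for k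
    using that
  proof (induction k)
    case (Suc k)
    then have IH: "E k \<le> \<eta> * (h * real k) * (1 + h * L) ^ k" by simp
    also have "\<dots> \<le> \<delta>" using *[of k] small Suc.prems by simp
    finally have "E (Suc k) \<le> (1 + h * L) * E k + \<eta> * h" using step Suc.prems by simp
    also have "\<dots> \<le> (1 + h * L) * (\<eta> * (h * real k) * (1 + h * L) ^ k) + \<eta> * h * (1 + h * L) ^ Suc k"
    proof (intro add_mono mult_left_mono IH)
      have "1 \<le> (1 + h * L) ^ Suc k" using h L by (intro one_le_power) simp
      then show "\<eta> * h \<le> \<eta> * h * (1 + h * L) ^ Suc k" using h \<eta> mult_left_mono[of 1 _ "\<eta> * h"] by simp
    qed (use h L in auto)
    also have "\<dots> = \<eta> * (h * real (Suc k)) * (1 + h * L) ^ Suc k" by (simp add: algebra_simps)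
    finally show ?case .
  qed (simp add: E0)
  then show ?thesis using *[OF k] k order_trans by blast
qed

text \<open>The field does not depend on time, so one automorphism \<open>A\<close> serves as the
  step at every time, and its iterates are compared with the exact curves within the compact tube
  \<open>C'\<close>.\<close>

lemma flow_approx:
  fixes W :: "complex ^ 'n \<Rightarrow> complex ^ 'n" and \<phi> :: "real \<Rightarrow> 'a::euclidean_space \<Rightarrow> complex ^ 'n"
  assumes U: "open U" and W: "approx_field U W" "holo_map U W" and K: "compact K" and T: "T > 0"
    and cont: "continuous_on ({0..T} \<times> K) (\<lambda>p. \<phi> (fst p) (snd p))"
    and inU: "\<And>t x. t \<in> {0..T} \<Longrightarrow> x \<in> K \<Longrightarrow> \<phi> t x \<in> U"
    and der: "\<And>t x. t \<in> {0..T} \<Longrightarrow> x \<in> K \<Longrightarrow> ((\<lambda>t. \<phi> t x) has_vector_derivative W (\<phi> t x)) (at t within {0..T})"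
    and e: "e > 0"
  shows "\<exists>A\<in>holo_aut. \<forall>x\<in>K. norm (A (\<phi> 0 x) - \<phi> T x) \<le> e"
proof -
  define C where "C = (\<lambda>p. \<phi> (fst p) (snd p)) ` ({0..T} \<times> K)"
  have cTK: "compact ({0..T} \<times> K)" by (intro compact_Times K) simp
  have C: "compact C" unfolding C_def by (rule compact_continuous_image[OF cont cTK])
  have CU: "C \<subseteq> U" using inU by (auto simp: C_def)
  have \<phi>C: "\<phi> t x \<in> C" if "t \<in> {0..T}" "x \<in> K" for t x using that by (force simp: C_def)
  obtain \<delta> where \<delta>: "\<delta> > 0" "compact (\<Union>x\<in>C. cball x \<delta>)" "(\<Union>x\<in>C. cball x \<delta>) \<subseteq> U"
    using compact_cball_nbhd[OF C U CU] by blast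
  define C' where "C' = (\<Union>x\<in>C. cball x \<delta>)"
  obtain L where L: "L > 0"
    "\<And>S x y. convex S \<Longrightarrow> S \<subseteq> C' \<Longrightarrow> x \<in> S \<Longrightarrow> y \<in> S \<Longrightarrow> norm (W x - W y) \<le> L * norm (x - y)"
    using holo_map_lipschitz[OF U W(2) \<delta>(2,3)] unfolding C'_def by blast
  define m where "m = min e \<delta>"
  \<comment> \<open>Chosen so that the total error \<open>2 * \<eta> * T * exp (L * T)\<close> is
    \<open>m\<close>. The factor 2 counts the error of \<open>A\<close> and the linearisation error
    of the exact curve.\<close>
  define \<eta> where "\<eta> = m / (2 * T * exp (L * T))"
  have m: "m > 0" using e \<delta>(1) by (simp add: m_def)
  have \<eta>: "\<eta> > 0" using m T by (simp add: \<eta>_def)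
  obtain h0 where h0: "h0 > 0"
    "\<And>h. 0 < h \<Longrightarrow> h < h0 \<Longrightarrow> \<exists>A\<in>holo_aut. \<forall>x\<in>C'. norm (A x - x - h *\<^sub>R W x) \<le> \<eta> * h"
    using approx_fieldD[OF W(1) \<delta>(2,3) \<eta>] unfolding C'_def by blast
  have "continuous_on ({0..T} \<times> K) (\<lambda>p. W (\<phi> (fst p) (snd p)))"
    by (rule continuous_on_compose2[OF holo_map_continuous[OF W(2)] cont]) (use inU in auto)
  from uniformly_continuous_onE[OF cTK this \<eta>] obtain d where d: "d > 0"
    "\<And>p q. p \<in> {0..T} \<times> K \<Longrightarrow> q \<in> {0..T} \<times> K \<Longrightarrow> dist q p < d \<Longrightarrow>
       dist (W (\<phi> (fst q) (snd q))) (W (\<phi> (fst p) (snd p))) < \<eta>" by blast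
  \<comment> \<open>The step must be below \<open>h0\<close> for \<open>A\<close> to exist, and
    below \<open>d\<close> for the velocity along a curve to vary by less than \<open>\<eta>\<close>
    during one step.\<close>
  obtain N where N: "T / min h0 d < real N" using reals_Archimedean2 by blast
  have N0: "real N > 0" using N T h0(1) d(1) by (metis divide_pos_pos less_trans min_less_iff_conj)
  define h where "h = T / real N"
  have "T < real N * min h0 d" using N h0(1) d(1) by (simp add: pos_divide_less_eq)
  then have "T < min h0 d * real N" by (subst mult.commute)
  then have h: "h > 0" "h < min h0 d" using N0 T pos_divide_less_eq[OF N0, of T "min h0 d"] unfolding h_def by auto
  have hN: "h * real N = T" using N0 by (simp add: h_def)
  obtain A where A: "A \<in> holo_aut" "\<And>x. x \<in> C' \<Longrightarrow> norm (A x - x - h *\<^sub>R W x) \<le> \<eta> * h"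
    using h0(2)[OF h(1)] h(2) by auto
  have main: "norm ((A ^^ N) (\<phi> 0 x) - \<phi> T x) \<le> e" if x: "x \<in> K" for x
  proof -
    define E where "E k = norm ((A ^^ k) (\<phi> 0 x) - \<phi> (h * real k) x)" for k :: nat
    have small: "2 * \<eta> * (h * real N) * exp (L * (h * real N)) = m"
      unfolding hN using T by (simp add: \<eta>_def)
    have "E N \<le> 2 * \<eta> * (h * real N) * exp (L * (h * real N))"
    proof (rule discrete_gronwall[where \<delta> = \<delta>])
      fix k assume k: "k < N" "E k \<le> \<delta>"
      define t where "t = h * real k"
      define y where "y = (A ^^ k) (\<phi> 0 x)"
      define c where "c = \<phi> t x"
      define c' where "c' = \<phi> (t + h) x"
      have "t + h = h * real (Suc k)" by (simp add: t_def algebra_simps)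
      also have "\<dots> \<le> h * real N" using k h(1) by (intro mult_left_mono) auto
      finally have th: "0 \<le> t" "t + h \<le> T" using h(1) by (auto simp: t_def hN)
      have tT: "t \<in> {0..T}" using th h(1) by simp
      have Ek: "E k = norm (y - c)" by (simp add: E_def y_def c_def t_def)
      have "c \<in> C" unfolding c_def by (rule \<phi>C[OF tT x])
      have cb: "cball c \<delta> \<subseteq> C'" using \<open>c \<in> C\<close> by (auto simp: C'_def)
      have yc: "y \<in> cball c \<delta>" "c \<in> cball c \<delta>"
        using k(2) \<delta>(1) by (auto simp: Ek dist_norm norm_minus_commute)
      have 1: "norm (A y - y - h *\<^sub>R W y) \<le> \<eta> * h" using A(2) cb yc(1) by blast
      have 2: "norm (W y - W c) \<le> L * norm (y - c)" by (rule L(2)[OF convex_cball cb yc])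
      have 3: "norm (c' - c - h *\<^sub>R W c) \<le> \<eta> * h"
      proof -
        have "norm (\<phi> (t + h) x - \<phi> t x - ((t + h) - t) *\<^sub>R W (\<phi> t x)) \<le> norm ((t + h) - t) * \<eta>"
        proof (rule vector_differentiable_bound_linearization[where S = "{t..t + h}" and f' = "\<lambda>s. W (\<phi> s x)"])
          fix s assume s: "s \<in> {t..t + h}"
          then have sT: "s \<in> {0..T}" using th by auto
          show "((\<lambda>t. \<phi> t x) has_vector_derivative W (\<phi> s x)) (at s within {t..t + h})"
            by (rule has_vector_derivative_within_subset[OF der[OF sT x]]) (use th in auto)
          have "dist (s, x) (t, x) < d" using s h by (simp add: dist_Pair_Pair dist_real_def)
          then show "norm (W (\<phi> s x) - W (\<phi> t x)) \<le> \<eta>"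
            using d(2)[of "(t, x)" "(s, x)"] sT tT x by (simp add: dist_norm)
        qed (use h(1) in \<open>auto simp: closed_segment_eq_real_ivl\<close>)
        then show ?thesis using h(1) by (simp add: c_def c'_def mult.commute)
      qed
      have "E (Suc k) = norm (A y - c')" by (simp add: E_def y_def c'_def t_def algebra_simps)
      \<comment> \<open>The three terms: error of the automorphism at \<open>y\<close>, propagation
        of the old error, and deviation of the exact curve from its tangent.\<close>
      also have "A y - c' = (A y - y - h *\<^sub>R W y) + ((y - c) + h *\<^sub>R (W y - W c)) + - (c' - c - h *\<^sub>R W c)"
        by (simp add: algebra_simps)
      also have "norm \<dots> \<le> \<eta> * h + (norm (y - c) + h * (L * norm (y - c))) + \<eta> * h"
      proof (intro order_trans[OF norm_triangle_ineq] add_mono 1)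
        show "norm (h *\<^sub>R (W y - W c)) \<le> h * (L * norm (y - c))" using 2 h(1) by (simp add: mult_left_mono)
        show "norm (- (c' - c - h *\<^sub>R W c)) \<le> \<eta> * h" using 3 by (simp only: norm_minus_cancel)
      qed simp
      finally show "E (Suc k) \<le> (1 + h * L) * E k + 2 * \<eta> * h" by (simp add: Ek algebra_simps)
    qed (use h L \<eta> small in \<open>auto simp: E_def m_def\<close>)
    then have "E N \<le> e" unfolding small by (simp add: m_def)
    then show ?thesis by (simp add: E_def hN)
  qed
  then show ?thesis using holo_aut_iterate[OF A(1)] by blast
qed

lemma holo_map_compose_inv_into:
  fixes F :: "complex ^ 'n \<Rightarrow> complex ^ 'n"
  assumes "open \<Omega>" "holo_map \<Omega> F" "inj_on F \<Omega>" "holo_fun \<Omega> f"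
  shows "holo_fun (F ` \<Omega>) (\<lambda>y. f (inv_into \<Omega> F y))"
  by (rule holo_fun_compose[OF assms(4) holo_map_inv_into(2)[OF assms(1-3)] holo_map_inv_into(1)[OF assms(1-3)] assms(1)])
     (auto simp: inv_into_into)

text \<open>By the chain rule the transported curves follow the push-forward \<open>W\<close> of
  \<open>X\<close>. It is holomorphic because the inverse of \<open>F\<close> is, and approximable
  because the image of \<open>F\<close> is Runge.\<close>

lemma transported_flow_approx:
  fixes F X :: "complex ^ 'n \<Rightarrow> complex ^ 'n" and \<phi> :: "real \<Rightarrow> 'a::euclidean_space \<Rightarrow> complex ^ 'n"
  assumes n: "CARD('n) \<ge> 2" and \<Omega>: "open \<Omega>" and F: "holo_map \<Omega> F" "inj_on F \<Omega>" "runge_in (F ` \<Omega>) UNIV"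
    and X: "holo_map \<Omega> X" and K: "compact K" and T: "T > 0"
    and cont: "continuous_on ({0..T} \<times> K) (\<lambda>p. \<phi> (fst p) (snd p))"
    and in\<Omega>: "\<And>t x. t \<in> {0..T} \<Longrightarrow> x \<in> K \<Longrightarrow> \<phi> t x \<in> \<Omega>"
    and der: "\<And>t x. t \<in> {0..T} \<Longrightarrow> x \<in> K \<Longrightarrow> ((\<lambda>t. \<phi> t x) has_vector_derivative X (\<phi> t x)) (at t within {0..T})"
    and e: "e > 0"
  shows "\<exists>A\<in>holo_aut. \<forall>x\<in>K. norm (A (F (\<phi> 0 x)) - F (\<phi> T x)) \<le> e"
proof -
  define G where "G = inv_into \<Omega> F"
  define U where "U = F ` \<Omega>"
  have U: "open U" unfolding U_def by (rule holo_map_inv_into(1)[OF \<Omega> F(1,2)])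
  have GF: "G (F z) = z" if "z \<in> \<Omega>" for z using F(2) that by (simp add: G_def)
  define W where "W y = jac_mat F (G y) *v X (G y)" for y
  have W: "holo_map U W"
    unfolding holo_map_def W_def matrix_vector_mult_def U_def G_def vec_lambda_beta
    by (intro allI holo_fun_sum holo_fun_mult holo_map_compose_inv_into[OF \<Omega> F(1,2), of "\<lambda>z. jac_mat F z $ _ $ _"]
        holo_map_compose_inv_into[OF \<Omega> F(1,2), of "\<lambda>z. X z $ _"] holo_fun_jac_mat[OF \<Omega> F(1)] X[unfolded holo_map_def, rule_format])
  show ?thesis
  proof (rule flow_approx[OF U approx_field_runge[OF n F(3)[folded U_def] W] W K T, where \<phi> = "\<lambda>t x. F (\<phi> t x)"])
    show "continuous_on ({0..T} \<times> K) (\<lambda>p. F (\<phi> (fst p) (snd p)))"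
      by (rule continuous_on_compose2[OF holo_map_continuous[OF F(1)] cont]) (use in\<Omega> in auto)
    show "F (\<phi> t x) \<in> U" if "t \<in> {0..T}" "x \<in> K" for t x using in\<Omega>[OF that] by (simp add: U_def)
    show "((\<lambda>t. F (\<phi> t x)) has_vector_derivative W (F (\<phi> t x))) (at t within {0..T})"
      if tx: "t \<in> {0..T}" "x \<in> K" for t x
    proof -
      have dF: "(F has_derivative (\<lambda>v. jac_mat F (\<phi> t x) *v v)) (at (\<phi> t x))"
        by (rule has_derivative_jac_mat[OF \<Omega> F(1) in\<Omega>[OF tx]])
      have "((\<lambda>t. F (\<phi> t x)) has_derivative (\<lambda>h. jac_mat F (\<phi> t x) *v (h *\<^sub>R X (\<phi> t x)))) (at t within {0..T})"
        using has_derivative_compose[OF der[OF tx, unfolded has_vector_derivative_def] dF] .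
      moreover have "jac_mat F (\<phi> t x) *v (h *\<^sub>R X (\<phi> t x)) = h *\<^sub>R (jac_mat F (\<phi> t x) *v X (\<phi> t x))" for h
        using linear_scale[OF has_derivative_linear[OF dF]] .
      ultimately show ?thesis
        unfolding has_vector_derivative_def W_def by (simp add: GF[OF in\<Omega>[OF tx]])
    qed
  qed (rule e)
qed

section \<open>The generator of a holomorphic flow\<close>

text \<open>Unit discs in coordinate directions about points of \<open>cball 0 R\<close> stay within
  radius \<open>R + 1\<close>, so Cauchy's estimate bounds every entry of the Jacobian matrix by
  \<open>B\<close>; the operator norm costs the number of entries.\<close>

lemma cauchy_lipschitz:
  fixes g :: "complex ^ 'n \<Rightarrow> complex ^ 'm"
  assumes g: "holo_map UNIV g" and B: "\<And>z. norm z \<le> R + 1 \<Longrightarrow> norm (g z) \<le> B"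
    and xy: "norm x \<le> R" "norm y \<le> R"
  shows "norm (g x - g y) \<le> real CARD('m) * real CARD('n) * B * norm (x - y)"
proof (rule differentiable_bound[of "cball 0 R"])
  have entry: "cmod (jac_mat g z $ i $ j) \<le> B" if z: "norm z \<le> R" for z i j
  proof -
    have gi: "holo_fun UNIV (\<lambda>z. g z $ i)" using g by (simp add: holo_map_def)
    have hol: "(\<lambda>t. g (z + t *s axis j 1) $ i) holomorphic_on UNIV"
      using holo_fun_line[OF gi open_UNIV] by simp
    have "cmod ((deriv ^^ 1) (\<lambda>t. g (z + t *s axis j 1) $ i) 0) \<le> fact 1 * B / 1 ^ 1"
    proof (rule Cauchy_inequality)
      show "(\<lambda>t. g (z + t *s axis j 1) $ i) holomorphic_on ball 0 1"
        using hol by (rule holomorphic_on_subset) simp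
      show "continuous_on (cball 0 1) (\<lambda>t. g (z + t *s axis j 1) $ i)"
        using holomorphic_on_imp_continuous_on[OF hol] by (rule continuous_on_subset) simp
      show "cmod (g (z + t *s axis j 1) $ i) \<le> B" if "cmod (0 - t) = 1" for t
      proof -
        have "norm (z + t *s axis j 1) \<le> R + 1"
          using norm_triangle_ineq[of z "t *s axis j 1"] z that by simp
        then show ?thesis using B Finite_Cartesian_Product.norm_nth_le order_trans by blast
      qed
    qed simp
    then show ?thesis by (simp add: jac_mat_def pd_def)
  qed
  fix z :: "complex ^ 'n" assume z: "z \<in> cball 0 R"
  show "(g has_derivative (\<lambda>v. jac_mat g z *v v)) (at z within cball 0 R)"
    by (rule has_derivative_at_withinI[OF has_derivative_jac_mat[OF open_UNIV g UNIV_I]])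
  have "(\<Sum>i\<in>UNIV. \<Sum>j\<in>UNIV. cmod (jac_mat g z $ i $ j)) \<le> (\<Sum>i\<in>(UNIV :: 'm set). \<Sum>j\<in>(UNIV :: 'n set). B)"
    using entry[of z] z by (intro sum_mono) simp
  also have "\<dots> = real CARD('m) * real CARD('n) * B" by simp
  finally have *: "(\<Sum>i\<in>UNIV. \<Sum>j\<in>UNIV. cmod (jac_mat g z $ i $ j)) \<le> real CARD('m) * real CARD('n) * B" .
  show "onorm (\<lambda>v. jac_mat g z *v v) \<le> real CARD('m) * real CARD('n) * B"
  proof (rule onorm_le)
    fix v :: "complex ^ 'n"
    show "norm (jac_mat g z *v v) \<le> real CARD('m) * real CARD('n) * B * norm v"
      by (rule order_trans[OF norm_matrix_vector_le mult_right_mono[OF * norm_ge_zero]])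
  qed
qed (use xy in auto)

locale holo_flow =
  fixes \<theta> :: "real \<times> (complex ^ 'n) \<Rightarrow> complex ^ 'n"
  assumes cont: "continuous_on UNIV \<theta>"
    and zero: "\<theta> (0, z) = z"
    and plus: "\<theta> (s + t, z) = \<theta> (s, \<theta> (t, z))"
    and holo: "holo_map UNIV (\<lambda>z. \<theta> (t, z))"
begin

lemma cont_compose: "continuous_on S f \<Longrightarrow> continuous_on S g \<Longrightarrow> continuous_on S (\<lambda>x. \<theta> (f x, g x))"
  by (rule continuous_on_compose2[OF cont]) (auto intro!: continuous_intros)

lemma small_time:
  assumes c: "c > 0"
  shows "\<exists>h. 0 < h \<and> (\<forall>s z. 0 \<le> s \<longrightarrow> s \<le> h \<longrightarrow> norm z \<le> R \<longrightarrow> norm (\<theta> (s, z) - z) \<le> c)"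
proof -
  have K: "compact ({0..1::real} \<times> cball (0 :: complex ^ 'n) R)" by (intro compact_Times) auto
  obtain d where d: "d > 0" "\<And>p q. p \<in> {0..1::real} \<times> cball 0 R \<Longrightarrow> q \<in> {0..1::real} \<times> cball 0 R \<Longrightarrow>
      dist q p < d \<Longrightarrow> dist (\<theta> q) (\<theta> p) < c"
    using uniformly_continuous_onE[OF K continuous_on_subset[OF cont subset_UNIV] c] by blast
  have "norm (\<theta> (s, z) - z) \<le> c" if s: "0 \<le> s" "s \<le> min 1 (d / 2)" "norm z \<le> R" for s z
  proof -
    have "dist (s, z) (0, z) < d" using s d(1) by (simp add: dist_Pair_Pair dist_real_def)
    then show ?thesis
      using d(2)[of "(0, z)" "(s, z)"] s zero by (simp add: dist_norm)
  qed
  moreover have "0 < min 1 (d / 2)" using d(1) by simp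
  ultimately show ?thesis by blast
qed

text \<open>Difference quotients at time 0 along dyadic steps: a coarse step consists of whole finer
  steps, which permits comparison by telescoping.\<close>

definition quot :: "nat \<Rightarrow> complex ^ 'n \<Rightarrow> complex ^ 'n" where
  "quot k z = 2 ^ k *\<^sub>R (\<theta> (1 / 2 ^ k, z) - z)"

lemma step_eq_quot: "\<theta> (1 / 2 ^ k, z) - z = (1 / 2 ^ k) *\<^sub>R quot k z"
  by (simp add: quot_def)

lemma holo_map_quot: "holo_map UNIV (quot k)"
  using holo[of "1 / 2 ^ k"] unfolding holo_map_def quot_def
  by (auto simp: scaleR_conv_of_real[where 'a = complex] intro!: holo_fun_mult holo_fun_diff)

lemma telescope:
  "\<theta> (s + real m / 2 ^ k, z) - \<theta> (s, z) = (\<Sum>j<m. (1 / 2 ^ k) *\<^sub>R quot k (\<theta> (s + real j / 2 ^ k, z)))"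
proof (induction m)
  case (Suc m)
  have "s + real (Suc m) / 2 ^ k = 1 / 2 ^ k + (s + real m / 2 ^ k)" by (simp add: add_divide_distrib)
  then have "\<theta> (s + real (Suc m) / 2 ^ k, z) = \<theta> (1 / 2 ^ k, \<theta> (s + real m / 2 ^ k, z))" using plus by metis
  then show ?case using Suc step_eq_quot[of k "\<theta> (s + real m / 2 ^ k, z)"] by (simp add: algebra_simps)
qed simp

text \<open>The average \<open>\<eta>\<close> of \<open>\<theta>\<close> over the times \<open>j * t\<close> with \<open>j < N\<close> satisfies
  \<open>\<eta> (\<theta> (t, z)) - \<eta> z = (\<theta> (N * t, z) - z) / N\<close>.  For small \<open>N * t\<close> it differs from the
  identity by a map \<open>g\<close> with Lipschitz constant \<open>1 / 2\<close>, so \<open>\<theta> (t, z) - z\<close> is of order \<open>1 / N\<close>.\<close>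

lemma quot_bounded:
  "\<exists>C m. C > 0 \<and> (\<forall>k z. k \<ge> m \<longrightarrow> norm z \<le> R \<longrightarrow> norm (quot k z) \<le> C)"
proof -
  \<comment> \<open>Makes the Lipschitz constant given by \<open>cauchy_lipschitz\<close> equal to
    \<open>1 / 2\<close>.\<close>
  define c where "c = 1 / (2 * (real CARD('n) * real CARD('n)))"
  have n1: "real CARD('n) * real CARD('n) \<ge> 1"
    using mult_mono[of 1 "real CARD('n)" 1 "real CARD('n)"] by (simp add: Suc_leI)
  have c: "c > 0" "c \<le> 1" "real CARD('n) * real CARD('n) * c = 1 / 2" using n1 by (auto simp: c_def field_simps)
  \<comment> \<open>Radius \<open>R + 2\<close>: one unit for the displacement of \<open>z\<close>,
    another for the Cauchy estimate.\<close>
  obtain h0 where h0_: "0 < h0 \<and> (\<forall>s z. 0 \<le> s \<longrightarrow> s \<le> h0 \<longrightarrow> norm z \<le> R + 2 \<longrightarrow> norm (\<theta> (s, z) - z) \<le> c)"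
    using small_time[OF c(1), where R = "R + 2"] by (elim exE) (rule that)
  note h0 = h0_[THEN conjunct1] h0_[THEN conjunct2, rule_format]
  obtain m where m: "(1 / 2) ^ m < h0" using real_arch_pow_inv[OF h0(1), of "1 / 2"] by auto
  show ?thesis
  proof (intro exI[of _ "2 * 2 ^ m * c"] exI[of _ m] conjI allI impI)
    show "2 * 2 ^ m * c > 0" using c by simp
    fix k :: nat and z :: "complex ^ 'n" assume k: "k \<ge> m" and z: "norm z \<le> R"
    \<comment> \<open>The number of steps \<open>t\<close> that fill the fixed time
      \<open>(1 / 2) ^ m\<close>, which is below \<open>h0\<close>.\<close>
    define N :: nat where "N = 2 ^ (k - m)"
    define t :: real where "t = 1 / 2 ^ k"
    have N: "real N > 0" by (simp add: N_def)
    have "(2 :: real) ^ k = 2 ^ m * real N" using k by (simp add: N_def flip: power_add)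
    then have kN: "2 ^ k = 2 ^ m * real N" "real N * t = (1 / 2) ^ m" using N by (auto simp: t_def power_divide)
    have t: "t > 0" by (simp add: t_def)
    have jt: "0 \<le> real j * t" "real j * t \<le> h0" if "j \<le> N" for j
    proof -
      have "real j * t \<le> real N * t" using that t by (intro mult_right_mono) auto
      then show "real j * t \<le> h0" using kN m by simp
    qed (use t in simp)
    define g where "g w = (1 / real N) *\<^sub>R (\<Sum>j<N. \<theta> (real j * t, w) - w)" for w
    have g: "holo_map UNIV g"
      unfolding holo_map_def
    proof
      fix i
      have "holo_fun UNIV (\<lambda>w. (\<Sum>j<N. \<theta> (real j * t, w) $ i - w $ i) * of_real (1 / real N))"
        by (intro holo_fun_mult holo_fun_sum holo_fun_diff holo_fun_const holo_fun_nth holo[unfolded holo_map_def, rule_format])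
      moreover have "g w $ i = (\<Sum>j<N. \<theta> (real j * t, w) $ i - w $ i) * of_real (1 / real N)" for w
        by (simp add: g_def sum_component scaleR_conv_of_real[where 'a = complex] del: of_real_divide)
      ultimately show "holo_fun UNIV (\<lambda>w. g w $ i)" by presburger
    qed
    have gb: "norm (g w) \<le> c" if "norm w \<le> (R + 1) + 1" for w
    proof -
      have "norm (\<Sum>j<N. \<theta> (real j * t, w) - w) \<le> (\<Sum>j<N. c)"
        by (intro order_trans[OF norm_sum] sum_mono h0(2) jt) (use that in auto)
      then show ?thesis using N by (simp add: g_def field_simps)
    qed
    define w where "w = \<theta> (t, z)"
    have wz: "norm (w - z) \<le> c" unfolding w_def
      using h0(2)[of "real 1 * t" z] jt[of 1] z by (simp add: N_def)
    have wR: "norm w \<le> R + 1" "norm z \<le> R + 1" using norm_triangle_sub[of w z] wz z c(2) by auto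
    have half: "norm (g w - g z) \<le> 1 / 2 * norm (w - z)"
      using cauchy_lipschitz[OF g gb wR] c(3) by simp
    have shift: "\<theta> (real j * t, w) = \<theta> (real (Suc j) * t, z)" for j
    proof -
      have "real (Suc j) * t = real j * t + t" by (simp add: algebra_simps)
      then show ?thesis using plus[of "real j * t" t z] by (simp add: w_def)
    qed
    have "(\<Sum>j<N. \<theta> (real j * t, w) - w) - (\<Sum>j<N. \<theta> (real j * t, z) - z)
        = (\<Sum>j<N. \<theta> (real (Suc j) * t, z) - \<theta> (real j * t, z)) - real N *\<^sub>R (w - z)"
      unfolding shift by (simp add: sum_subtractf scaleR_diff_right sum_constant_scaleR algebra_simps del: sum_constant)
    also have "(\<Sum>j<N. \<theta> (real (Suc j) * t, z) - \<theta> (real j * t, z)) = \<theta> (real N * t, z) - z"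
      by (subst sum_lessThan_telescope) (simp add: zero)
    finally have "g w - g z = (1 / real N) *\<^sub>R (\<theta> (real N * t, z) - z) - (w - z)"
      using N by (simp add: g_def flip: scaleR_diff_right) (simp add: scaleR_diff_right)
    \<comment> \<open>The term in \<open>g\<close> is at most half the left side and is absorbed
      there, which leaves a displacement of order \<open>1 / N\<close>.\<close>
    then have "norm (w - z) \<le> norm ((1 / real N) *\<^sub>R (\<theta> (real N * t, z) - z)) + norm (g w - g z)"
      by (metis add_diff_cancel_left' diff_add_cancel norm_triangle_ineq4)
    also have "norm ((1 / real N) *\<^sub>R (\<theta> (real N * t, z) - z)) \<le> c / real N"
      using h0(2)[OF jt[of N], of z] z N by (simp add: divide_right_mono)
    finally have "norm (w - z) \<le> 2 * c / real N" using half by simp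
    then have "2 ^ k * norm (w - z) \<le> 2 ^ k * (2 * c / real N)" by (rule mult_left_mono) simp
    moreover have "norm (quot k z) = 2 ^ k * norm (w - z)" by (simp add: quot_def w_def t_def)
    ultimately have "norm (quot k z) \<le> 2 ^ k * (2 * c / real N)" by simp
    then show "norm (quot k z) \<le> 2 * 2 ^ m * c" using N by (simp add: kN(1) field_simps)
  qed
qed

text \<open>\<open>quot k z\<close> is the average of \<open>quot (k + l)\<close> over
  \<open>2 ^ l\<close> intermediate points, all within \<open>B / 2 ^ k\<close> of \<open>z\<close>.
  The uniform bound on the quotients gives them a common Lipschitz constant by Cauchy's
  estimate.\<close>

lemma quot_cauchy:
  "\<exists>C m. C > 0 \<and> (\<forall>k l z. k \<ge> m \<longrightarrow> norm z \<le> R \<longrightarrow> norm (quot k z - quot (k + l) z) \<le> C / 2 ^ k)"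
proof -
  obtain B m1 where B_: "B > 0 \<and> (\<forall>k z. k \<ge> m1 \<longrightarrow> norm z \<le> (R + 1) + 1 \<longrightarrow> norm (quot k z) \<le> B)"
    using quot_bounded[where R = "(R + 1) + 1"] by (elim exE) (rule that)
  note B = B_[THEN conjunct1] B_[THEN conjunct2, rule_format]
  obtain h where h_: "0 < h \<and> (\<forall>s z. 0 \<le> s \<longrightarrow> s \<le> h \<longrightarrow> norm z \<le> R \<longrightarrow> norm (\<theta> (s, z) - z) \<le> 1)"
    using small_time[OF zero_less_one, where R = R] by (elim exE) (rule that)
  note h = h_[THEN conjunct1] h_[THEN conjunct2, rule_format]
  obtain m2 where m2: "(1 / 2) ^ m2 < h" using real_arch_pow_inv[OF h(1), of "1 / 2"] by auto
  define L where "L = real CARD('n) * real CARD('n) * B"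
  have L: "L > 0" using B(1) by (simp add: L_def)
  show ?thesis
  proof (intro exI[of _ "L * B"] exI[of _ "max m1 m2"] conjI allI impI)
    show "L * B > 0" using L B by simp
    fix k l :: nat and z :: "complex ^ 'n" assume k: "k \<ge> max m1 m2" and z: "norm z \<le> R"
    have kh: "1 / 2 ^ k \<le> h"
    proof -
      have "(1 / 2 :: real) ^ k \<le> (1 / 2) ^ m2" using k by (intro power_decreasing) auto
      then show ?thesis using m2 by (simp add: power_one_over)
    qed
    define M :: nat where "M = 2 ^ l"
    have M: "real M > 0" by (simp add: M_def)
    have pw: "(2 :: real) ^ (k + l) = 2 ^ k * real M" by (simp add: M_def power_add)
    have time: "0 \<le> real j / 2 ^ (k + l)" "real j / 2 ^ (k + l) \<le> 1 / 2 ^ k" if "j \<le> M" for j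
      using that M by (auto simp: pw field_simps)
    have near: "norm (\<theta> (real j / 2 ^ (k + l), z)) \<le> R + 1" if "j \<le> M" for j
      using h(2)[OF time(1)[OF that] order_trans[OF time(2)[OF that] kh] z] z
        norm_triangle_sub[of "\<theta> (real j / 2 ^ (k + l), z)" z] by simp
    have dist: "norm (\<theta> (real j / 2 ^ (k + l), z) - z) \<le> B / 2 ^ k" if j: "j \<le> M" for j
    proof -
      have "\<theta> (real j / 2 ^ (k + l), z) - z = (\<Sum>i<j. (1 / 2 ^ (k + l)) *\<^sub>R quot (k + l) (\<theta> (real i / 2 ^ (k + l), z)))"
        using telescope[of 0 j "k + l" z] by (simp add: zero)
      also have "norm \<dots> \<le> (\<Sum>i<j. 1 / 2 ^ (k + l) * B)"
      proof (intro order_trans[OF norm_sum] sum_mono)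
        fix i assume "i \<in> {..<j}"
        then have "norm (quot (k + l) (\<theta> (real i / 2 ^ (k + l), z))) \<le> B"
          using near[of i] j k by (intro B(2)) auto
        then show "norm ((1 / 2 ^ (k + l)) *\<^sub>R quot (k + l) (\<theta> (real i / 2 ^ (k + l), z))) \<le> 1 / 2 ^ (k + l) * B"
          by (simp add: divide_right_mono)
      qed
      also have "\<dots> = real j / 2 ^ (k + l) * B" by simp
      also have "\<dots> \<le> 1 / 2 ^ k * B" using time(2)[OF j] B(1) by (intro mult_right_mono) auto
      finally show ?thesis by simp
    qed
    have "real M *\<^sub>R (quot k z - quot (k + l) z) = (\<Sum>j<M. quot (k + l) (\<theta> (real j / 2 ^ (k + l), z)) - quot (k + l) z)"
    proof -
      have "real M / 2 ^ (k + l) = 1 / 2 ^ k" using M by (simp add: pw)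
      then have "\<theta> (1 / 2 ^ k, z) - z = (1 / 2 ^ (k + l)) *\<^sub>R (\<Sum>j<M. quot (k + l) (\<theta> (real j / 2 ^ (k + l), z)))"
        using telescope[of 0 M "k + l" z] by (simp add: zero scaleR_sum_right)
      then have "2 ^ (k + l) *\<^sub>R (\<theta> (1 / 2 ^ k, z) - z) = (\<Sum>j<M. quot (k + l) (\<theta> (real j / 2 ^ (k + l), z)))"
        by simp
      then have "real M *\<^sub>R quot k z = (\<Sum>j<M. quot (k + l) (\<theta> (real j / 2 ^ (k + l), z)))"
        by (simp add: quot_def[of k] pw mult.commute)
      then show ?thesis by (simp add: scaleR_diff_right sum_subtractf sum_constant_scaleR del: sum_constant)
    qed
    then have "real M * norm (quot k z - quot (k + l) z) = norm (\<Sum>j<M. quot (k + l) (\<theta> (real j / 2 ^ (k + l), z)) - quot (k + l) z)"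
      using M by (metis abs_of_pos norm_scaleR)
    also have "\<dots> \<le> (\<Sum>j<M. L * (B / 2 ^ k))"
    proof (intro order_trans[OF norm_sum] sum_mono)
      fix j assume "j \<in> {..<M}"
      then have j: "j \<le> M" by simp
      have "norm (quot (k + l) (\<theta> (real j / 2 ^ (k + l), z)) - quot (k + l) z) \<le> L * norm (\<theta> (real j / 2 ^ (k + l), z) - z)"
        unfolding L_def by (rule cauchy_lipschitz[OF holo_map_quot _ near[OF j]]) (use B(2) k z in auto)
      also have "\<dots> \<le> L * (B / 2 ^ k)" using dist[OF j] L by (intro mult_left_mono) auto
      finally show "norm (quot (k + l) (\<theta> (real j / 2 ^ (k + l), z)) - quot (k + l) z) \<le> L * (B / 2 ^ k)" .
    qed
    finally have "real M * norm (quot k z - quot (k + l) z) \<le> real M * (L * B / 2 ^ k)" by simp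
    then show "norm (quot k z - quot (k + l) z) \<le> L * B / 2 ^ k" using M by (simp only: mult_le_cancel_left_pos)
  qed
qed

definition gen :: "complex ^ 'n \<Rightarrow> complex ^ 'n" where
  "gen z = lim (\<lambda>k. quot k z)"

lemma quot_tendsto_gen: "(\<lambda>k. quot k z) \<longlonglongrightarrow> gen z"
proof -
  obtain C m where C_: "C > 0 \<and> (\<forall>k l w. k \<ge> m \<longrightarrow> norm w \<le> norm z \<longrightarrow> norm (quot k w - quot (k + l) w) \<le> C / 2 ^ k)"
    using quot_cauchy[where R = "norm z"] by (elim exE) (rule that)
  note C = C_[THEN conjunct1] C_[THEN conjunct2, rule_format]
  have "Cauchy (\<lambda>k. quot k z)"
  proof (rule metric_CauchyI)
    fix e :: real assume e: "e > 0"
    obtain p where p: "(1 / 2) ^ p < e / (2 * C)" using real_arch_pow_inv[of "e / (2 * C)" "1 / 2"] e C(1) by auto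
    define q where "q = max m p"
    have "(1 / 2 :: real) ^ q \<le> (1 / 2) ^ p" by (intro power_decreasing) (auto simp: q_def)
    then have "1 / 2 ^ q < e / (2 * C)" using p by (simp add: power_one_over)
    then have less: "C / 2 ^ q < e / 2" using C(1) by (simp add: field_simps)
    have le: "norm (quot q z - quot i z) \<le> C / 2 ^ q" if "i \<ge> q" for i
      using C(2)[of q z "i - q"] that by (simp add: q_def)
    have near: "dist (quot q z) (quot i z) < e / 2" if "i \<ge> q" for i
      using le_less_trans[OF le[OF that] less] by (simp only: dist_norm)
    have "dist (quot i z) (quot j z) < e" if "i \<ge> q" "j \<ge> q" for i j
      using dist_triangle_half_r[OF near[OF that(1)] near[OF that(2)]] .
    then show "\<exists>M. \<forall>i\<ge>M. \<forall>j\<ge>M. dist (quot i z) (quot j z) < e" by blast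
  qed
  then show ?thesis unfolding gen_def using Cauchy_convergent convergent_LIMSEQ_iff by blast
qed

lemma gen_rate:
  "\<exists>C m. C > 0 \<and> (\<forall>k z. k \<ge> m \<longrightarrow> norm z \<le> R \<longrightarrow> norm (quot k z - gen z) \<le> C / 2 ^ k)"
proof -
  obtain C m where C_: "C > 0 \<and> (\<forall>k l z. k \<ge> m \<longrightarrow> norm z \<le> R \<longrightarrow> norm (quot k z - quot (k + l) z) \<le> C / 2 ^ k)"
    using quot_cauchy[where R = R] by (elim exE) (rule that)
  note C = C_[THEN conjunct1] C_[THEN conjunct2, rule_format]
  have "norm (quot k z - gen z) \<le> C / 2 ^ k" if "k \<ge> m" "norm z \<le> R" for k z
  proof (rule LIMSEQ_le_const2)
    have "(\<lambda>l. quot (l + k) z) \<longlonglongrightarrow> gen z" using quot_tendsto_gen by (rule LIMSEQ_ignore_initial_segment)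
    then show "(\<lambda>l. norm (quot k z - quot (k + l) z)) \<longlonglongrightarrow> norm (quot k z - gen z)"
      by (intro tendsto_intros) (simp add: add.commute)
  qed (use C(2)[OF that] in auto)
  then show ?thesis using C(1) by blast
qed

lemma holo_map_gen: "holo_map UNIV gen"
  unfolding holo_map_def
proof
  fix i
  show "holo_fun UNIV (\<lambda>z. gen z $ i)"
  proof (rule holo_fun_limit[OF open_UNIV])
    show "holo_fun UNIV (\<lambda>z. quot k z $ i)" for k using holo_map_quot by (simp add: holo_map_def)
    fix z :: "complex ^ 'n"
    obtain C m where C_: "C > 0 \<and> (\<forall>k w. k \<ge> m \<longrightarrow> norm w \<le> norm z + 1 \<longrightarrow> norm (quot k w - gen w) \<le> C / 2 ^ k)"
      using gen_rate[where R = "norm z + 1"] by (elim exE) (rule that)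
    note C = C_[THEN conjunct1] C_[THEN conjunct2, rule_format]
    have "uniform_limit (ball z 1) (\<lambda>k w. quot k w $ i) (\<lambda>w. gen w $ i) sequentially"
      unfolding uniform_limit_iff
    proof (intro allI impI)
      fix e :: real assume e: "e > 0"
      have "(\<lambda>k. C / 2 ^ k) \<longlonglongrightarrow> 0" by real_asymp
      then have "\<forall>\<^sub>F k in sequentially. C / 2 ^ k < e" using e by (rule order_tendstoD)
      then show "\<forall>\<^sub>F k in sequentially. \<forall>w\<in>ball z 1. dist (quot k w $ i) (gen w $ i) < e"
        using eventually_ge_at_top[of m]
      proof eventually_elim
        case (elim k)
        show ?case
        proof
          fix w assume "w \<in> ball z 1"
          then have "norm w \<le> norm z + 1" using norm_triangle_sub[of w z] by (simp add: dist_norm norm_minus_commute)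
          from C(2)[OF elim(2) this] have "norm ((quot k w - gen w) $ i) < e"
            using Finite_Cartesian_Product.norm_nth_le[of "quot k w - gen w" i] elim(1) by linarith
          then show "dist (quot k w $ i) (gen w $ i) < e" by (simp add: dist_norm)
        qed
      qed
    qed
    then show "\<exists>U. open U \<and> z \<in> U \<and> uniform_limit (U \<inter> UNIV) (\<lambda>k w. quot k w $ i) (\<lambda>w. gen w $ i) sequentially"
      by (intro exI[of _ "ball z 1"]) auto
  qed
qed

text \<open>A mean value inequality obtained before differentiability in time is known: the
  increment is a sum of dyadic steps, each governed by \<open>quot k\<close> and so by
  \<open>gen\<close> up to a uniform rate; then \<open>k\<close> tends to infinity.\<close>

lemma flow_increment:
  assumes s: "s \<le> s'" and v: "\<And>r. s \<le> r \<Longrightarrow> r \<le> s' \<Longrightarrow> norm (gen (\<theta> (r, z)) - v) \<le> \<epsilon>"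
  shows "norm (\<theta> (s', z) - \<theta> (s, z) - (s' - s) *\<^sub>R v) \<le> (s' - s) * \<epsilon>"
proof -
  have "continuous_on {s..s'} (\<lambda>r. \<theta> (r, z))" by (intro cont_compose continuous_intros)
  then obtain R where R: "\<And>r. r \<in> {s..s'} \<Longrightarrow> norm (\<theta> (r, z)) \<le> R"
    using compact_norm_bound[of "{s..s'}" "\<lambda>r. \<theta> (r, z)"] by auto
  obtain C m where C_: "C > 0 \<and> (\<forall>k w. k \<ge> m \<longrightarrow> norm w \<le> R \<longrightarrow> norm (quot k w - gen w) \<le> C / 2 ^ k)"
    using gen_rate[where R = R] by (elim exE) (rule that)
  note C = C_[THEN conjunct1] C_[THEN conjunct2, rule_format]
  \<comment> \<open>The number of whole steps \<open>1 / 2 ^ k\<close> that fit between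
    \<open>s\<close> and \<open>s'\<close>; the missing end piece disappears by continuity in
    time.\<close>
  define N where "N k = nat \<lfloor>(s' - s) * 2 ^ k\<rfloor>" for k
  have N: "real (N k) = of_int \<lfloor>(s' - s) * 2 ^ k\<rfloor>" for k using s by (simp add: N_def)
  define r where "r k = real (N k) / 2 ^ k" for k
  have r_lim: "r \<longlonglongrightarrow> s' - s" unfolding r_def N by real_asymp
  have Nk: "real (N k) \<le> (s' - s) * 2 ^ k" for k unfolding N by linarith
  have bound: "norm (\<theta> (s + r k, z) - \<theta> (s, z) - r k *\<^sub>R v) \<le> r k * (\<epsilon> + C / 2 ^ k)" if k: "k \<ge> m" for k
  proof -
    have "\<theta> (s + r k, z) - \<theta> (s, z) - r k *\<^sub>R v = (\<Sum>j<N k. (1 / 2 ^ k) *\<^sub>R (quot k (\<theta> (s + real j / 2 ^ k, z)) - v))"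
      unfolding r_def telescope by (simp add: scaleR_diff_right sum_subtractf sum_constant_scaleR del: sum_constant)
    also have "norm \<dots> \<le> (\<Sum>j<N k. 1 / 2 ^ k * (\<epsilon> + C / 2 ^ k))"
    proof (intro order_trans[OF norm_sum] sum_mono)
      fix j assume "j \<in> {..<N k}"
      then have "real j \<le> real (N k)" by simp
      also have "\<dots> \<le> (s' - s) * 2 ^ k" by (rule Nk)
      finally have "real j / 2 ^ k \<le> s' - s" by (simp add: pos_divide_le_eq)
      then have j: "s \<le> s + real j / 2 ^ k" "s + real j / 2 ^ k \<le> s'" by auto
      have 1: "norm (gen (\<theta> (s + real j / 2 ^ k, z)) - v) \<le> \<epsilon>" by (rule v[OF j])
      have 2: "norm (quot k (\<theta> (s + real j / 2 ^ k, z)) - gen (\<theta> (s + real j / 2 ^ k, z))) \<le> C / 2 ^ k"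
        by (rule C(2)[OF k]) (use R j in auto)
      have "norm (quot k (\<theta> (s + real j / 2 ^ k, z)) - v) \<le> \<epsilon> + C / 2 ^ k"
        using norm_triangle_ineq[of "gen (\<theta> (s + real j / 2 ^ k, z)) - v"
          "quot k (\<theta> (s + real j / 2 ^ k, z)) - gen (\<theta> (s + real j / 2 ^ k, z))"] 1 2 by simp
      then show "norm ((1 / 2 ^ k) *\<^sub>R (quot k (\<theta> (s + real j / 2 ^ k, z)) - v)) \<le> 1 / 2 ^ k * (\<epsilon> + C / 2 ^ k)"
        by (simp add: divide_right_mono)
    qed
    also have "\<dots> = r k * (\<epsilon> + C / 2 ^ k)" by (simp add: r_def)
    finally show ?thesis .
  qed
  have "continuous_on UNIV (\<lambda>t. \<theta> (t, z))" by (intro cont_compose continuous_intros)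
  then have "isCont (\<lambda>t. \<theta> (t, z)) (s + (s' - s))" by (simp add: continuous_on_eq_continuous_at)
  then have "(\<lambda>k. \<theta> (s + r k, z)) \<longlonglongrightarrow> \<theta> (s + (s' - s), z)"
    by (rule isCont_tendsto_compose) (intro tendsto_intros r_lim)
  then have "(\<lambda>k. norm (\<theta> (s + r k, z) - \<theta> (s, z) - r k *\<^sub>R v)) \<longlonglongrightarrow> norm (\<theta> (s', z) - \<theta> (s, z) - (s' - s) *\<^sub>R v)"
    by (intro tendsto_intros r_lim) simp
  moreover have "(\<lambda>k. C / 2 ^ k) \<longlonglongrightarrow> 0" by real_asymp
  then have "(\<lambda>k. r k * (\<epsilon> + C / 2 ^ k)) \<longlonglongrightarrow> (s' - s) * (\<epsilon> + 0)" by (intro tendsto_intros r_lim)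
  ultimately show ?thesis using LIMSEQ_le bound by fastforce
qed

text \<open>The reference velocity in \<open>flow_increment\<close> is taken at \<open>t\<close>,
  which may be either end of the time interval; this settles both signs of the increment.\<close>

theorem has_vector_derivative_flow:
  "((\<lambda>t. \<theta> (t, z)) has_vector_derivative gen (\<theta> (t, z))) (at t)"
  unfolding has_vector_derivative_def has_derivative_at_alt
proof (intro conjI allI impI)
  show "bounded_linear (\<lambda>h. h *\<^sub>R gen (\<theta> (t, z)))" by (rule bounded_linear_scaleR_left)
  fix e :: real assume e: "e > 0"
  have "continuous_on UNIV (\<lambda>r. gen (\<theta> (r, z)))"
    by (rule continuous_on_compose2[OF holo_map_continuous[OF holo_map_gen]]) (auto intro!: cont_compose continuous_intros)
  then have "isCont (\<lambda>r. gen (\<theta> (r, z))) t" by (simp add: continuous_on_eq_continuous_at)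
  then obtain d where d: "d > 0" "\<And>r. dist r t < d \<Longrightarrow> dist (gen (\<theta> (r, z))) (gen (\<theta> (t, z))) < e"
    unfolding continuous_at_eps_delta using e by blast
  show "\<exists>d>0. \<forall>y. norm (y - t) < d \<longrightarrow>
      norm (\<theta> (y, z) - \<theta> (t, z) - (y - t) *\<^sub>R gen (\<theta> (t, z))) \<le> e * norm (y - t)"
  proof (intro exI[of _ d] conjI allI impI d(1))
    fix y assume y: "norm (y - t) < d"
    have near: "norm (gen (\<theta> (r, z)) - gen (\<theta> (t, z))) \<le> e" if "min y t \<le> r" "r \<le> max y t" for r
      using d(2)[of r] y that by (auto simp: dist_real_def dist_norm min_def max_def split: if_splits)
    show "norm (\<theta> (y, z) - \<theta> (t, z) - (y - t) *\<^sub>R gen (\<theta> (t, z))) \<le> e * norm (y - t)"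
    proof (cases "t \<le> y")
      case True
      then show ?thesis using flow_increment[of t y z "gen (\<theta> (t, z))" e] near by (simp add: mult.commute)
    next
      case False
      then have "norm (\<theta> (t, z) - \<theta> (y, z) - (t - y) *\<^sub>R gen (\<theta> (t, z))) \<le> (t - y) * e"
        using flow_increment[of y t z "gen (\<theta> (t, z))" e] near by simp
      moreover have "\<theta> (y, z) - \<theta> (t, z) - (y - t) *\<^sub>R gen (\<theta> (t, z))
          = - (\<theta> (t, z) - \<theta> (y, z) - (t - y) *\<^sub>R gen (\<theta> (t, z)))" by (simp add: algebra_simps)
      ultimately show ?thesis using False by (simp only: norm_minus_cancel) (simp add: mult.commute)
    qed
  qed
qed

end

section \<open>Approximation by automorphisms\<close>

text \<open>Serves to show that a map uniformly close to \<open>G\<close> on \<open>K\<close> takes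
  only values of \<open>G\<close> at points close to the original ones. The reason is uniform
  continuity of the inverse on a compact neighbourhood of the image of \<open>K\<close>.\<close>

lemma injective_holo_perturb:
  fixes G :: "complex ^ 'n \<Rightarrow> complex ^ 'n"
  assumes \<Omega>: "open \<Omega>" and G: "holo_map \<Omega> G" "inj_on G \<Omega>" and K: "compact K" "K \<subseteq> \<Omega>" and r: "r > 0"
  shows "\<exists>\<rho>>0. \<forall>z\<in>K. \<forall>y. norm (y - G z) \<le> \<rho> \<longrightarrow> (\<exists>x\<in>\<Omega>. G x = y \<and> norm (x - z) < r)"
proof -
  note U = holo_map_inv_into(1)[OF \<Omega> G] and H = holo_map_inv_into(2)[OF \<Omega> G]
  have GK: "compact (G ` K)" "G ` K \<subseteq> G ` \<Omega>"
    using compact_continuous_image[OF continuous_on_subset[OF holo_map_continuous[OF G(1)] K(2)] K(1)] K(2) by auto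
  obtain d where d: "d > 0" "compact (\<Union>y\<in>G ` K. cball y d)" "(\<Union>y\<in>G ` K. cball y d) \<subseteq> G ` \<Omega>"
    using compact_cball_nbhd[OF GK(1) U GK(2)] by blast
  obtain d' where d': "d' > 0" "\<And>x y. x \<in> (\<Union>y\<in>G ` K. cball y d) \<Longrightarrow> y \<in> (\<Union>y\<in>G ` K. cball y d) \<Longrightarrow>
      dist y x < d' \<Longrightarrow> dist (inv_into \<Omega> G y) (inv_into \<Omega> G x) < r"
    using uniformly_continuous_onE[OF d(2) continuous_on_subset[OF holo_map_continuous[OF H] d(3)] r] by blast
  show ?thesis
  proof (intro exI[of _ "min d (d' / 2)"] conjI ballI allI impI)
    show "0 < min d (d' / 2)" using d(1) d'(1) by simp
    fix z y assume z: "z \<in> K" and y: "norm (y - G z) \<le> min d (d' / 2)"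
    have in1: "y \<in> (\<Union>y\<in>G ` K. cball y d)" using z y by (auto simp: dist_norm norm_minus_commute)
    have in2: "G z \<in> (\<Union>y\<in>G ` K. cball y d)" using z d(1) by (intro UN_I[of "G z"]) auto
    have "dist y (G z) < d'" using y d'(1) by (simp add: dist_norm)
    from d'(2)[OF in2 in1 this] have "dist (inv_into \<Omega> G y) z < r"
      using z K(2) by (simp add: inv_into_f_f[OF G(2)] subset_iff)
    moreover have "y \<in> G ` \<Omega>" using in1 d(3) by blast
    ultimately show "\<exists>x\<in>\<Omega>. G x = y \<and> norm (x - z) < r"
      by (intro bexI[of _ "inv_into \<Omega> G y"]) (auto simp: f_inv_into_f inv_into_into dist_norm)
  qed
qed

text \<open>Near a point \<open>G\<close> is close to its affine part \<open>L\<close>, so an automorphism approximating the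
  dilation flow transported by \<open>G\<close> takes \<open>L (s *s z)\<close>, for small \<open>s\<close>, close to \<open>G z\<close>.\<close>

lemma approx_on_ball:
  fixes G :: "complex ^ 'n \<Rightarrow> complex ^ 'n"
  assumes n: "CARD('n) \<ge> 2" and \<Omega>: "open \<Omega>" and G: "holo_map \<Omega> G" "inj_on G \<Omega>" "runge_in (G ` \<Omega>) UNIV"
    and R: "0 < r" "r < R" "cball 0 R \<subseteq> \<Omega>" and e: "e > 0"
  shows "\<exists>\<Phi>\<in>holo_aut. \<forall>z\<in>cball 0 r. norm (\<Phi> z - G z) \<le> e"
proof -
  define H where "H = inv_into \<Omega> G"
  define U where "U = G ` \<Omega>"
  have U: "open U" and HU: "holo_map U H"
    unfolding H_def U_def by (rule holo_map_inv_into[OF \<Omega> G(1,2)])+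
  have HG: "H (G z) = z" if "z \<in> \<Omega>" for z using G(2) that by (simp add: H_def)
  have GH: "G (H y) = y" if "y \<in> U" for y using that by (auto simp: H_def U_def f_inv_into_f)
  have zero: "0 \<in> \<Omega>" using R by auto
  then have G0: "G 0 \<in> U" "H (G 0) = 0" using HG by (auto simp: U_def)
  define D where "D = jac_mat G 0"
  define B where "B = jac_mat H (G 0)"
  have dG: "(G has_derivative (\<lambda>v. D *v v)) (at 0)" unfolding D_def by (rule has_derivative_jac_mat[OF \<Omega> G(1) zero])
  have dH: "(H has_derivative (\<lambda>v. B *v v)) (at (G 0))" unfolding B_def by (rule has_derivative_jac_mat[OF U HU G0(1)])
  have "((\<lambda>z. H (G z)) has_derivative (\<lambda>v. B *v (D *v v))) (at 0)" by (rule has_derivative_compose[OF dG dH])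
  moreover have "((\<lambda>z. H (G z)) has_derivative (\<lambda>v. v)) (at 0)"
    by (rule has_derivative_transform_within_open[of "\<lambda>z. z" _ _ _ \<Omega>]) (use \<Omega> zero HG in auto)
  ultimately have "(\<lambda>v. B *v (D *v v)) = (\<lambda>v. v)" by (rule has_derivative_unique)
  then have BD: "B *v (D *v v) = v" for v by (rule fun_cong)
  have "((\<lambda>y. G (H y)) has_derivative (\<lambda>v. D *v (B *v v))) (at (G 0))"
    by (rule has_derivative_compose[OF dH]) (use dG G0 in simp)
  moreover have "((\<lambda>y. G (H y)) has_derivative (\<lambda>v. v)) (at (G 0))"
    by (rule has_derivative_transform_within_open[of "\<lambda>z. z" _ _ _ U]) (use U G0 GH in auto)
  ultimately have "(\<lambda>v. D *v (B *v v)) = (\<lambda>v. v)" by (rule has_derivative_unique)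
  then have DB: "D *v (B *v v) = v" for v by (rule fun_cong)
  define M where "M = (\<Sum>i\<in>UNIV. \<Sum>j\<in>UNIV. cmod (D $ i $ j)) + 1"
  have M: "M > 0" unfolding M_def by (intro add_nonneg_pos sum_nonneg) auto
  have normD: "norm (D *v v) \<le> M * norm v" for v
    using norm_matrix_vector_le[of D v] by (simp add: M_def distrib_right add_increasing2)
  have GR: "continuous_on (cball 0 R) G" using holo_map_continuous[OF G(1)] R(3) by (rule continuous_on_subset)
  obtain d1 where d1: "d1 > 0" "\<And>x y. x \<in> cball 0 R \<Longrightarrow> y \<in> cball 0 R \<Longrightarrow> dist y x < d1 \<Longrightarrow> dist (G y) (G x) < e / 2"
    using uniformly_continuous_onE[OF compact_cball GR, of "e / 2"] e by auto
  \<comment> \<open>The admissible final deviation: up to \<open>R - r\<close> the expanded points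
    stay in \<open>cball 0 R\<close>, and below \<open>d1\<close> the values of \<open>G\<close>
    differ by less than \<open>e / 2\<close>.\<close>
  define q where "q = min (R - r) (d1 / 2)"
  have q: "q > 0" "q \<le> R - r" "q < d1" using R d1(1) by (auto simp: q_def)
  \<comment> \<open>The relative linearisation error of \<open>H\<close> that yields a deviation
    \<open>s * q\<close> at scale \<open>s\<close>; expansion by \<open>1 / s\<close> turns it into
    \<open>q\<close>.\<close>
  define \<epsilon> where "\<epsilon> = q / (M * r)"
  have \<epsilon>: "\<epsilon> > 0" using q M R by (simp add: \<epsilon>_def)
  have "\<exists>d>0. \<forall>y. norm (y - G 0) < d \<longrightarrow> norm (H y - H (G 0) - B *v (y - G 0)) \<le> \<epsilon> * norm (y - G 0)"
    using dH \<epsilon> unfolding has_derivative_at_alt by blast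
  then obtain d0 where d0: "d0 > 0" "\<forall>y. norm (y - G 0) < d0 \<longrightarrow> norm (H y - H (G 0) - B *v (y - G 0)) \<le> \<epsilon> * norm (y - G 0)"
    by blast
  obtain d2 where d2: "d2 > 0" "ball (G 0) d2 \<subseteq> U" using U G0 open_contains_ball by blast
  define s where "s = min (1 / 2) (min d0 d2 / (2 * (M * r)))"
  have Mr: "M * r > 0" using M R by simp
  have s: "s > 0" "s < 1" using d0 d2 Mr by (auto simp: s_def)
  have "s \<le> min d0 d2 / (2 * (M * r))" by (simp add: s_def)
  then have "s * (2 * (M * r)) \<le> min d0 d2" using Mr by (simp add: pos_le_divide_eq)
  moreover have "s * (2 * (M * r)) = 2 * (s * (M * r))" by simp
  moreover have "s * (M * r) > 0" using s(1) Mr by (rule mult_pos_pos)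
  ultimately have sM: "s * (M * r) < d0" "s * (M * r) < d2" by linarith+
  define L where "L z = G 0 + D *v (s *\<^sub>R z)" for z
  have L: "L \<in> holo_aut"
  proof -
    have "bij L"
    proof (rule bij_by_inverse[of "\<lambda>y. (1 / s) *\<^sub>R (B *v (y - G 0))"])
      show "(1 / s) *\<^sub>R (B *v (L z - G 0)) = z" for z using s(1) by (simp add: L_def BD)
      show "L ((1 / s) *\<^sub>R (B *v (y - G 0))) = y" for y using s(1) by (simp add: L_def DB)
    qed
    moreover have "holo_map UNIV L"
      unfolding holo_map_def L_def matrix_vector_mult_def
      by (auto simp: scaleR_conv_of_real[where 'a = complex] intro!: holo_fun_add holo_fun_sum holo_fun_mult)
    ultimately show ?thesis by (simp add: holo_aut_def)
  qed
  have near: "L z \<in> U \<and> norm (H (L z) - s *\<^sub>R z) \<le> s * q" if z: "z \<in> cball 0 r" for z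
  proof -
    have "norm (D *v (s *\<^sub>R z)) \<le> M * (s * r)"
      using normD[of "s *\<^sub>R z"] z s(1) M by (elim order_trans) (simp add: mult_left_mono)
    then have D1: "norm (D *v (s *\<^sub>R z)) \<le> s * (M * r)" by (simp add: mult_ac)
    then have "L z \<in> ball (G 0) d2" using sM by (simp add: L_def dist_norm)
    moreover have "norm (H (L z) - s *\<^sub>R z) \<le> \<epsilon> * norm (D *v (s *\<^sub>R z))"
      using d0(2)[rule_format, of "L z"] D1 sM by (simp add: L_def G0 BD)
    moreover have "\<epsilon> * norm (D *v (s *\<^sub>R z)) \<le> \<epsilon> * (s * (M * r))" using D1 \<epsilon> by (intro mult_left_mono) auto
    moreover have "\<epsilon> * (s * (M * r)) = s * q" using M R(1) by (simp add: \<epsilon>_def)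
    ultimately show ?thesis using d2(2) by auto
  qed
  \<comment> \<open>The time in which the dilation flow expands by the factor
    \<open>1 / s\<close>.\<close>
  define T where "T = ln (1 / s)"
  have T: "T > 0" "exp T = 1 / s" using s by (auto simp: T_def)
  \<comment> \<open>The flow of the identity field. Starting at \<open>H (L z)\<close> instead of
    \<open>s *\<^sub>R z\<close> makes \<open>G (\<phi> 0 z) = L z\<close> exact, and the deviation
    is felt only at time \<open>T\<close>.\<close>
  define \<phi> where "\<phi> t z = exp t *\<^sub>R H (L z)" for t :: real and z
  have \<phi>R: "\<phi> t z \<in> cball 0 R" if t: "t \<in> {0..T}" and z: "z \<in> cball 0 r" for t z
  proof -
    have "norm (H (L z)) \<le> norm (s *\<^sub>R z) + norm (H (L z) - s *\<^sub>R z)" by (rule norm_triangle_sub)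
    also have "\<dots> \<le> s * r + s * (R - r)"
      using near[OF z] z s(1) q(2) by (intro add_mono) (auto intro: mult_left_mono order_trans)
    finally have "norm (H (L z)) \<le> s * R" by (simp add: algebra_simps)
    moreover have "exp t \<le> 1 / s" using t T(2) by (metis atLeastAtMost_iff exp_le_cancel_iff)
    ultimately have "exp t * norm (H (L z)) \<le> 1 / s * (s * R)" using s(1) by (intro mult_mono) auto
    then show ?thesis using s(1) by (simp add: \<phi>_def)
  qed
  have "\<exists>A\<in>holo_aut. \<forall>z\<in>cball 0 r. norm (A (G (\<phi> 0 z)) - G (\<phi> T z)) \<le> e / 2"
  proof (rule transported_flow_approx[OF n \<Omega> G holo_map_id compact_cball T(1)])
    have cL: "continuous_on UNIV L" using L by (auto simp: holo_aut_def intro: holo_map_continuous)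
    have "continuous_on (cball 0 r) (\<lambda>z. H (L z))"
      by (rule continuous_on_compose2[OF holo_map_continuous[OF HU] continuous_on_subset[OF cL subset_UNIV]]) (use near in blast)
    then have "continuous_on ({0..T} \<times> cball 0 r) (\<lambda>p. H (L (snd p)))"
      by (rule continuous_on_compose2) (auto intro!: continuous_intros)
    then show "continuous_on ({0..T} \<times> cball 0 r) (\<lambda>p. \<phi> (fst p) (snd p))"
      unfolding \<phi>_def by (intro continuous_intros)
    show "\<phi> t z \<in> \<Omega>" if "t \<in> {0..T}" "z \<in> cball 0 r" for t z using \<phi>R[OF that] R(3) by blast
    show "((\<lambda>t. \<phi> t z) has_vector_derivative \<phi> t z) (at t within {0..T})" for t z
      unfolding \<phi>_def by (auto intro!: derivative_eq_intros)
  qed (use e in simp)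
  then obtain A where A: "A \<in> holo_aut" "\<forall>z\<in>cball 0 r. norm (A (G (\<phi> 0 z)) - G (\<phi> T z)) \<le> e / 2" by blast
  have "norm (A (L z) - G z) \<le> e" if z: "z \<in> cball 0 r" for z
  proof -
    have "G (\<phi> 0 z) = L z" using near[OF z] GH by (simp add: \<phi>_def)
    then have 1: "norm (A (L z) - G (\<phi> T z)) \<le> e / 2" using A(2) z by metis
    have "\<phi> T z - z = (1 / s) *\<^sub>R (H (L z) - s *\<^sub>R z)"
      using s(1) T(2) by (simp add: \<phi>_def scaleR_diff_right)
    then have "norm (\<phi> T z - z) = norm (H (L z) - s *\<^sub>R z) / s" using s(1) by simp
    also have "\<dots> \<le> q" using near[OF z] s(1) by (simp add: pos_divide_le_eq mult.commute)
    finally have "dist (\<phi> T z) z < d1" using q(3) by (simp add: dist_norm)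
    then have "dist (G (\<phi> T z)) (G z) < e / 2"
      using d1(2)[of z "\<phi> T z"] \<phi>R[of T z] z T(1) R(2) by auto
    then show ?thesis using norm_triangle_ineq[of "A (L z) - G (\<phi> T z)" "G (\<phi> T z) - G z"] 1 by (simp add: dist_norm)
  qed
  then show ?thesis using holo_aut_compose[OF A(1) L] by (intro bexI[of _ "\<lambda>z. A (L z)"]) auto
qed

section \<open>Flowing compact sets into \<open>\<Omega>\<close> and back\<close>

context holo_flow
begin

lemma flow_inverse: "\<theta> (- t, \<theta> (t, z)) = z" "\<theta> (t, \<theta> (- t, z)) = z"
  using plus[of "- t" t z] plus[of t "- t" z] zero by auto

lemma inj_flow: "inj_on (\<lambda>z. \<theta> (t, z)) S"
  by (rule inj_on_inverseI[where g = "\<lambda>z. \<theta> (- t, z)"]) (rule flow_inverse)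

text \<open>If \<open>F\<close> composed with \<open>\<theta> (T, \<cdot>)\<close> is approximable, so is \<open>F\<close>: flow back along the vector
  field on the image of \<open>F\<close> that corresponds to \<open>- gen\<close>.\<close>

lemma approx_flow_back:
  assumes n: "CARD('n) \<ge> 2" and \<Omega>: "open \<Omega>" and F: "holo_map \<Omega> F" "inj_on F \<Omega>" "runge_in (F ` \<Omega>) UNIV"
    and inv: "\<And>t z. t \<ge> 0 \<Longrightarrow> z \<in> \<Omega> \<Longrightarrow> \<theta> (t, z) \<in> \<Omega>" and K: "compact K" "K \<subseteq> \<Omega>" and T: "T > 0"
    and approx: "\<And>e. e > 0 \<Longrightarrow> \<exists>\<Phi>\<in>holo_aut. \<forall>z\<in>K. norm (\<Phi> z - F (\<theta> (T, z))) \<le> e"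
    and e: "e > 0"
  shows "\<exists>\<Phi>\<in>holo_aut. \<forall>z\<in>K. norm (\<Phi> z - F z) \<le> e"
proof -
  obtain d where d: "d > 0" "compact (\<Union>x\<in>K. cball x d)" "(\<Union>x\<in>K. cball x d) \<subseteq> \<Omega>"
    using compact_cball_nbhd[OF K(1) \<Omega> K(2)] by blast
  \<comment> \<open>A neighbourhood is needed because \<open>\<Phi> z\<close> will be the value of
    \<open>F\<close> after \<open>\<theta> (T, \<cdot>)\<close> at a point near \<open>z\<close>
    that may lie outside \<open>K\<close>.\<close>
  define K' where "K' = (\<Union>x\<in>K. cball x d)"
  have K': "compact K'" "K' \<subseteq> \<Omega>" using d by (auto simp: K'_def)
  obtain d1 where d1: "d1 > 0" "\<And>x y. x \<in> K' \<Longrightarrow> y \<in> K' \<Longrightarrow> dist y x < d1 \<Longrightarrow> dist (F y) (F x) < e / 2"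
    using uniformly_continuous_onE[OF K'(1) continuous_on_subset[OF holo_map_continuous[OF F(1)] K'(2)], of "e / 2"] e by auto
  have "\<exists>A\<in>holo_aut. \<forall>x\<in>K'. norm (A (F (\<theta> (T - 0, x))) - F (\<theta> (T - T, x))) \<le> e / 2"
  \<comment> \<open>The times \<open>T - t\<close> stay nonnegative, so forward invariance keeps the
    reversed curves inside \<open>\<Omega>\<close>.\<close>
  proof (rule transported_flow_approx[OF n \<Omega> F _ K'(1) T, where \<phi> = "\<lambda>t x. \<theta> (T - t, x)"])
    show "holo_map \<Omega> (\<lambda>z. - gen z)"
      using holo_map_subset[OF holo_map_gen subset_UNIV] unfolding holo_map_def by (auto intro!: holo_fun_uminus)
    show "continuous_on ({0..T} \<times> K') (\<lambda>p. \<theta> (T - fst p, snd p))"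
      by (intro cont_compose continuous_intros)
    show "\<theta> (T - t, x) \<in> \<Omega>" if "t \<in> {0..T}" "x \<in> K'" for t x using inv that K'(2) by auto
    show "((\<lambda>t. \<theta> (T - t, x)) has_vector_derivative - gen (\<theta> (T - t, x))) (at t within {0..T})" for t x
    proof -
      have "((\<lambda>t. T - t) has_real_derivative - 1) (at t)" by (auto intro!: derivative_eq_intros)
      from vector_diff_chain_at[OF this[unfolded has_real_derivative_iff_has_vector_derivative] has_vector_derivative_flow[of x "T - t"]]
      show ?thesis by (simp add: o_def has_vector_derivative_at_within)
    qed
  qed (use e in simp)
  then obtain A where A: "A \<in> holo_aut" "\<forall>x\<in>K'. norm (A (F (\<theta> (T, x))) - F x) \<le> e / 2"
    by (auto simp: zero)
  have r: "min d d1 > 0" using d(1) d1(1) by simp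
  have G: "holo_map \<Omega> (\<lambda>z. F (\<theta> (T, z)))"
    by (rule holo_map_compose[OF F(1) holo_map_subset[OF holo subset_UNIV] \<Omega> \<Omega>]) (use inv T in auto)
  have injG: "inj_on (\<lambda>z. F (\<theta> (T, z))) \<Omega>"
  proof (rule inj_onI)
    fix x y assume xy: "x \<in> \<Omega>" "y \<in> \<Omega>" "F (\<theta> (T, x)) = F (\<theta> (T, y))"
    then have "\<theta> (T, x) = \<theta> (T, y)" using inj_onD[OF F(2) xy(3)] inv T by simp
    then show "x = y" using flow_inverse(1) by metis
  qed
  \<comment> \<open>\<open>A\<close> is controlled only at the points
    \<open>F (\<theta> (T, x))\<close> with \<open>x\<close> in \<open>K'\<close>; closeness
    \<open>\<rho>\<close> guarantees that \<open>\<Phi> z\<close> is one of them.\<close>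
  obtain \<rho> where \<rho>: "\<rho> > 0" "\<forall>z\<in>K. \<forall>y. norm (y - F (\<theta> (T, z))) \<le> \<rho> \<longrightarrow> (\<exists>x\<in>\<Omega>. F (\<theta> (T, x)) = y \<and> norm (x - z) < min d d1)"
    using injective_holo_perturb[OF \<Omega> G injG K r] by blast
  obtain \<Phi> where \<Phi>: "\<Phi> \<in> holo_aut" "\<forall>z\<in>K. norm (\<Phi> z - F (\<theta> (T, z))) \<le> \<rho>" using approx[OF \<rho>(1)] by blast
  have "norm (A (\<Phi> z) - F z) \<le> e" if z: "z \<in> K" for z
  proof -
    obtain x where x: "F (\<theta> (T, x)) = \<Phi> z" "norm (x - z) < min d d1" using \<rho>(2) \<Phi>(2) z by blast
    have "x \<in> cball z d" using x(2) by (simp add: dist_norm norm_minus_commute)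
    then have xK: "x \<in> K'" using z unfolding K'_def by blast
    have zK: "z \<in> K'" using z d(1) unfolding K'_def by (intro UN_I[of z]) auto
    have 1: "norm (A (\<Phi> z) - F x) \<le> e / 2" using A(2) xK x(1) by metis
    have 2: "dist (F x) (F z) < e / 2" using d1(2)[OF zK xK] x(2) by (simp add: dist_norm)
    show ?thesis using norm_triangle_ineq[of "A (\<Phi> z) - F x" "F x - F z"] 1 2 by (simp add: dist_norm)
  qed
  then show ?thesis using holo_aut_compose[OF A(1) \<Phi>(1)] by (intro bexI[of _ "\<lambda>z. A (\<Phi> z)"]) auto
qed

text \<open>Forward invariance makes the open sets of points that have entered
  \<open>\<Omega>\<close> by time \<open>m\<close> increase with \<open>m\<close>, and the orbit
  condition makes them cover; compactness selects one time for the whole ball.\<close>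

lemma ball_flows_into:
  assumes \<Omega>: "open \<Omega>" and inv: "\<And>t z. t \<ge> 0 \<Longrightarrow> z \<in> \<Omega> \<Longrightarrow> \<theta> (t, z) \<in> \<Omega>"
    and orbit: "\<And>z. \<exists>t. \<theta> (t, z) \<in> \<Omega>"
  shows "\<exists>T>0. \<forall>z\<in>cball 0 R. \<theta> (T, z) \<in> \<Omega>"
proof -
  have mono: "\<theta> (t', z) \<in> \<Omega>" if "\<theta> (t, z) \<in> \<Omega>" "t \<le> t'" for t t' z
    using inv[of "t' - t" "\<theta> (t, z)"] that plus[of "t' - t" t z] by simp
  define V where "V m = (\<lambda>z. \<theta> (real m, z)) -` \<Omega>" for m :: nat
  have V: "open (V m)" if "m \<in> UNIV" for m unfolding V_def by (intro open_vimage \<Omega> cont_compose continuous_intros)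
  have in_V: "z \<in> (\<Union>m. V m)" for z
  proof -
    obtain t where "\<theta> (t, z) \<in> \<Omega>" using orbit by blast
    moreover obtain m where "t \<le> real m" using real_arch_simple by blast
    ultimately show ?thesis using mono by (auto simp: V_def)
  qed
  have cover: "cball 0 R \<subseteq> (\<Union>m\<in>UNIV. V m)" by (rule subsetI) (rule in_V)
  from compactE_image[OF compact_cball V cover]
  obtain D where D: "finite D" "cball 0 R \<subseteq> (\<Union>m\<in>D. V m)" by metis
  \<comment> \<open>The inserted 1 keeps the time positive even if \<open>D\<close> is empty or
    contains only 0.\<close>
  define m where "m = Max (insert 1 D)"
  have "\<theta> (real m, z) \<in> \<Omega>" if z: "z \<in> cball 0 R" for z
  proof -
    obtain k where k: "k \<in> D" "z \<in> V k" using D(2) z by blast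
    have "real k \<le> real m" using D(1) k(1) by (simp add: m_def)
    then show ?thesis using mono k(2) by (auto simp: V_def)
  qed
  moreover have "1 \<le> m" using D(1) by (simp add: m_def)
  ultimately show ?thesis by (intro exI[of _ "real m"]) auto
qed

text \<open>The preimage \<open>\<Omega>'\<close> of \<open>\<Omega>\<close> under
  \<open>\<theta> (T, \<cdot>)\<close> contains a ball around \<open>K\<close>. As the flow map is
  onto, the composite has the same image on \<open>\<Omega>'\<close> as \<open>F\<close> has on
  \<open>\<Omega>\<close>, so its image is Runge too.\<close>

lemma approx_by_aut:
  assumes n: "CARD('n) \<ge> 2" and \<Omega>: "open \<Omega>" and F: "holo_map \<Omega> F" "inj_on F \<Omega>" "runge_in (F ` \<Omega>) UNIV"
    and inv: "\<And>t z. t \<ge> 0 \<Longrightarrow> z \<in> \<Omega> \<Longrightarrow> \<theta> (t, z) \<in> \<Omega>" and orbit: "\<And>z. \<exists>t. \<theta> (t, z) \<in> \<Omega>"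
    and K: "compact K" "K \<subseteq> \<Omega>" and e: "e > 0"
  shows "\<exists>\<Phi>\<in>holo_aut. \<forall>z\<in>K. norm (\<Phi> z - F z) \<le> e"
proof -
  obtain r where r: "r > 0" "\<forall>z\<in>K. norm z \<le> r" using compact_imp_bounded[OF K(1)] bounded_pos by blast
  \<comment> \<open>The extra unit of radius is the room that \<open>approx_on_ball\<close> requires
    around the ball on which it approximates.\<close>
  obtain T where T: "T > 0" "\<forall>z\<in>cball 0 (r + 1). \<theta> (T, z) \<in> \<Omega>"
    using ball_flows_into[OF \<Omega> inv orbit] by blast
  define \<Omega>' where "\<Omega>' = (\<lambda>z. \<theta> (T, z)) -` \<Omega>"
  have \<Omega>': "open \<Omega>'" unfolding \<Omega>'_def by (intro open_vimage \<Omega> cont_compose continuous_intros)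
  have img: "(\<lambda>z. \<theta> (T, z)) ` \<Omega>' = \<Omega>"
  proof (intro equalityI subsetI)
    fix y assume "y \<in> \<Omega>"
    then show "y \<in> (\<lambda>z. \<theta> (T, z)) ` \<Omega>'"
      by (intro image_eqI[of _ _ "\<theta> (- T, y)"]) (auto simp: \<Omega>'_def flow_inverse)
  qed (auto simp: \<Omega>'_def)
  have G: "holo_map \<Omega>' (\<lambda>z. F (\<theta> (T, z)))"
    by (rule holo_map_compose[OF F(1) holo_map_subset[OF holo subset_UNIV] \<Omega>' \<Omega>]) (simp add: img)
  have injG: "inj_on (\<lambda>z. F (\<theta> (T, z))) \<Omega>'"
    using comp_inj_on[OF inj_flow[of T \<Omega>'], of F] F(2) by (simp add: img o_def)
  have "(\<lambda>z. F (\<theta> (T, z))) ` \<Omega>' = F ` \<Omega>" using img by (metis image_image)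
  then have rungeG: "runge_in ((\<lambda>z. F (\<theta> (T, z))) ` \<Omega>') UNIV" using F(3) by simp
  have ball: "cball 0 (r + 1) \<subseteq> \<Omega>'" using T(2) by (auto simp: \<Omega>'_def)
  show ?thesis
  proof (rule approx_flow_back[OF n \<Omega> F inv K T(1) _ e])
    fix e :: real assume e: "e > 0"
    have "\<exists>\<Phi>\<in>holo_aut. \<forall>z\<in>cball 0 r. norm (\<Phi> z - F (\<theta> (T, z))) \<le> e"
      by (rule approx_on_ball[OF n \<Omega>' G injG rungeG r(1) _ ball e]) simp
    moreover have "K \<subseteq> cball 0 r" using r(2) by auto
    ultimately show "\<exists>\<Phi>\<in>holo_aut. \<forall>z\<in>K. norm (\<Phi> z - F (\<theta> (T, z))) \<le> e" by blast
  qed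
qed

end

text \<open>The comparison of the compact-open topology with uniform convergence on compact sets in
  the direction needed for closures, by induction on the generation of open sets. For a subbasic
  set, a closed tube around the compact image stays in the open target.\<close>

lemma openin_inj_holo_top_nbhd:
  fixes F :: "complex ^ 'n \<Rightarrow> complex ^ 'n"
  assumes "openin (inj_holo_top \<Omega>) V" "F \<in> V"
  shows "\<exists>K e. compact K \<and> K \<subseteq> \<Omega> \<and> e > 0 \<and>
    (\<forall>H\<in>inj_holo_maps \<Omega>. (\<forall>z\<in>K. norm (H z - F z) \<le> e) \<longrightarrow> H \<in> V)"
proof -
  let ?S = "{{F \<in> inj_holo_maps \<Omega>. F ` K \<subseteq> U} |K U. compact K \<and> K \<subseteq> \<Omega> \<and> open U}"
  have F: "continuous_on \<Omega> F"
  proof -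
    have "F \<in> inj_holo_maps \<Omega>" using assms openin_subset topspace_inj_holo_top by blast
    then show ?thesis by (auto simp: inj_holo_maps_def intro: holo_map_continuous)
  qed
  have "generate_topology_on ?S V"
    using assms(1) by (simp add: inj_holo_top_def openin_topology_generated_by_iff)
  then show ?thesis using assms(2)
  proof (induction rule: generate_topology_on.induct)
    case (Int a b)
    then obtain K1 e1 K2 e2 where
      "compact K1" "K1 \<subseteq> \<Omega>" "e1 > 0" "\<forall>H\<in>inj_holo_maps \<Omega>. (\<forall>z\<in>K1. norm (H z - F z) \<le> e1) \<longrightarrow> H \<in> a"
      "compact K2" "K2 \<subseteq> \<Omega>" "e2 > 0" "\<forall>H\<in>inj_holo_maps \<Omega>. (\<forall>z\<in>K2. norm (H z - F z) \<le> e2) \<longrightarrow> H \<in> b"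
      by auto
    then show ?case by (intro exI[of _ "K1 \<union> K2"] exI[of _ "min e1 e2"]) auto
  next
    case (UN \<K>)
    then obtain k where k: "k \<in> \<K>" "F \<in> k" by blast
    from UN.IH[OF this] show ?case using k(1) by blast
  next
    case (Basis s)
    then obtain K U where KU: "s = {F \<in> inj_holo_maps \<Omega>. F ` K \<subseteq> U}" "compact K" "K \<subseteq> \<Omega>" "open U" by blast
    then have "compact (F ` K)" "F ` K \<subseteq> U"
      using Basis compact_continuous_image[OF continuous_on_subset[OF F]] by auto
    then obtain d where d: "d > 0" "(\<Union>y\<in>F ` K. cball y d) \<subseteq> U" using compact_cball_nbhd KU(4) by metis
    have "H \<in> s" if "H \<in> inj_holo_maps \<Omega>" "\<forall>z\<in>K. norm (H z - F z) \<le> d" for H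
    proof -
      have "H z \<in> U" if z: "z \<in> K" for z
      proof -
        have "H z \<in> cball (F z) d" using \<open>\<forall>z\<in>K. norm (H z - F z) \<le> d\<close> z by (simp add: dist_norm norm_minus_commute)
        then show ?thesis using d(2) z by blast
      qed
      then show ?thesis using that(1) KU(1) by blast
    qed
    then show ?case using KU d(1) by blast
  qed simp
qed

lemma restrict_aut_inj_holo:
  assumes "\<Phi> \<in> holo_aut"
  shows "restrict \<Phi> \<Omega> \<in> inj_holo_maps \<Omega>"
proof -
  have "holo_map \<Omega> \<Phi>" "inj_on \<Phi> \<Omega>"
    using assms holo_map_subset[OF _ subset_UNIV] unfolding holo_aut_def by (auto simp: bij_def intro: inj_on_subset)
  then have "holo_map \<Omega> (restrict \<Phi> \<Omega>)" "inj_on (restrict \<Phi> \<Omega>) \<Omega>"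
    using holo_map_cong[of \<Omega> \<Phi> "restrict \<Phi> \<Omega>"] by (auto simp: inj_on_def)
  then show ?thesis by (simp add: inj_holo_maps_def)
qed

theorem theorem1p2:
  fixes \<theta> :: "real \<times> (complex ^ 'n) \<Rightarrow> complex ^ 'n"
    and \<Omega> :: "(complex ^ 'n) set"
  assumes "CARD('n) \<ge> 2"
    and "continuous_on UNIV \<theta>"
    and "\<And>z. \<theta> (0, z) = z"
    and "\<And>s t z. \<theta> (s + t, z) = \<theta> (s, \<theta> (t, z))"
    and "\<And>t. holo_map UNIV (\<lambda>z. \<theta> (t, z))"
    and "stein_domain \<Omega>"
    and "\<And>t. t \<ge> 0 \<Longrightarrow> (\<lambda>z. \<theta> (t, z)) ` \<Omega> \<subseteq> \<Omega>"
    and "\<And>z. range (\<lambda>t. \<theta> (t, z)) \<inter> \<Omega> \<noteq> {}"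
  shows "runge_inj_holo_maps \<Omega> \<subseteq> aut_closure \<Omega>"
proof
  interpret holo_flow \<theta> by unfold_locales (use assms(2-5) in auto)
  fix F assume "F \<in> runge_inj_holo_maps \<Omega>"
  then have F: "F \<in> inj_holo_maps \<Omega>" "holo_map \<Omega> F" "inj_on F \<Omega>" "runge_in (F ` \<Omega>) UNIV"
    by (auto simp: runge_inj_holo_maps_def inj_holo_maps_def)
  have \<Omega>: "open \<Omega>" using assms(6) by (simp add: stein_domain_def)
  have inv: "\<theta> (t, z) \<in> \<Omega>" if "t \<ge> 0" "z \<in> \<Omega>" for t z using assms(7) that by blast
  have orbit: "\<exists>t. \<theta> (t, z) \<in> \<Omega>" for z using assms(8)[of z] by auto
  show "F \<in> aut_closure \<Omega>"
    unfolding aut_closure_def in_closure_of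
  proof (intro conjI allI impI)
    show "F \<in> topspace (inj_holo_top \<Omega>)" using F(1) by (simp add: topspace_inj_holo_top)
    fix V assume V: "F \<in> V \<and> openin (inj_holo_top \<Omega>) V"
    from openin_inj_holo_top_nbhd[OF V[THEN conjunct2] V[THEN conjunct1]]
    obtain K e where K: "compact K" "K \<subseteq> \<Omega>" "e > 0"
      "\<forall>H\<in>inj_holo_maps \<Omega>. (\<forall>z\<in>K. norm (H z - F z) \<le> e) \<longrightarrow> H \<in> V"
      by (elim exE conjE) (rule that)
    have "\<exists>\<Phi>\<in>holo_aut. \<forall>z\<in>K. norm (\<Phi> z - F z) \<le> e"
      by (rule approx_by_aut[OF assms(1) \<Omega> F(2-4) _ orbit K(1-3)], rule inv)
    then obtain \<Phi> where \<Phi>: "\<Phi> \<in> holo_aut" "\<forall>z\<in>K. norm (\<Phi> z - F z) \<le> e"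
      by (elim bexE) (rule that)
    have "restrict \<Phi> \<Omega> \<in> V"
      using K(4)[rule_format, OF restrict_aut_inj_holo[OF \<Phi>(1)]] \<Phi>(2) K(2) by (auto simp: subset_iff)
    then show "\<exists>H. H \<in> (\<lambda>\<Phi>. restrict \<Phi> \<Omega>) ` holo_aut \<and> H \<in> V" using \<Phi>(1) by blast
  qed
qed

end
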